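(* Suppose that $1<q_1<q<\infty$ and $\frac{1}{q}=\frac{1-\theta}{q_1}$, with $\theta\in(0,1)$. Then $$\big[L^{q_1},BMO\big]_{\theta,q}=L^q.$$
   Context: Let $d\geq 1$ be an integer and $S=\mathbb{R}^d\ltimes\mathbb{R}^+$ the group with product $(x,a)\cdot(x',a')=(x+a\,x',a\,a')$, endowed with the right Haar measure $d\rho(x,a)=a^{-1}\,dx\,da$. Write $L^p=L^p(S,\rho)$ with norm $\|\cdot\|_p$. A Calderón--Zygmund set is a set $R=Q\times[ae^{-r},ae^r]$, where $Q$ is a dyadic cube in $\mathbb{R}^d$ of side $L$, $a\in\mathbb{R}^+$, $r>0$, and $e^2ar\leq L<e^8ar$ if $r<1$, while $ae^{2r}\leq L<ae^{8r}$ if $r\geq1$. $\mathcal{R}$ denotes the family of all Calderón--Zygmund sets. For $f\in L^1_{\mathrm{loc}}$, $f_R=\frac{1}{\rho(R)}\int_Rf\,d\rho$ and $\|f\|_*=\sup_{R\in\mathcal{R}}\frac{1}{\rho(R)}\int_R|f-f_R|\,d\rho$. $BMO$ is the space of all $f\in L^1_{\mathrm{loc}}$ with $\|f\|_*<\infty$, modulo constant functions, regarded as a normed space with norm $\|\cdot\|_*$ (so any two functions $f,g$ with $\|f-g\|_*=0$ are identified). Elements of $L^{p}$ spaces are identified with their classes modulo the same functions when forming sums with $BMO$. For two compatible normed spaces $X_0,X_1$, $t>0$ and $x\in X_0+X_1$, let $K(t,x;X_0,X_1)=\inf\{\|x_0\|_{X_0}+t\|x_1\|_{X_1}: x=x_0+x_1,\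 x_i\in X_i\}$. For $q\in[1,\infty]$, $\theta\in(0,1)$, the real interpolation space $[X_0,X_1]_{\theta,q}$ is the set of $x\in X_0+X_1$ for which $\|x\|_{\theta,q}<\infty$, where $\|x\|_{\theta,q}=\big(\int_0^\infty[t^{-\theta}K(t,x;X_0,X_1)]^q\frac{dt}{t}\big)^{1/q}$ if $q<\infty$ and $\|x\|_{\theta,\infty}=\sup_{t>0}t^{-\theta}K(t,x;X_0,X_1)$. Equality of interpolation spaces is understood with equivalence of norms. *)

theory Defs
  imports "HOL-Analysis.Analysis" "HOL-Library.Set_Algebras" "HOL-Library.Function_Algebras"
begin

section \<open>The group and its right Haar measure\<close>

text \<open>
  The group S is the half space below, with product (x, a) (x', a') = (x + a x', a a').
  The product enters only through the right Haar measure, which is given by its density 1/a.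
  Functions on S are represented by total functions; as the space of the measure rho is S,
  their values off S are irrelevant.
\<close>

definition S_set :: "((real^'n) \<times> real) set" where
  "S_set = UNIV \<times> {0<..}"

definition rho :: "((real^'n) \<times> real) measure" where
  "rho = restrict_space (density lborel (\<lambda>(x, a). ennreal (1 / a))) S_set"

type_synonym 'n S_fun = "(real^'n) \<times> real \<Rightarrow> complex"

section \<open>Calderon--Zygmund sets and mean oscillation\<close>

definition dyadic_cube :: "int \<Rightarrow> ('n \<Rightarrow> int) \<Rightarrow> (real^'n) set" where
  "dyadic_cube k m =
     {x. \<forall>i. 2 powi k * of_int (m i) \<le> x $ i \<and> x $ i < 2 powi k * (of_int (m i) + 1)}"

definition CZ_admissible :: "real \<Rightarrow> real \<Rightarrow> real \<Rightarrow> bool" where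
  "CZ_admissible L a r \<longleftrightarrow>
     (if r < 1 then exp 2 * a * r \<le> L \<and> L < exp 8 * a * r
      else a * exp (2 * r) \<le> L \<and> L < a * exp (8 * r))"

definition CZ_sets :: "((real^'n) \<times> real) set set" where
  "CZ_sets = {dyadic_cube k m \<times> {a * exp (- r) .. a * exp r} | k m a r.
     0 < a \<and> 0 < r \<and> CZ_admissible (2 powi k) a r}"

definition L1_loc :: "'n::finite S_fun set" where
  "L1_loc = {f \<in> borel_measurable rho.
     \<forall>K. compact K \<and> K \<subseteq> S_set \<longrightarrow> set_integrable rho K f}"

definition average :: "'n::finite S_fun \<Rightarrow> ((real^'n) \<times> real) set \<Rightarrow> complex" where
  "average f R = (1 / measure rho R) *\<^sub>R (LINT z:R|rho. f z)"

definition mean_osc :: "'n::finite S_fun \<Rightarrow> ((real^'n) \<times> real) set \<Rightarrow> real" where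
  "mean_osc f R = 1 / measure rho R * (LINT z:R|rho. norm (f z - average f R))"

definition bmo_seminorm :: "'n::finite S_fun \<Rightarrow> ennreal" where
  "bmo_seminorm f = (SUP R\<in>CZ_sets. ennreal (mean_osc f R))"

section \<open>The spaces as normed spaces of classes\<close>

text \<open>
  The common ambient space of the interpolation couple is the quotient of L1_loc by the functions
  with vanishing seminorm. These are not only the constants: no dyadic cube meets two different
  orthants, so a function that is constant on each orthant times (0, infinity) is among them.
  Elements of the quotient are represented by the sets bmo_class f, and their sum is
  the elementwise sum of sets from Set_Algebras (see bmo_class_add below).
\<close>

definition bmo_class :: "'n::finite S_fun \<Rightarrow> 'n S_fun set" where
  "bmo_class f = {g \<in> L1_loc. bmo_seminorm (\<lambda>z. g z - f z) = 0}"

record 'v normed_sp =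
  elems :: "'v set"
  nrm :: "'v \<Rightarrow> real"

definition Lp_fun :: "real \<Rightarrow> 'n::finite S_fun set" where
  "Lp_fun p = {f \<in> borel_measurable rho. integrable rho (\<lambda>z. norm (f z) powr p)}"

definition Lp_norm :: "real \<Rightarrow> 'n::finite S_fun \<Rightarrow> real" where
  "Lp_norm p f = (LINT z|rho. norm (f z) powr p) powr (1 / p)"

definition BMO_fun :: "'n::finite S_fun set" where
  "BMO_fun = {f \<in> L1_loc. bmo_seminorm f < \<infinity>}"

text \<open>
  Both norms of a class are taken over its representatives in the function space at hand:
  all representatives of a BMO class have the same seminorm (bmo_seminorm_cong below), and
  the representatives of a class in L^p that lie in L^p agree almost everywhere.
\<close>

definition Lp_space :: "real \<Rightarrow> 'n::finite S_fun set normed_sp" where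
  "Lp_space p = \<lparr>elems = bmo_class ` Lp_fun p, nrm = (\<lambda>c. INF f\<in>c \<inter> Lp_fun p. Lp_norm p f)\<rparr>"

definition BMO_space :: "'n::finite S_fun set normed_sp" where
  "BMO_space = \<lparr>elems = bmo_class ` BMO_fun, nrm = (\<lambda>c. INF f\<in>c. enn2real (bmo_seminorm f))\<rparr>"

section \<open>Real interpolation (second parameter finite)\<close>

definition K_functional :: "'v::plus normed_sp \<Rightarrow> 'v normed_sp \<Rightarrow> real \<Rightarrow> 'v \<Rightarrow> real" where
  "K_functional X0 X1 t x =
     Inf {nrm X0 x0 + t * nrm X1 x1 | x0 x1. x0 \<in> elems X0 \<and> x1 \<in> elems X1 \<and> x = x0 + x1}"

definition interp_integral ::
  "'v::plus normed_sp \<Rightarrow> 'v normed_sp \<Rightarrow> real \<Rightarrow> real \<Rightarrow> 'v \<Rightarrow> ennreal" where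
  "interp_integral X0 X1 \<theta> q x =
     (\<integral>\<^sup>+ t\<in>{0<..}. ennreal ((t powr (- \<theta>) * K_functional X0 X1 t x) powr q / t) \<partial>lborel)"

definition real_interpolation ::
  "'v::plus normed_sp \<Rightarrow> 'v normed_sp \<Rightarrow> real \<Rightarrow> real \<Rightarrow> 'v normed_sp" where
  "real_interpolation X0 X1 \<theta> q =
     \<lparr>elems = {x. (\<exists>x0\<in>elems X0. \<exists>x1\<in>elems X1. x = x0 + x1) \<and> interp_integral X0 X1 \<theta> q x < \<infinity>},
      nrm = (\<lambda>x. enn2real (interp_integral X0 X1 \<theta> q x) powr (1 / q))\<rparr>"

definition eq_equiv_norms :: "'v normed_sp \<Rightarrow> 'v normed_sp \<Rightarrow> bool" where
  "eq_equiv_norms X Y \<longleftrightarrow> elems X = elems Y \<and>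
     (\<exists>C>0. \<forall>x\<in>elems X. nrm X x \<le> C * nrm Y x \<and> nrm Y x \<le> C * nrm X x)"

section \<open>Sums and norms of classes are well defined\<close>

lemma CZ_set_integrable:
  fixes f :: "'n::finite S_fun"
  assumes f: "f \<in> L1_loc" and R: "R \<in> CZ_sets"
  shows "set_integrable rho R f"
proof -
  obtain k m a r where eq: "R = dyadic_cube k m \<times> {a * exp (- r) .. a * exp r}"
    and a: "0 < a" using R unfolding CZ_sets_def by blast
  define u :: "real^'n" where "u = (\<chi> i. 2 powi k * of_int (m i))"
  define v :: "real^'n" where "v = (\<chi> i. 2 powi k * (of_int (m i) + 1))"
  let ?K = "cbox u v \<times> {a * exp (- r) .. a * exp r}"
  have "compact ?K" by (intro compact_Times) auto
  moreover have KS: "?K \<subseteq> S_set"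
    using a by (auto simp: S_set_def intro: less_le_trans[of 0 "a * exp (- r)"])
  ultimately have K: "set_integrable rho ?K f" using f unfolding L1_loc_def by blast
  have sub: "R \<subseteq> ?K"
    unfolding eq dyadic_cube_def u_def v_def mem_box_cart
    by (auto simp: mem_box_cart less_imp_le)
  have "dyadic_cube k m = (\<Inter>i. {x::real^'n. 2 powi k * of_int (m i) \<le> x $ i} \<inter>
      {x. x $ i < 2 powi k * (of_int (m i) + 1)})"
    unfolding dyadic_cube_def by auto
  also have "\<dots> \<in> sets borel"
    by (intro sets.countable_INT' sets.Int borel_closed borel_open closed_Collect_le
        open_Collect_less continuous_intros) auto
  finally have D: "dyadic_cube k m \<in> sets (borel :: (real^'n) measure)" .
  have "R \<in> sets (borel \<Otimes>\<^sub>M borel)" unfolding eq using D by (intro pair_measureI) auto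
  then have Rb: "R \<in> sets borel" by (simp only: borel_prod)
  have "R = S_set \<inter> R" using sub KS by blast
  with Rb have "R \<in> sets rho"
    unfolding rho_def sets_restrict_space by (auto intro!: image_eqI[of _ _ R])
  from set_integrable_subset[OF K this sub] show ?thesis .
qed

lemma L1_loc_add:
  assumes "f \<in> L1_loc" "g \<in> L1_loc" shows "(\<lambda>z. f z + g z) \<in> L1_loc"
  using assms unfolding L1_loc_def by (auto intro: set_integral_add)

lemma L1_loc_diff:
  assumes "f \<in> L1_loc" "g \<in> L1_loc" shows "(\<lambda>z. f z - g z) \<in> L1_loc"
  using assms unfolding L1_loc_def by (auto intro: set_integral_diff)

lemma CZ_set_integrable_const:
  assumes R: "R \<in> CZ_sets" shows "set_integrable rho R (\<lambda>_. c :: complex)"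
proof (rule CZ_set_integrable[OF _ R])
  show "(\<lambda>_. c) \<in> (L1_loc :: 'n::finite S_fun set)"
    unfolding L1_loc_def
  proof safe
    fix K :: "((real^'n) \<times> real) set" assume K: "compact K" "K \<subseteq> S_set"
    show "set_integrable rho K (\<lambda>_. c)"
    proof (cases "K = {}")
      case False
      have cs: "compact (snd ` K)"
        using K(1) by (intro compact_continuous_image continuous_intros)
      then obtain s where s: "s \<in> snd ` K" "\<forall>t\<in>snd ` K. s \<le> t"
        using compact_attains_inf[of "snd ` K"] False by blast
      have s0: "0 < s" using s(1) K(2) by (auto simp: S_set_def)
      have Kb: "K \<in> sets borel" using K(1) by (simp add: borel_compact)
      then have Kr: "K \<in> sets rho"
        unfolding rho_def sets_restrict_space using K(2) by (auto intro!: image_eqI[of _ _ K])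
      have Sb: "S_set \<in> sets (borel :: ((real^'n) \<times> real) measure)"
        unfolding S_set_def by (intro borel_open open_Times) auto
      have m: "(\<lambda>(x, a). ennreal (1 / a)) \<in> borel_measurable (lborel :: ((real^'n) \<times> real) measure)"
        by (simp add: case_prod_beta borel_prod[symmetric])
      have "emeasure rho K = (\<integral>\<^sup>+z\<in>K. (case z of (x, a) \<Rightarrow> ennreal (1 / a)) \<partial>lborel)"
        unfolding rho_def using Kb Sb K(2) m
        by (subst emeasure_restrict_space) (auto simp: emeasure_density)
      also have "\<dots> \<le> (\<integral>\<^sup>+z. ennreal (1 / s) * indicator K z \<partial>lborel)"
        using s s0 by (intro nn_integral_mono)
          (force simp: indicator_def divide_simps intro!: ennreal_leI)
      also have "\<dots> = ennreal (1 / s) * emeasure lborel K"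
        using Kb by (simp add: nn_integral_cmult_indicator)
      also have "\<dots> < \<infinity>"
        using emeasure_bounded_finite[OF compact_imp_bounded[OF K(1)]]
        by (simp add: ennreal_mult_less_top)
      finally have "emeasure rho K < \<infinity>" .
      with Kr show ?thesis
        unfolding set_integrable_def by (intro integrable_scaleR_left integrable_real_indicator) auto
    qed (simp add: set_integrable_def)
  qed auto
qed

lemma mean_osc_add_le:
  assumes f: "f \<in> L1_loc" and g: "g \<in> L1_loc" and R: "R \<in> CZ_sets"
  shows "mean_osc (\<lambda>z. f z + g z) R \<le> mean_osc f R + mean_osc g R"
proof -
  note fi = CZ_set_integrable[OF f R] and gi = CZ_set_integrable[OF g R]
    and ci = CZ_set_integrable_const[OF R]
  have av: "average (\<lambda>z. f z + g z) R = average f R + average g R"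
    unfolding average_def by (simp add: set_integral_add(2)[OF fi gi] scaleR_add_right)
  have i1: "set_integrable rho R (\<lambda>z. norm (f z - average f R))"
    by (intro set_integrable_norm set_integral_diff fi ci)
  have i2: "set_integrable rho R (\<lambda>z. norm (g z - average g R))"
    by (intro set_integrable_norm set_integral_diff gi ci)
  have i3: "set_integrable rho R (\<lambda>z. norm (f z + g z - average (\<lambda>z. f z + g z) R))"
    by (intro set_integrable_norm set_integral_diff set_integral_add fi gi ci)
  have "(LINT z:R|rho. norm (f z + g z - average (\<lambda>z. f z + g z) R))
      \<le> (LINT z:R|rho. norm (f z - average f R) + norm (g z - average g R))"
    using norm_triangle_ineq[of "f _ - average f R" "g _ - average g R"]
    by (intro set_integral_mono i3 set_integral_add i1 i2) (simp add: av algebra_simps)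
  also have "\<dots> = (LINT z:R|rho. norm (f z - average f R)) + (LINT z:R|rho. norm (g z - average g R))"
    by (rule set_integral_add(2)[OF i1 i2])
  finally show ?thesis
    unfolding mean_osc_def by (simp add: divide_right_mono flip: add_divide_distrib)
qed

lemma mean_osc_nonneg: "0 \<le> mean_osc f R"
  unfolding mean_osc_def set_lebesgue_integral_def
  by (intro mult_nonneg_nonneg integral_nonneg_AE) auto

lemma bmo_seminorm_add_le:
  assumes "f \<in> L1_loc" "g \<in> L1_loc"
  shows "bmo_seminorm (\<lambda>z. f z + g z) \<le> bmo_seminorm f + bmo_seminorm g"
  unfolding bmo_seminorm_def
proof (rule SUP_least)
  fix R :: "((real^'a) \<times> real) set" assume R: "R \<in> CZ_sets"
  have "ennreal (mean_osc (\<lambda>z. f z + g z) R) \<le> ennreal (mean_osc f R) + ennreal (mean_osc g R)"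
    using mean_osc_add_le[OF assms R]
    by (simp add: mean_osc_nonneg ennreal_leI flip: ennreal_plus)
  also have "\<dots> \<le> (SUP R\<in>CZ_sets. ennreal (mean_osc f R)) + (SUP R\<in>CZ_sets. ennreal (mean_osc g R))"
    using R by (intro add_mono SUP_upper)
  finally show "ennreal (mean_osc (\<lambda>z. f z + g z) R) \<le> \<dots>" .
qed

lemma bmo_seminorm_minus: "bmo_seminorm (\<lambda>z. - f z) = bmo_seminorm f"
proof -
  have "average (\<lambda>z. - f z) R = - average f R" for R
    unfolding average_def set_lebesgue_integral_def by simp
  then have "mean_osc (\<lambda>z. - f z) R = mean_osc f R" for R
    unfolding mean_osc_def by (simp add: norm_minus_commute)
  then show ?thesis unfolding bmo_seminorm_def by simp
qed

lemma bmo_class_self: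
  assumes "f \<in> L1_loc" shows "f \<in> bmo_class f"
proof -
  have "mean_osc (\<lambda>z. f z - f z) R = 0" for R
    by (simp add: mean_osc_def average_def)
  then have "bmo_seminorm (\<lambda>z. f z - f z) = 0"
    unfolding bmo_seminorm_def by (intro antisym SUP_least) auto
  with assms show ?thesis unfolding bmo_class_def by simp
qed

lemma bmo_class_eq_iff:
  assumes f: "f \<in> L1_loc" and g: "g \<in> L1_loc"
  shows "bmo_class f = bmo_class g \<longleftrightarrow> bmo_seminorm (\<lambda>z. f z - g z) = 0"
proof
  assume "bmo_class f = bmo_class g"
  then show "bmo_seminorm (\<lambda>z. f z - g z) = 0"
    using bmo_class_self[OF f] by (simp add: bmo_class_def)
next
  have sub: "bmo_class f \<subseteq> bmo_class g"
    if f: "f \<in> L1_loc" and g: "g \<in> L1_loc" and z: "bmo_seminorm (\<lambda>z. f z - g z) = 0"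
    for f g :: "'a S_fun"
  proof
    fix h assume "h \<in> bmo_class f"
    then have h: "h \<in> L1_loc" "bmo_seminorm (\<lambda>z. h z - f z) = 0" by (auto simp: bmo_class_def)
    show "h \<in> bmo_class g"
      using bmo_seminorm_add_le[OF L1_loc_diff[OF h(1) f] L1_loc_diff[OF f g]] h z
      by (simp add: bmo_class_def)
  qed
  assume z: "bmo_seminorm (\<lambda>z. f z - g z) = 0"
  moreover have "bmo_seminorm (\<lambda>z. g z - f z) = 0"
    using bmo_seminorm_minus[of "\<lambda>z. f z - g z"] z by simp
  ultimately show "bmo_class f = bmo_class g" using sub[OF f g] sub[OF g f] by blast
qed

lemma bmo_seminorm_cong:
  assumes f: "f \<in> L1_loc" and g: "g \<in> bmo_class f"
  shows "bmo_seminorm g = bmo_seminorm f"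
proof (rule antisym)
  have gl: "g \<in> L1_loc" and z: "bmo_seminorm (\<lambda>z. g z - f z) = 0"
    using g by (auto simp: bmo_class_def)
  have z': "bmo_seminorm (\<lambda>z. f z - g z) = 0"
    using bmo_seminorm_minus[of "\<lambda>z. g z - f z"] z by simp
  show "bmo_seminorm g \<le> bmo_seminorm f"
    using bmo_seminorm_add_le[OF L1_loc_diff[OF gl f] f] z by simp
  show "bmo_seminorm f \<le> bmo_seminorm g"
    using bmo_seminorm_add_le[OF L1_loc_diff[OF f gl] gl] z' by simp
qed

lemma bmo_class_add:
  assumes f: "f \<in> L1_loc" and g: "g \<in> L1_loc"
  shows "bmo_class f + bmo_class g = bmo_class (f + g)"
proof (intro equalityI subsetI)
  fix h assume "h \<in> bmo_class f + bmo_class g"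
  then obtain u v where h: "h = u + v" and u: "u \<in> L1_loc" "bmo_seminorm (\<lambda>z. u z - f z) = 0"
    and v: "v \<in> L1_loc" "bmo_seminorm (\<lambda>z. v z - g z) = 0"
    by (auto simp: bmo_class_def elim: set_plus_elim)
  show "h \<in> bmo_class (f + g)"
    using bmo_seminorm_add_le[OF L1_loc_diff[OF u(1) f] L1_loc_diff[OF v(1) g]]
      L1_loc_add[OF u(1) v(1)] u(2) v(2)
    by (simp add: h bmo_class_def plus_fun_def algebra_simps)
next
  fix h assume "h \<in> bmo_class (f + g)"
  then have h: "h \<in> L1_loc" "bmo_seminorm (\<lambda>z. (h z - f z) - g z) = 0"
    by (auto simp: bmo_class_def algebra_simps)
  have "(\<lambda>z. h z - f z) \<in> bmo_class g"
    using L1_loc_diff[OF h(1) f] h(2) by (simp add: bmo_class_def)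
  moreover have "h = f + (\<lambda>z. h z - f z)" by (simp add: fun_eq_iff)
  ultimately show "h \<in> bmo_class f + bmo_class g"
    using bmo_class_self[OF f] set_plus_intro by metis
qed

end

theory Submission
  imports Defs
begin

text \<open>
  Write p for the smaller exponent, n for the dimension and K(t) for the K-functional of (L^p,
  BMO) at the given class. Because \<theta> q = q - p, the q-th power of the interpolation norm
  is a multiple of the integral of (K(t)/t)^q against d(t^p). This would be the q-th power of
  the L^q norm of a function that exceeds K(t)/t exactly on a set of measure t^p. So each
  inclusion reduces to comparing a distribution function with K(t)/t, and the comparison is
  turned into an inequality of integrals by Tonelli's theorem (tonelli_exchange).

  For the inclusion of L^q in the interpolation space, cut f at height s. The part above s has
  an L^p norm N(s), the part below is bounded by s and has BMO norm at most 2 s, hence K(t)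
  \<le> N(s) + 2 t s. So s < K(t)/(3t) forces t \<le> N(s)/s, and integrating N(s)/s to the
  power p against d(s^q) returns a multiple of the integral of |f|^q (interp_integral_le_Lp).

  For the converse, let f = f0 + f1 be a nearly optimal decomposition at t. The mean oscillation
  of f over a Calderon--Zygmund set is at most twice the average of |f0| plus the norm of f1, so
  by the weak-type estimate for averages of |f0|^p, the sharp function of f exceeds 2 k/t, for
  any k > K(t), only on a set of measure at most (2t)^p (sharp_level_measure). It remains to
  bound f by its sharp function. The measure rho is not doubling, but Calderon--Zygmund sets
  with half-open intervals can be cut into smaller ones: if the cube is small compared with the
  interval, halve the interval, otherwise halve the cube in each direction (CZ_cell_splits).
  Iterating this, each such set R0 becomes the root of a tree of sets that are nested or
  disjoint, whose measures decrease by a factor between 2 and 2^n at each step, and which shrink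
  to points. On such a tree the classical good-lambda argument works, and it gives a
  Fefferman--Stein inequality for f minus its mean over R0 (local_fefferman_stein) with a
  constant that does not depend on R0.

  Finally, each orthant times the half line is the increasing union of such sets R0. The means
  over them are bounded, so they converge along a subsequence, and Fatou's lemma shows that f
  minus the limit is in L^q over the orthant (orthant_limit). The limits may differ from one
  orthant to the next, but a function that is constant on each orthant has vanishing mean oscillation,
  because no Calderon--Zygmund set meets two orthants. So the class of f has a representative in
  L^q.
\<close>

section \<open>Power measures and the layer-cake formula\<close>

text \<open>
  This is the measure d(s^p) on the half line: integrating the distribution function of a
  nonnegative w against it gives the integral of w^p.
\<close>

definition power_measure :: "real \<Rightarrow> real measure" where
  "power_measure p = density lborel (\<lambda>s. ennreal (p * s powr (p - 1)) * indicator {0<..} s)"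

lemma sets_power_measure [measurable_cong, simp]: "sets (power_measure p) = sets borel"
  by (simp add: power_measure_def)

lemma space_power_measure [simp]: "space (power_measure p) = UNIV"
  by (simp add: power_measure_def)

lemma nn_integral_power_measure:
  assumes [measurable]: "g \<in> borel_measurable borel"
  shows "(\<integral>\<^sup>+s. g s \<partial>power_measure p) =
    (\<integral>\<^sup>+s. ennreal (p * s powr (p - 1)) * indicator {0<..} s * g s \<partial>lborel)"
  unfolding power_measure_def by (subst nn_integral_density) auto

lemma AE_power_measure_pos: "AE s in power_measure p. 0 < s"
  unfolding power_measure_def by (subst AE_density) (auto simp: indicator_def split: if_splits)

lemma emeasure_power_measure_initial:
  assumes p: "0 < p" and b: "0 \<le> b" and A[measurable]: "A \<in> sets borel"
    and A1: "{0<..<b} \<subseteq> A" and A2: "A \<inter> {0<..} \<subseteq> {..b}"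
  shows "emeasure (power_measure p) A = ennreal (b powr p)"
proof -
  have "emeasure (power_measure p) A
      = (\<integral>\<^sup>+s. ennreal (p * s powr (p - 1)) * indicator {0<..} s * indicator A s \<partial>lborel)"
    unfolding power_measure_def by (subst emeasure_density) auto
  also have "\<dots> = (\<integral>\<^sup>+s. indicator {0..b} s * ennreal (p * s powr (p - 1)) \<partial>lborel)"
  proof (intro nn_integral_cong_AE)
    have "AE s in lborel. s \<noteq> (0::real)" "AE s in lborel. s \<noteq> b" by (rule AE_lborel_singleton)+
    then show "AE s in lborel. ennreal (p * s powr (p - 1)) * indicator {0<..} s * indicator A s
        = indicator {0..b} s * ennreal (p * s powr (p - 1))"
    proof eventually_elim
      case (elim s)
      then show ?case using A1 A2 by (auto simp: indicator_def subset_iff)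
    qed
  qed
  also have "\<dots> = (\<integral>\<^sup>+s. ennreal (indicator {0..b} s * (p * s powr (p - 1))) \<partial>lborel)"
    by (intro nn_integral_cong) (auto simp: indicator_def)
  also have "\<dots> = ennreal (p * (b powr (p - 1 + 1) / (p - 1 + 1)))"
    using p b by (intro nn_integral_has_integral_lebesgue has_integral_mult_right
        has_integral_powr_from_0) auto
  finally show ?thesis using p by simp
qed

lemma sigma_finite_power_measure: "sigma_finite_measure (power_measure p)"
proof -
  have "(\<lambda>s::real. ennreal (p * s powr (p - 1)) * indicator {0<..} s) \<in> borel_measurable lborel"
    by measurable
  from sigma_finite_measure.sigma_finite_iff_density_finite[OF sigma_finite_lborel this] show ?thesis
    unfolding power_measure_def by (auto simp: indicator_def)
qed

text \<open>
  A(t)^v is the mass of the interval below A(t) for d(s^v), and B(s)^u is the mass of the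
  interval up to B(s) for d(t^u). So both sides measure regions of the quadrant for the
  product of d(t^u) and d(s^v), and the hypothesis says that the first region lies in the
  second. If A and B are decreasing and inverse to each other, the two sides are equal.
\<close>

lemma tonelli_exchange:
  fixes A B :: "real \<Rightarrow> real"
  assumes u: "0 < u" and v: "0 < v" and B[measurable]: "B \<in> borel_measurable borel"
    and A0: "\<And>t. 0 < t \<Longrightarrow> 0 \<le> A t" and B0: "\<And>s. 0 < s \<Longrightarrow> 0 \<le> B s"
    and AB: "\<And>s t. 0 < s \<Longrightarrow> 0 < t \<Longrightarrow> s < A t \<Longrightarrow> t \<le> B s"
  shows "(\<integral>\<^sup>+t. ennreal (A t powr v) \<partial>power_measure u) \<le> (\<integral>\<^sup>+s. ennreal (B s powr u) \<partial>power_measure v)"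
proof -
  interpret U: sigma_finite_measure "power_measure u" by (rule sigma_finite_power_measure)
  interpret V: sigma_finite_measure "power_measure v" by (rule sigma_finite_power_measure)
  interpret pair_sigma_finite "power_measure u" "power_measure v" ..
  have "(\<integral>\<^sup>+t. ennreal (A t powr v) \<partial>power_measure u)
      \<le> (\<integral>\<^sup>+t. \<integral>\<^sup>+s. indicator {..B s} t \<partial>power_measure v \<partial>power_measure u)"
  proof (rule nn_integral_mono_AE)
    show "AE t in power_measure u. ennreal (A t powr v) \<le> (\<integral>\<^sup>+s. indicator {..B s} t \<partial>power_measure v)"
      using AE_power_measure_pos
    proof eventually_elim
      case (elim t)
      have "ennreal (A t powr v) = emeasure (power_measure v) {..<A t}"
        using v A0[OF elim] by (subst emeasure_power_measure_initial[where b = "A t"]) auto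
      also have "\<dots> = (\<integral>\<^sup>+s. indicator {..<A t} s \<partial>power_measure v)" by simp
      also have "\<dots> \<le> (\<integral>\<^sup>+s. indicator {..B s} t \<partial>power_measure v)"
      proof (rule nn_integral_mono_AE)
        show "AE s in power_measure v. indicator {..<A t} s \<le> (indicator {..B s} t :: ennreal)"
          using AE_power_measure_pos
          by eventually_elim (use elim AB in \<open>auto simp: indicator_def\<close>)
      qed
      finally show ?case .
    qed
  qed
  also have "\<dots> = (\<integral>\<^sup>+s. \<integral>\<^sup>+t. indicator {..B s} t \<partial>power_measure u \<partial>power_measure v)"
  proof (rule Fubini'[symmetric])
    have "(\<lambda>(t, s). indicator {..B s} t :: ennreal) = indicator {z. fst z \<le> B (snd z)}"
      by (auto simp: indicator_def fun_eq_iff)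
    moreover have "{z. fst z \<le> B (snd z)} \<in> sets (power_measure u \<Otimes>\<^sub>M power_measure v)"
    proof -
      have "{z \<in> space (power_measure u \<Otimes>\<^sub>M power_measure v). fst z \<le> B (snd z)}
          \<in> sets (power_measure u \<Otimes>\<^sub>M power_measure v)" by measurable
      then show ?thesis by (simp add: space_pair_measure)
    qed
    ultimately show "(\<lambda>(t, s). indicator {..B s} t :: ennreal) \<in> borel_measurable (power_measure u \<Otimes>\<^sub>M power_measure v)"
      by (simp add: borel_measurable_indicator)
  qed
  also have "\<dots> = (\<integral>\<^sup>+s. ennreal (B s powr u) \<partial>power_measure v)"
  proof (rule nn_integral_cong_AE)
    show "AE s in power_measure v. (\<integral>\<^sup>+t. indicator {..B s} t \<partial>power_measure u) = ennreal (B s powr u)"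
      using AE_power_measure_pos
      by eventually_elim (use u B0 in \<open>auto intro!: emeasure_power_measure_initial\<close>)
  qed
  finally show ?thesis .
qed

lemma measurable_distribution:
  fixes w :: "'a \<Rightarrow> real"
  assumes M: "sigma_finite_measure M" and [measurable]: "w \<in> borel_measurable M"
  shows "(\<lambda>s. emeasure M {x \<in> space M. s < w x}) \<in> borel_measurable borel"
proof -
  interpret sigma_finite_measure M by fact
  have "{z \<in> space (borel \<Otimes>\<^sub>M M). fst z < w (snd z)} \<in> sets (borel \<Otimes>\<^sub>M M)" by measurable
  from measurable_emeasure_Pair[OF this]
  have "(\<lambda>s. emeasure M (Pair s -` {z \<in> space (borel \<Otimes>\<^sub>M M). fst z < w (snd z)})) \<in> borel_measurable borel" .
  moreover have "Pair s -` {z \<in> space (borel \<Otimes>\<^sub>M M). fst z < w (snd z)} = {x \<in> space M. s < w x}" for s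
    by (auto simp: space_pair_measure)
  ultimately show ?thesis by simp
qed

lemma layer_cake:
  fixes w :: "'a \<Rightarrow> real"
  assumes M: "sigma_finite_measure M" and w[measurable]: "w \<in> borel_measurable M"
    and w0: "\<And>x. 0 \<le> w x" and p: "0 < p"
  shows "(\<integral>\<^sup>+x. ennreal (w x powr p) \<partial>M) = (\<integral>\<^sup>+s. emeasure M {x \<in> space M. s < w x} \<partial>power_measure p)"
proof -
  interpret M: sigma_finite_measure M by fact
  interpret V: sigma_finite_measure "power_measure p" by (rule sigma_finite_power_measure)
  interpret pair_sigma_finite M "power_measure p" ..
  have "(\<integral>\<^sup>+x. ennreal (w x powr p) \<partial>M) = (\<integral>\<^sup>+x. \<integral>\<^sup>+s. indicator {..<w x} s \<partial>power_measure p \<partial>M)"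
    using p w0 by (intro nn_integral_cong)
      (auto intro!: emeasure_power_measure_initial[symmetric])
  also have "\<dots> = (\<integral>\<^sup>+s. \<integral>\<^sup>+x. indicator {..<w x} s \<partial>M \<partial>power_measure p)"
  proof (rule Fubini'[symmetric])
    have "(\<lambda>(x, s). indicator {..<w x} s :: ennreal) = (\<lambda>z. if snd z < w (fst z) then 1 else 0)"
      by (auto simp: indicator_def fun_eq_iff)
    then show "(\<lambda>(x, s). indicator {..<w x} s :: ennreal) \<in> borel_measurable (M \<Otimes>\<^sub>M power_measure p)"
      by simp
  qed
  also have "\<dots> = (\<integral>\<^sup>+s. emeasure M {x \<in> space M. s < w x} \<partial>power_measure p)"
  proof (intro nn_integral_cong)
    fix s
    have "(\<integral>\<^sup>+x. indicator {..<w x} s \<partial>M) = (\<integral>\<^sup>+x. indicator {x \<in> space M. s < w x} x \<partial>M)"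
      by (intro nn_integral_cong) (auto simp: indicator_def)
    then show "(\<integral>\<^sup>+x. indicator {..<w x} s \<partial>M) = emeasure M {x \<in> space M. s < w x}" by simp
  qed
  finally show ?thesis .
qed

text \<open>
  The density of d(s^p), times s^(-a), is a multiple of the density of d(s^(p-a)).
\<close>

lemma nn_integral_power_measure_weight:
  assumes a: "0 < a" "a < p" and [measurable]: "g \<in> borel_measurable borel"
  shows "(\<integral>\<^sup>+s. ennreal (s powr (- a)) * g s \<partial>power_measure p)
    = ennreal (p / (p - a)) * (\<integral>\<^sup>+s. g s \<partial>power_measure (p - a))"
proof -
  have "(\<integral>\<^sup>+s. ennreal (s powr (- a)) * g s \<partial>power_measure p)
     = (\<integral>\<^sup>+s. ennreal (p * s powr (p - 1)) * indicator {0<..} s * (ennreal (s powr (- a)) * g s) \<partial>lborel)"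
    by (subst nn_integral_power_measure) auto
  also have "\<dots> = (\<integral>\<^sup>+s. ennreal (p / (p - a)) *
      (ennreal ((p - a) * s powr (p - a - 1)) * indicator {0<..} s * g s) \<partial>lborel)"
  proof (intro nn_integral_cong)
    fix s :: real
    have "s powr (p - 1) * s powr (- a) = s powr (p - a - 1)"
      by (subst powr_add[symmetric]) (simp add: algebra_simps)
    then have "p * s powr (p - 1) * s powr (- a) = p / (p - a) * ((p - a) * s powr (p - a - 1))"
      using a by simp
    then have "ennreal (p * s powr (p - 1)) * ennreal (s powr (- a))
        = ennreal (p / (p - a)) * ennreal ((p - a) * s powr (p - a - 1))"
      using a by (simp add: ennreal_mult[symmetric])
    then show "ennreal (p * s powr (p - 1)) * indicator {0<..} s * (ennreal (s powr (- a)) * g s)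
      = ennreal (p / (p - a)) * (ennreal ((p - a) * s powr (p - a - 1)) * indicator {0<..} s * g s)"
      by (cases "0 < s") (simp_all add: mult.assoc[symmetric])
  qed
  also have "\<dots> = ennreal (p / (p - a)) * (\<integral>\<^sup>+s. g s \<partial>power_measure (p - a))"
    by (subst nn_integral_cmult) (auto simp: nn_integral_power_measure)
  finally show ?thesis .
qed

lemma nn_integral_power_measure_double:
  assumes p: "0 < p" and [measurable]: "g \<in> borel_measurable borel"
  shows "(\<integral>\<^sup>+s. g s \<partial>power_measure p) = ennreal (2 powr p) * (\<integral>\<^sup>+s. g (2 * s) \<partial>power_measure p)"
proof -
  have "(\<integral>\<^sup>+s. g s \<partial>power_measure p)
     = ennreal 2 * (\<integral>\<^sup>+s. ennreal (p * (2 * s) powr (p - 1)) * indicator {0<..} (2 * s) * g (2 * s) \<partial>lborel)"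
    by (subst nn_integral_power_measure, simp)
       (subst nn_integral_real_affine[where t = 0 and c = 2], auto)
  also have "\<dots> = (\<integral>\<^sup>+s. ennreal 2 * (ennreal (p * (2 * s) powr (p - 1)) * indicator {0<..} (2 * s) * g (2 * s)) \<partial>lborel)"
    by (subst nn_integral_cmult) auto
  also have "\<dots> = (\<integral>\<^sup>+s. ennreal (2 powr p) * (ennreal (p * s powr (p - 1)) * indicator {0<..} s * g (2 * s)) \<partial>lborel)"
  proof (intro nn_integral_cong)
    fix s :: real
    have "2 * (p * (2 * s) powr (p - 1)) = 2 powr p * (p * s powr (p - 1))" if "0 < s"
      using that by (simp add: powr_mult powr_diff)
    then have "ennreal 2 * ennreal (p * (2 * s) powr (p - 1)) = ennreal (2 powr p) * ennreal (p * s powr (p - 1))" if "0 < s"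
      using that ennreal_mult'[OF zero_le_numeral, of "num.Bit0 num.One" "p * (2 * s) powr (p - 1)"]
        ennreal_mult'[OF powr_ge_zero, of 2 p "p * s powr (p - 1)"] by metis
    then show "ennreal 2 * (ennreal (p * (2 * s) powr (p - 1)) * indicator {0<..} (2 * s) * g (2 * s))
       = ennreal (2 powr p) * (ennreal (p * s powr (p - 1)) * indicator {0<..} s * g (2 * s))"
      by (cases "0 < s") (simp_all add: mult.assoc[symmetric])
  qed
  also have "\<dots> = ennreal (2 powr p) * (\<integral>\<^sup>+s. g (2 * s) \<partial>power_measure p)"
    by (subst nn_integral_cmult) (auto simp: nn_integral_power_measure)
  finally show ?thesis .
qed

text \<open>
  Doubling the variable multiplies an integral against d(s^p) by a constant, so the hypothesis
  bounds the integral of d by half of itself plus the term with e. Absorbing the half requires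
  finite integrals; these are obtained by truncating at N, where the bound D is used, and
  letting N tend to infinity at the end.
\<close>

lemma good_lambda_absorb:
  fixes d e :: "real \<Rightarrow> real"
  assumes p: "0 < p" and [measurable]: "d \<in> borel_measurable borel" "e \<in> borel_measurable borel"
    and d0: "\<And>s. 0 \<le> d s" and D: "\<And>s. d s \<le> D" and e0: "\<And>s. 0 \<le> e s"
    and c: "0 \<le> c" "2 powr p * c \<le> 1 / 2"
    and good: "\<And>s. 0 < s \<Longrightarrow> d (2 * s) \<le> c * d s + e s"
  shows "(\<integral>\<^sup>+s. ennreal (d s) \<partial>power_measure p) \<le> ennreal (2 powr (p + 1)) * (\<integral>\<^sup>+s. ennreal (e s) \<partial>power_measure p)"
proof -
  define J where "J = (\<integral>\<^sup>+s. ennreal (e s) \<partial>power_measure p)"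
  define I where "I N = (\<integral>\<^sup>+s. ennreal (d s) * indicator {..<real N} s \<partial>power_measure p)" for N
  have D0: "0 \<le> D" using d0[of 0] D[of 0] by linarith
  have bnd: "I N \<le> ennreal (2 powr (p + 1)) * J" for N
  proof (cases "J = \<infinity>")
    case True then show ?thesis by (simp add: ennreal_mult_top)
  next
    case False
    have "I N \<le> (\<integral>\<^sup>+s. ennreal D * indicator {..<real N} s \<partial>power_measure p)"
      unfolding I_def by (intro nn_integral_mono mult_right_mono ennreal_leI D) auto
    also have "\<dots> = ennreal D * emeasure (power_measure p) {..<real N}"
      by (subst nn_integral_cmult) auto
    also have "\<dots> = ennreal (D * real N powr p)"
      using p D0 by (subst emeasure_power_measure_initial[where b = "real N"]) (auto simp: ennreal_mult)
    finally have fin: "I N < \<infinity>" by (auto intro: le_less_trans)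
    have "I N = ennreal (2 powr p) * (\<integral>\<^sup>+s. ennreal (d (2 * s)) * indicator {..<real N} (2 * s) \<partial>power_measure p)"
      unfolding I_def by (rule nn_integral_power_measure_double) (use p in auto)
    also have "(\<integral>\<^sup>+s. ennreal (d (2 * s)) * indicator {..<real N} (2 * s) \<partial>power_measure p)
       \<le> (\<integral>\<^sup>+s. ennreal c * (ennreal (d s) * indicator {..<real N} s) + ennreal (e s) \<partial>power_measure p)"
    proof (rule nn_integral_mono_AE)
      show "AE s in power_measure p. ennreal (d (2 * s)) * indicator {..<real N} (2 * s)
         \<le> ennreal c * (ennreal (d s) * indicator {..<real N} s) + ennreal (e s)"
        using AE_power_measure_pos
      proof eventually_elim
        case (elim s)
        show ?case
        proof (cases "2 * s < real N")
          case True
          have "ennreal (d (2 * s)) \<le> ennreal (c * d s + e s)" by (intro ennreal_leI good elim)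
          also have "\<dots> = ennreal c * ennreal (d s) + ennreal (e s)"
            using c d0 e0 by (simp add: ennreal_mult)
          finally show ?thesis using True elim by simp
        qed auto
      qed
    qed
    also have "\<dots> = ennreal c * I N + J"
      unfolding I_def J_def by (subst nn_integral_add, simp, simp, subst nn_integral_cmult) auto
    finally have le: "I N \<le> ennreal (2 powr p) * (ennreal c * I N + J)"
      by (simp add: mult_left_mono)
    obtain i where i: "I N = ennreal i" "0 \<le> i" using fin by (cases "I N") auto
    obtain j where j: "J = ennreal j" "0 \<le> j" using False by (cases J) auto
    have "ennreal i \<le> ennreal (2 powr p * (c * i + j))"
      using le c i j by (simp add: ennreal_mult)
    then have "i \<le> 2 powr p * (c * i + j)" using c i j by (subst (asm) ennreal_le_iff) auto
    also have "\<dots> = (2 powr p * c) * i + 2 powr p * j" by (simp add: algebra_simps)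
    also have "\<dots> \<le> 1 / 2 * i + 2 powr p * j" using c i by (intro add_right_mono mult_right_mono) auto
    finally have "i \<le> 2 powr (p + 1) * j" by (simp add: powr_add)
    then show ?thesis using i j by (simp add: ennreal_mult[symmetric] ennreal_leI)
  qed
  have "(\<integral>\<^sup>+s. ennreal (d s) \<partial>power_measure p) = (\<integral>\<^sup>+s. (SUP N. ennreal (d s) * indicator {..<real N} s) \<partial>power_measure p)"
  proof (intro nn_integral_cong)
    fix s :: real
    obtain N where "s < real N" using reals_Archimedean2 by blast
    then have "ennreal (d s) \<le> (SUP N. ennreal (d s) * indicator {..<real N} s)"
      by (intro SUP_upper2[of N]) auto
    then show "ennreal (d s) = (SUP N. ennreal (d s) * indicator {..<real N} s)"
      by (intro antisym SUP_least) (auto simp: indicator_def)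
  qed
  also have "\<dots> = (SUP N. I N)"
    unfolding I_def by (intro nn_integral_monotone_convergence_SUP)
      (auto simp: incseq_def le_fun_def indicator_def)
  also have "\<dots> \<le> ennreal (2 powr (p + 1)) * J" by (intro SUP_least bnd)
  finally show ?thesis unfolding J_def .
qed

text \<open>
  The graph of y^p lies above its tangent at s. The negative term of the tangent is moved to the
  other side, so that the inequality can be integrated in the extended nonnegative reals.
\<close>

lemma young_tangent:
  fixes y s p :: real
  assumes "1 \<le> p" "0 \<le> y" "0 < s"
  shows "p * s powr (p - 1) * y \<le> y powr p + (p - 1) * s powr p"
proof (cases "y = 0")
  case True then show ?thesis using assms by simp
next
  case False
  have "(y powr p) powr (1 / p) * (s powr p) powr (1 - 1 / p) \<le> 1 / p * y powr p + (1 - 1 / p) * s powr p"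
    using False assms by (intro Youngs_inequality_0) (auto simp: field_simps)
  also have "(y powr p) powr (1 / p) * (s powr p) powr (1 - 1 / p) = y * s powr (p - 1)"
    using False assms by (simp add: powr_powr right_diff_distrib)
  finally have "p * (y * s powr (p - 1)) \<le> p * (1 / p * y powr p + (1 - 1 / p) * s powr p)"
    using assms by (intro mult_left_mono) auto
  also have "\<dots> = y powr p + (p - 1) * s powr p" using assms by (simp add: field_simps)
  finally show ?thesis by (simp add: mult_ac)
qed

text \<open>
  The tangent inequality at the point s, integrated over R.
\<close>

lemma jensen_powr:
  fixes h :: "'a \<Rightarrow> real"
  assumes p: "1 \<le> p" and s: "0 \<le> s" and [measurable]: "h \<in> borel_measurable M" "R \<in> sets M"
    and h0: "\<And>x. 0 \<le> h x" and fin: "emeasure M R < \<infinity>"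
    and avg: "ennreal s * emeasure M R \<le> (\<integral>\<^sup>+x\<in>R. ennreal (h x) \<partial>M)"
  shows "ennreal (s powr p) * emeasure M R \<le> (\<integral>\<^sup>+x\<in>R. ennreal (h x powr p) \<partial>M)"
proof (cases "s = 0 \<or> (\<integral>\<^sup>+x\<in>R. ennreal (h x powr p) \<partial>M) = \<infinity>")
  case True then show ?thesis by auto
next
  case False
  then have s: "0 < s" and nt: "(\<integral>\<^sup>+x\<in>R. ennreal (h x powr p) \<partial>M) \<noteq> \<infinity>" using s by auto
  let ?c = "p * s powr (p - 1)"
  obtain m where m: "emeasure M R = ennreal m" "0 \<le> m" using fin by (cases "emeasure M R") auto
  obtain i where i: "(\<integral>\<^sup>+x\<in>R. ennreal (h x powr p) \<partial>M) = ennreal i" "0 \<le> i"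
    using nt by (cases "(\<integral>\<^sup>+x\<in>R. ennreal (h x powr p) \<partial>M)") auto
  have "ennreal (?c * s * m) = ennreal ?c * (ennreal s * emeasure M R)"
    using p s m by (simp add: ennreal_mult mult_ac)
  also have "\<dots> \<le> ennreal ?c * (\<integral>\<^sup>+x\<in>R. ennreal (h x) \<partial>M)" by (intro mult_left_mono avg) auto
  also have "\<dots> = (\<integral>\<^sup>+x\<in>R. ennreal (?c * h x) \<partial>M)"
    using p s h0 by (subst nn_integral_cmult[symmetric]) (auto simp: ennreal_mult mult.assoc)
  also have "\<dots> \<le> (\<integral>\<^sup>+x. ennreal (h x powr p) * indicator R x + ennreal ((p - 1) * s powr p) * indicator R x \<partial>M)"
  proof (intro nn_integral_mono)
    fix x
    have "ennreal (?c * h x) \<le> ennreal (h x powr p + (p - 1) * s powr p)"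
      by (intro ennreal_leI young_tangent p h0 s)
    also have "\<dots> = ennreal (h x powr p) + ennreal ((p - 1) * s powr p)" using p by simp
    finally show "ennreal (?c * h x) * indicator R x
        \<le> ennreal (h x powr p) * indicator R x + ennreal ((p - 1) * s powr p) * indicator R x"
      by (auto simp: indicator_def)
  qed
  also have "\<dots> = ennreal i + ennreal ((p - 1) * s powr p) * emeasure M R"
    by (subst nn_integral_add) (auto simp: i nn_integral_cmult_indicator)
  also have "\<dots> = ennreal (i + (p - 1) * s powr p * m)"
    using p m i by (simp add: ennreal_mult)
  finally have "?c * s * m \<le> i + (p - 1) * s powr p * m"
    using p m i by (subst (asm) ennreal_le_iff) auto
  moreover have "?c * s = p * s powr p" using s by (simp add: powr_diff)
  ultimately have "p * s powr p * m \<le> i + (p - 1) * s powr p * m" by simp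
  then have "s powr p * m \<le> i" by (simp add: left_diff_distrib)
  then show ?thesis using m i by (simp add: ennreal_mult[symmetric] ennreal_leI)
qed

section \<open>A local Fefferman--Stein inequality on trees of cells\<close>

lemma emeasure_eq_measure_of_pos:
  "0 < measure M R \<Longrightarrow> emeasure M R = ennreal (measure M R)"
  by (intro emeasure_eq_ennreal_measure) (auto simp: measure_def)

text \<open>
  What the good-lambda argument needs to know about cells. That only finitely many cells lie
  above a given one yields maximal cells; the ratio of a cell to its parent takes the place of
  a doubling property of the measure; and the last assumption, which combines regularity of
  the measure with the fact that cells shrink to points, takes the place of Lebesgue's
  differentiation theorem.
\<close>

locale dyadic_tree = sigma_finite_measure M for M :: "'a measure" +
  fixes T :: "'a set set" and R0 :: "'a set" and A :: real
  assumes countable_tree: "countable T"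
    and tree_sets: "R \<in> T \<Longrightarrow> R \<in> sets M"
    and tree_pos: "R \<in> T \<Longrightarrow> 0 < measure M R"
    and nested: "R \<in> T \<Longrightarrow> S \<in> T \<Longrightarrow> R \<inter> S \<noteq> {} \<Longrightarrow> R \<subseteq> S \<or> S \<subseteq> R"
    and finite_above: "R \<in> T \<Longrightarrow> finite {S \<in> T. R \<subseteq> S}"
    and root: "R0 \<in> T" and below_root: "R \<in> T \<Longrightarrow> R \<subseteq> R0"
    and ratio: "1 \<le> A"
    and parent: "R \<in> T \<Longrightarrow> R \<noteq> R0 \<Longrightarrow> \<exists>P\<in>T. R \<subset> P \<and> measure M P \<le> A * measure M R"
    and outer: "B \<in> sets M \<Longrightarrow> B \<subseteq> R0 \<Longrightarrow> 0 < e \<Longrightarrow>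
      \<exists>U\<subseteq>T. B \<subseteq> \<Union>U \<and> emeasure M (\<Union>U) \<le> emeasure M B + ennreal e"
begin

lemma emeasure_tree: "R \<in> T \<Longrightarrow> emeasure M R = ennreal (measure M R)"
  by (rule emeasure_eq_measure_of_pos[OF tree_pos])

lemma union_sets: "U \<subseteq> T \<Longrightarrow> \<Union>U \<in> sets M"
  using countable_tree tree_sets by (intro sets.countable_Union) (auto intro: countable_subset)

lemma union_fmeasurable: assumes U: "U \<subseteq> T" shows "\<Union>U \<in> fmeasurable M"
proof (rule fmeasurableI2)
  show "R0 \<in> fmeasurable M"
    using tree_sets[OF root] emeasure_tree[OF root] by (simp add: fmeasurable_def)
  show "\<Union>U \<subseteq> R0" using U below_root by blast
qed (rule union_sets[OF U])

lemma union_emeasure: "U \<subseteq> T \<Longrightarrow> emeasure M (\<Union>U) = ennreal (measure M (\<Union>U))"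
  using union_fmeasurable by (simp add: emeasure_eq_measure2)

lemma maximal_cells:
  assumes U: "U \<subseteq> T"
  obtains V where "V \<subseteq> U" "\<Union>V = \<Union>U" "disjoint V"
    "\<forall>S\<in>V. \<forall>R\<in>U. S \<subseteq> R \<longrightarrow> R = S"
proof
  define V where "V = {S \<in> U. \<forall>R\<in>U. S \<subseteq> R \<longrightarrow> R = S}"
  show "V \<subseteq> U" by (auto simp: V_def)
  show "\<forall>S\<in>V. \<forall>R\<in>U. S \<subseteq> R \<longrightarrow> R = S" by (auto simp: V_def)
  show "disjoint V"
  proof (rule disjointI)
    fix S S' assume S: "S \<in> V" "S' \<in> V" "S \<noteq> S'"
    show "S \<inter> S' = {}"
    proof (rule ccontr)
      assume "S \<inter> S' \<noteq> {}"
      then have "S \<subseteq> S' \<or> S' \<subseteq> S" using nested S U by (auto simp: V_def)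
      then show False using S by (auto simp: V_def)
    qed
  qed
  show "\<Union>V = \<Union>U"
  proof
    show "\<Union>U \<subseteq> \<Union>V"
    proof
      fix x assume "x \<in> \<Union>U"
      then obtain R where R: "R \<in> U" "x \<in> R" by auto
      have "finite {S \<in> U. R \<subseteq> S}"
        using finite_above[of R] R U by (auto intro: finite_subset[of _ "{S \<in> T. R \<subseteq> S}"])
      then obtain S where S: "S \<in> {S \<in> U. R \<subseteq> S}" "\<forall>b\<in>{S \<in> U. R \<subseteq> S}. S \<subseteq> b \<longrightarrow> S = b"
        using finite_has_maximal[of "{S \<in> U. R \<subseteq> S}"] R by auto
      then have "S \<in> V" by (auto simp: V_def)
      then show "x \<in> \<Union>V" using S R by auto
    qed
  qed (auto simp: V_def)
qed

text \<open>
  The maximal members of U are disjoint and have the same union as U, so the inequality can be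
  summed. With a multiple of M on the left and a density on the right this is the weak-type
  estimate for the maximal function of the tree.
\<close>

lemma union_mono:
  assumes U: "U \<subseteq> T" and N: "sets N1 = sets M" "sets N2 = sets M"
    and le: "\<And>R. R \<in> U \<Longrightarrow> emeasure N1 R \<le> emeasure N2 R"
  shows "emeasure N1 (\<Union>U) \<le> emeasure N2 (\<Union>U)"
proof -
  obtain V where V: "V \<subseteq> U" "\<Union>V = \<Union>U" "disjoint V" by (rule maximal_cells[OF U])
  have c: "countable V" using V U countable_tree by (meson countable_subset)
  have eq: "emeasure N (\<Union>V) = (\<integral>\<^sup>+R. emeasure N R \<partial>count_space V)" if "sets N = sets M" for N
  proof -
    have "emeasure N (\<Union>((\<lambda>R. R) ` V)) = (\<integral>\<^sup>+R. emeasure N R \<partial>count_space V)"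
      using V U tree_sets c that
      by (intro emeasure_UN_countable) (auto simp: disjoint_family_on_def disjoint_def)
    then show ?thesis by simp
  qed
  have "emeasure N1 (\<Union>V) \<le> emeasure N2 (\<Union>V)"
    unfolding eq[OF N(1)] eq[OF N(2)] using V le by (intro nn_integral_mono) auto
  then show ?thesis by (simp add: V)
qed

text \<open>
  The union of these cells is the set where a maximal function exceeds s: the maximal function
  of h along the tree if h does not depend on the cell, and the sharp function of f if h R is
  the distance of f to its mean over R.
\<close>

definition level_cells :: "('a set \<Rightarrow> 'a \<Rightarrow> real) \<Rightarrow> real \<Rightarrow> 'a set set" where
  "level_cells h s = {R \<in> T. ennreal s * emeasure M R < (\<integral>\<^sup>+x\<in>R. ennreal (h R x) \<partial>M)}"

lemma level_cells_sub: "level_cells h s \<subseteq> T" by (auto simp: level_cells_def)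

lemma level_cells_antimono:
  assumes "s \<le> t" shows "level_cells h t \<subseteq> level_cells h s"
proof
  fix R assume R: "R \<in> level_cells h t"
  have "ennreal s * emeasure M R \<le> ennreal t * emeasure M R"
    using assms by (intro mult_right_mono ennreal_leI) auto
  then show "R \<in> level_cells h s" using R by (auto simp: level_cells_def)
qed

lemma measurable_level_measure:
  "(\<lambda>s. measure M (\<Union>(level_cells h s))) \<in> borel_measurable borel"
proof -
  have "mono (\<lambda>s. - measure M (\<Union>(level_cells h s)))"
  proof (rule monoI)
    fix s t :: real assume "s \<le> t"
    then have "\<Union>(level_cells h t) \<subseteq> \<Union>(level_cells h s)" using level_cells_antimono by blast
    then have "measure M (\<Union>(level_cells h t)) \<le> measure M (\<Union>(level_cells h s))"
      by (rule measure_mono_fmeasurable) (rule union_sets union_fmeasurable, rule level_cells_sub)+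
    then show "- measure M (\<Union>(level_cells h s)) \<le> - measure M (\<Union>(level_cells h t))" by simp
  qed
  from borel_measurable_mono[OF this] show ?thesis by simp
qed

text \<open>
  Let B be the set in question. Cells that meet B have averages of w at most s. Covering B by
  such cells of almost the same total measure shows that the integral of w over B is at most s
  times the measure of B, although w exceeds s everywhere on B.
\<close>

lemma differentiation:
  assumes w[measurable]: "w \<in> borel_measurable M" and w0: "\<And>x. 0 \<le> w x" and s: "0 \<le> s"
  shows "emeasure M ({x \<in> R0. s < w x} - \<Union>(level_cells (\<lambda>_. w) s)) = 0"
proof -
  define B where "B = {x \<in> R0. s < w x} - \<Union>(level_cells (\<lambda>_. w) s)"
  have R0[measurable]: "R0 \<in> sets M" by (rule tree_sets[OF root])
  have "{x \<in> R0. s < w x} = R0 \<inter> {x \<in> space M. s < w x}" using sets.sets_into_space[OF R0] by auto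
  also have "\<dots> \<in> sets M" by measurable
  finally have B[measurable]: "B \<in> sets M"
    unfolding B_def by (intro sets.Diff union_sets level_cells_sub)
  have BR: "B \<subseteq> R0" by (auto simp: B_def)
  have finB: "emeasure M B < \<infinity>"
    using emeasure_mono[OF BR R0] emeasure_tree[OF root] by (auto intro: le_less_trans)
  define N where "N = density M (\<lambda>x. ennreal (w x))"
  have sN: "sets N = sets M" by (simp add: N_def)
  have eN: "emeasure N R = (\<integral>\<^sup>+x\<in>R. ennreal (w x) \<partial>M)" if "R \<in> sets M" for R
    using that unfolding N_def by (subst emeasure_density) auto
  have step: "emeasure N B \<le> ennreal s * (emeasure M B + ennreal e)" if e: "0 < e" for e
  proof -
    obtain U where U: "U \<subseteq> T" "B \<subseteq> \<Union>U" "emeasure M (\<Union>U) \<le> emeasure M B + ennreal e"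
      using outer[OF B BR e] by blast
    define V where "V = {R \<in> U. R \<inter> B \<noteq> {}}"
    have V: "V \<subseteq> T" "B \<subseteq> \<Union>V" "\<Union>V \<subseteq> \<Union>U" using U unfolding V_def by blast+
    have "emeasure N B \<le> emeasure N (\<Union>V)" using V union_sets sN by (intro emeasure_mono) auto
    also have "\<dots> \<le> emeasure (scale_measure (ennreal s) M) (\<Union>V)"
    proof (rule union_mono[OF V(1)])
      fix R assume R: "R \<in> V"
      then have "R \<notin> level_cells (\<lambda>_. w) s" by (auto simp: V_def B_def)
      then have "(\<integral>\<^sup>+x\<in>R. ennreal (w x) \<partial>M) \<le> ennreal s * emeasure M R"
        using R V by (auto simp: level_cells_def)
      then show "emeasure N R \<le> emeasure (scale_measure (ennreal s) M) R"
        using eN tree_sets R V by auto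
    qed (auto simp: sN)
    also have "\<dots> \<le> ennreal s * emeasure M (\<Union>U)"
      using V U union_sets by (auto intro!: mult_left_mono emeasure_mono)
    also have "\<dots> \<le> ennreal s * (emeasure M B + ennreal e)" using U by (intro mult_left_mono) auto
    finally show ?thesis .
  qed
  obtain b where b: "emeasure M B = ennreal b" "0 \<le> b" using finB by (cases "emeasure M B") auto
  have "emeasure N B \<le> ennreal (s * b)"
  proof (rule ennreal_le_epsilon)
    fix e :: real assume e: "0 < e"
    have "emeasure N B \<le> ennreal s * (ennreal b + ennreal (e / (s + 1)))"
      using step[of "e / (s + 1)"] e s b by simp
    also have "\<dots> = ennreal (s * b + s * (e / (s + 1)))"
    proof -
      have "0 \<le> e / (s + 1)" using s e by simp
      then show ?thesis using s b by (simp only: ennreal_plus[symmetric] ennreal_mult[symmetric]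
        add_nonneg_nonneg mult_nonneg_nonneg distrib_left)
    qed
    also have "\<dots> \<le> ennreal (s * b + e)"
      using s e by (intro ennreal_leI add_left_mono) (simp add: field_simps)
    also have "\<dots> = ennreal (s * b) + ennreal e" using s b e by (subst ennreal_plus) auto
    finally show "emeasure N B \<le> ennreal (s * b) + ennreal e" .
  qed
  moreover have "emeasure N B = ennreal (s * b) + (\<integral>\<^sup>+x\<in>B. ennreal (w x - s) \<partial>M)"
  proof -
    have "emeasure N B = (\<integral>\<^sup>+x. ennreal s * indicator B x + ennreal (w x - s) * indicator B x \<partial>M)"
      unfolding eN[OF B]
      by (intro nn_integral_cong) (use s in \<open>auto simp: indicator_def B_def ennreal_plus[symmetric] simp del: ennreal_plus\<close>)
    also have "\<dots> = ennreal (s * b) + (\<integral>\<^sup>+x\<in>B. ennreal (w x - s) \<partial>M)"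
      using s b by (subst nn_integral_add) (auto simp: nn_integral_cmult_indicator ennreal_mult)
    finally show ?thesis .
  qed
  ultimately have "ennreal (s * b) + (\<integral>\<^sup>+x\<in>B. ennreal (w x - s) \<partial>M) \<le> ennreal (s * b) + 0" by simp
  then have "(\<integral>\<^sup>+x\<in>B. ennreal (w x - s) \<partial>M) = 0"
    by (subst (asm) ennreal_add_left_cancel_le) auto
  then have "AE x in M. ennreal (w x - s) * indicator B x = 0"
    by (subst (asm) nn_integral_0_iff_AE) auto
  then have "AE x in M. x \<notin> B"
    by eventually_elim (auto simp: indicator_def B_def ennreal_eq_0_iff split: if_splits)
  then have "emeasure M B = 0" using B by (simp add: AE_iff_null_sets null_setsD1 null_sets_def[symmetric])
  then show ?thesis by (simp add: B_def)
qed

text \<open>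
  The numbers m R are the means of f. Let S be a maximal cell on which the average of the
  distance from f to m R0 exceeds s, and let P be its parent; by maximality, m P is within s
  of m R0. At a point of S where the level 2 s is exceeded, the averages of the distance from
  f to m P therefore exceed s on a cell inside S. By the weak-type estimate these points have
  measure at most 1/s times the integral of that distance over P, which is at most A g times
  the measure of S as soon as S contains at least one point outside F (g s).
\<close>

lemma good_lambda:
  fixes f :: "'a \<Rightarrow> complex" and m :: "'a set \<Rightarrow> complex"
  assumes f[measurable]: "f \<in> borel_measurable M"
    and mean: "\<And>R z. R \<in> T \<Longrightarrow>
      ennreal (norm (m R - z)) * emeasure M R \<le> (\<integral>\<^sup>+x\<in>R. ennreal (norm (f x - z)) \<partial>M)"
    and s: "0 < s" and g: "0 < g" "g \<le> 1"
  defines "E \<equiv> \<lambda>s. \<Union>(level_cells (\<lambda>_ x. norm (f x - m R0)) s)"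
    and "F \<equiv> \<lambda>s. \<Union>(level_cells (\<lambda>R x. norm (f x - m R)) s)"
  shows "emeasure M (E (2 * s) - F (g * s)) \<le> ennreal (A * g) * emeasure M (E s)"
proof -
  let ?w = "\<lambda>_ x. norm (f x - m R0)"
  obtain V where V: "V \<subseteq> level_cells ?w s" "\<Union>V = E s" "disjoint V"
    and Vmax': "\<forall>S\<in>V. \<forall>R\<in>level_cells ?w s. S \<subseteq> R \<longrightarrow> R = S"
    unfolding E_def by (rule maximal_cells[OF level_cells_sub[of ?w s]])
  have Vmax: "R = S" if "S \<in> V" "R \<in> level_cells ?w s" "S \<subseteq> R" for S R
    using Vmax' that by blast
  have VT: "V \<subseteq> T" using V(1) level_cells_sub by blast
  define X where "X = E (2 * s) - F (g * s)"
  have X[measurable]: "X \<in> sets M"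
    unfolding X_def E_def F_def by (intro sets.Diff union_sets level_cells_sub)
  have XE: "X \<subseteq> E s"
    using level_cells_antimono[of s "2 * s" ?w] s by (auto simp: X_def E_def)
  define N where "N = density M (indicator X)"
  have sN: "sets N = sets M" by (simp add: N_def)
  have eN: "emeasure N R = emeasure M (X \<inter> R)" if R: "R \<in> sets M" for R
  proof -
    have "emeasure N R = (\<integral>\<^sup>+x. indicator (X \<inter> R) x \<partial>M)"
      using R unfolding N_def
      by (simp add: emeasure_density indicator_inter_arith)
    then show ?thesis using R X by (simp only: nn_integral_indicator sets.Int)
  qed
  have "emeasure N (\<Union>V) \<le> emeasure (scale_measure (ennreal (A * g)) M) (\<Union>V)"
  proof (rule union_mono[OF VT])
    fix S assume S: "S \<in> V"
    then have ST: "S \<in> T" and Slev: "S \<in> level_cells ?w s" using VT V(1) by auto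
    show "emeasure N S \<le> emeasure (scale_measure (ennreal (A * g)) M) S"
    proof (cases "X \<inter> S = {}")
      case True then show ?thesis using eN[OF tree_sets[OF ST]] by simp
    next
      case False
      then obtain x where x: "x \<in> X" "x \<in> S" by blast
      have osc: "(\<integral>\<^sup>+y\<in>R. ennreal (norm (f y - m R)) \<partial>M) \<le> ennreal (g * s) * emeasure M R"
        if "R \<in> T" "x \<in> R" for R
        using that x unfolding X_def F_def level_cells_def by (auto simp: not_less)
      have "S \<noteq> R0"
      proof
        assume "S = R0"
        then have "ennreal s * emeasure M R0 < ennreal (g * s) * emeasure M R0"
          using Slev osc[OF ST x(2)] by (auto simp: level_cells_def)
        moreover have "ennreal (g * s) * emeasure M R0 \<le> ennreal s * emeasure M R0"
          using g s by (intro mult_right_mono ennreal_leI) (auto simp: mult_le_cancel_right1)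
        ultimately show False by simp
      qed
      then obtain P where P: "P \<in> T" "S \<subset> P" "measure M P \<le> A * measure M S"
        using parent[OF ST] by blast
      have "P \<notin> level_cells ?w s" using Vmax[OF S, of P] P by auto
      then have "(\<integral>\<^sup>+y\<in>P. ennreal (norm (f y - m R0)) \<partial>M) \<le> ennreal s * emeasure M P"
        using P by (auto simp: level_cells_def not_less)
      with mean[OF P(1), of "m R0"]
      have "ennreal (norm (m P - m R0)) * emeasure M P \<le> ennreal s * emeasure M P" by (rule order_trans)
      then have mP: "norm (m P - m R0) \<le> s"
        using tree_pos[OF P(1)] s by (simp add: emeasure_tree[OF P(1)] ennreal_mult[symmetric])
      define h where "h = (\<lambda>y. norm (f y - m P))"
      have [measurable]: "h \<in> borel_measurable M" by (simp add: h_def)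
      have cover: "X \<inter> S \<subseteq> \<Union>{R \<in> level_cells (\<lambda>_. h) s. R \<subseteq> S}"
      proof
        fix y assume y: "y \<in> X \<inter> S"
        then obtain R where R: "R \<in> level_cells ?w (2 * s)" "y \<in> R" by (auto simp: X_def E_def)
        then have RT: "R \<in> T" and R1: "R \<in> level_cells ?w s"
          using level_cells_sub level_cells_antimono[of s "2 * s" ?w] s by auto
        have RS: "R \<subseteq> S" using nested[OF ST RT] y R Vmax[OF S R1] by blast
        have [measurable]: "R \<in> sets M" by (rule tree_sets[OF RT])
        have "ennreal s * emeasure M R + ennreal s * emeasure M R = ennreal (2 * s) * emeasure M R"
          using s by (simp add: distrib_right[symmetric] ennreal_plus[symmetric] del: ennreal_plus)
        also have "\<dots> < (\<integral>\<^sup>+z\<in>R. ennreal (norm (f z - m R0)) \<partial>M)"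
          using R by (auto simp: level_cells_def)
        also have "\<dots> \<le> (\<integral>\<^sup>+z. ennreal (h z) * indicator R z + ennreal s * indicator R z \<partial>M)"
        proof (intro nn_integral_mono)
          fix z
          have "norm (f z - m R0) \<le> h z + s"
            using norm_triangle_ineq[of "f z - m P" "m P - m R0"] mP by (simp add: h_def)
          then have "ennreal (norm (f z - m R0)) \<le> ennreal (h z + s)" by (rule ennreal_leI)
          also have "\<dots> = ennreal (h z) + ennreal s"
            using s by (intro ennreal_plus) (auto simp: h_def)
          finally show "ennreal (norm (f z - m R0)) * indicator R z
              \<le> ennreal (h z) * indicator R z + ennreal s * indicator R z"
            by (auto simp: indicator_def)
        qed
        also have "\<dots> = (\<integral>\<^sup>+z\<in>R. ennreal (h z) \<partial>M) + ennreal s * emeasure M R"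
          by (subst nn_integral_add) (auto simp: nn_integral_cmult_indicator)
        finally have "ennreal s * emeasure M R < (\<integral>\<^sup>+z\<in>R. ennreal (h z) \<partial>M)"
          by (meson add_right_mono leD leI)
        then have "R \<in> level_cells (\<lambda>_. h) s" using RT by (simp add: level_cells_def)
        then show "y \<in> \<Union>{R \<in> level_cells (\<lambda>_. h) s. R \<subseteq> S}" using R RS by blast
      qed
      define W where "W = {R \<in> level_cells (\<lambda>_. h) s. R \<subseteq> S}"
      have WT: "W \<subseteq> T" using level_cells_sub by (auto simp: W_def)
      have "emeasure (scale_measure (ennreal s) M) (\<Union>W) \<le> emeasure (density M (\<lambda>x. ennreal (h x))) (\<Union>W)"
        by (rule union_mono[OF WT])
          (use WT tree_sets in \<open>auto simp: emeasure_density W_def level_cells_def less_imp_le subset_iff\<close>)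
      also have "\<dots> \<le> emeasure (density M (\<lambda>x. ennreal (h x))) P"
        using P tree_sets by (intro emeasure_mono) (auto simp: W_def)
      also have "\<dots> = (\<integral>\<^sup>+y\<in>P. ennreal (norm (f y - m P)) \<partial>M)"
        using tree_sets[OF P(1)] by (simp add: emeasure_density h_def)
      also have "\<dots> \<le> ennreal (g * s) * emeasure M P" using osc P x by auto
      also have "\<dots> \<le> ennreal (g * s) * ennreal (A * measure M S)"
        using P by (intro mult_left_mono) (auto simp: emeasure_tree intro: ennreal_leI)
      also have "\<dots> = ennreal s * (ennreal (A * g) * emeasure M S)"
        using g s ratio by (simp add: emeasure_tree[OF ST] ennreal_mult[symmetric] mult_ac)
      finally have "ennreal s * emeasure M (\<Union>W) \<le> ennreal s * (ennreal (A * g) * emeasure M S)"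
        by simp
      then have "emeasure M (\<Union>W) \<le> ennreal (A * g) * emeasure M S"
        using s by (subst (asm) ennreal_mult_le_mult_iff) auto
      moreover have "emeasure M (X \<inter> S) \<le> emeasure M (\<Union>W)"
        using cover union_sets[OF WT] by (intro emeasure_mono) (auto simp: W_def)
      ultimately show ?thesis using eN[OF tree_sets[OF ST]] by simp
    qed
  qed (auto simp: sN)
  then have "emeasure M (X \<inter> E s) \<le> ennreal (A * g) * emeasure M (E s)"
    using eN[OF union_sets[OF VT]] by (simp add: V)
  moreover have "X \<inter> E s = X" using XE by blast
  ultimately show ?thesis by (simp add: X_def)
qed

text \<open>
  Integrate the good-lambda inequality against d(s^p). Working below a root of finite measure
  makes the distribution functions bounded, which legitimises the absorption.
\<close>

lemma local_fefferman_stein: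
  fixes f :: "'a \<Rightarrow> complex" and m :: "'a set \<Rightarrow> complex"
  assumes f[measurable]: "f \<in> borel_measurable M"
    and mean: "\<And>R z. R \<in> T \<Longrightarrow>
      ennreal (norm (m R - z)) * emeasure M R \<le> (\<integral>\<^sup>+x\<in>R. ennreal (norm (f x - z)) \<partial>M)"
    and p: "0 < p" and g: "0 < g" "2 powr (p + 1) * A * g \<le> 1"
  shows "(\<integral>\<^sup>+x\<in>R0. ennreal (norm (f x - m R0) powr p) \<partial>M) \<le> ennreal (2 powr (p + 1)) *
    (\<integral>\<^sup>+s. ennreal (measure M (\<Union>(level_cells (\<lambda>R x. norm (f x - m R)) (g * s)))) \<partial>power_measure p)"
proof -
  define E where "E = (\<lambda>s. \<Union>(level_cells (\<lambda>_ x. norm (f x - m R0)) s))"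
  define F where "F = (\<lambda>s. \<Union>(level_cells (\<lambda>R x. norm (f x - m R)) s))"
  have R0[measurable]: "R0 \<in> sets M" by (rule tree_sets[OF root])
  define w where "w = (\<lambda>x. norm (f x - m R0) * indicator R0 x)"
  have [measurable]: "w \<in> borel_measurable M" unfolding w_def by measurable
  have "1 \<le> 2 powr (p + 1) * A"
    using ratio p mult_mono[of 1 "2 powr (p + 1)" 1 A] by (simp add: ge_one_powr_ge_zero)
  then have "1 * g \<le> 2 powr (p + 1) * A * g" using g(1) by (intro mult_right_mono) auto
  then have g1: "g \<le> 1" using g(2) by simp
  have "(\<integral>\<^sup>+x\<in>R0. ennreal (norm (f x - m R0) powr p) \<partial>M) = (\<integral>\<^sup>+x. ennreal (w x powr p) \<partial>M)"
    by (intro nn_integral_cong) (use p in \<open>auto simp: w_def indicator_def\<close>)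
  also have "\<dots> = (\<integral>\<^sup>+s. emeasure M {x \<in> space M. s < w x} \<partial>power_measure p)"
    by (rule layer_cake) (use p in \<open>auto simp: w_def sigma_finite_measure_axioms\<close>)
  also have "\<dots> \<le> (\<integral>\<^sup>+s. ennreal (measure M (E s)) \<partial>power_measure p)"
  proof (rule nn_integral_mono_AE)
    show "AE s in power_measure p. emeasure M {x \<in> space M. s < w x} \<le> ennreal (measure M (E s))"
      using AE_power_measure_pos
    proof eventually_elim
      case (elim s)
      let ?B = "{x \<in> R0. s < norm (f x - m R0)}"
      have eq: "?B = {x \<in> space M. s < w x}"
        using elim sets.sets_into_space[OF R0] by (auto simp: w_def indicator_def split: if_splits)
      have Em: "E s \<in> sets M" unfolding E_def by (rule union_sets[OF level_cells_sub])
      have Bm: "?B \<in> sets M" unfolding eq by measurable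
      have null: "emeasure M (?B - E s) = 0"
        unfolding E_def using elim by (intro differentiation) auto
      have "emeasure M {x \<in> space M. s < w x} \<le> emeasure M (E s \<union> (?B - E s))"
        unfolding eq[symmetric] using Em Bm by (intro emeasure_mono) auto
      also have "\<dots> \<le> emeasure M (E s) + emeasure M (?B - E s)"
        using Em Bm by (intro emeasure_subadditive) auto
      also have "\<dots> = ennreal (measure M (E s))"
        unfolding null unfolding E_def by (simp add: union_emeasure[OF level_cells_sub])
      finally show ?case .
    qed
  qed
  also have "\<dots> \<le> ennreal (2 powr (p + 1)) * (\<integral>\<^sup>+s. ennreal (measure M (F (g * s))) \<partial>power_measure p)"
  proof (rule good_lambda_absorb[OF p, where c = "A * g" and D = "measure M R0"])
    show "(\<lambda>s. measure M (E s)) \<in> borel_measurable borel"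
      unfolding E_def by (rule measurable_level_measure)
    show "(\<lambda>s. measure M (F (g * s))) \<in> borel_measurable borel"
      unfolding F_def by (rule measurable_compose[OF _ measurable_level_measure]) simp
    show "measure M (E s) \<le> measure M R0" for s
    proof (rule measure_mono_fmeasurable)
      show "E s \<subseteq> R0" unfolding E_def using below_root level_cells_sub by blast
      show "E s \<in> sets M" unfolding E_def by (rule union_sets[OF level_cells_sub])
      show "R0 \<in> fmeasurable M" using union_fmeasurable[of "{R0}"] root by simp
    qed
    show "2 powr p * (A * g) \<le> 1 / 2" using g by (simp add: powr_add mult_ac)
    show "measure M (E (2 * s)) \<le> A * g * measure M (E s) + measure M (F (g * s))" if s: "0 < s" for s
    proof -
      have fm: "E t \<in> fmeasurable M" "F t \<in> fmeasurable M" for t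
        unfolding E_def F_def by (intro union_fmeasurable level_cells_sub)+
      have "emeasure M (E (2 * s) - F (g * s)) \<le> ennreal (A * g) * emeasure M (E s)"
        unfolding E_def F_def by (rule good_lambda) (use mean s g g1 in auto)
      then have "measure M (E (2 * s) - F (g * s)) \<le> A * g * measure M (E s)"
        using fm g ratio
        by (simp add: emeasure_eq_measure2 ennreal_mult[symmetric] fmeasurable.Diff)
      moreover have "measure M (E (2 * s)) \<le> measure M ((E (2 * s) - F (g * s)) \<union> F (g * s))"
        using fm by (intro measure_mono_fmeasurable) (auto intro: fmeasurable.Un fmeasurable.Diff)
      moreover have "\<dots> \<le> measure M (E (2 * s) - F (g * s)) + measure M (F (g * s))"
        using fm by (intro measure_Un_le) (auto intro: fmeasurableD)
      ultimately show ?thesis by linarith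
    qed
  qed (use g ratio in auto)
  finally show ?thesis unfolding F_def .
qed

end

section \<open>Calderon--Zygmund cells and how they split\<close>

lemma S_set_borel: "S_set \<in> sets (borel :: ((real^'n) \<times> real) measure)"
  unfolding S_set_def by (intro borel_open open_Times) auto

lemma sets_rho_iff:
  "X \<in> sets (rho :: ((real^'n::finite) \<times> real) measure) \<longleftrightarrow> X \<in> sets borel \<and> X \<subseteq> S_set"
  unfolding rho_def by (subst sets_restrict_space_iff) (auto simp: S_set_borel)

lemma space_rho: "space rho = S_set"
  by (simp add: rho_def space_restrict_space)

lemma density_measurable:
  "(\<lambda>(x, a). ennreal (1 / a)) \<in> borel_measurable (lborel :: ((real^'n) \<times> real) measure)"
  by (simp add: case_prod_beta borel_prod[symmetric])

lemma emeasure_rho: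
  assumes "X \<in> sets (rho :: ((real^'n::finite) \<times> real) measure)"
  shows "emeasure rho X = (\<integral>\<^sup>+z\<in>X. ennreal (1 / snd z) \<partial>lborel)"
proof -
  have X: "X \<in> sets lborel" "X \<subseteq> S_set" using assms by (auto simp: sets_rho_iff)
  have "emeasure rho X = emeasure (density lborel (\<lambda>(x :: real^'n, a :: real). ennreal (1 / a))) X"
    unfolding rho_def using X by (intro emeasure_restrict_space) (auto simp: S_set_borel)
  also have "\<dots> = (\<integral>\<^sup>+z\<in>X. (case z of (x, a) \<Rightarrow> ennreal (1 / a)) \<partial>lborel)"
    using X by (intro emeasure_density density_measurable)
  finally show ?thesis by (simp add: case_prod_beta)
qed

lemma sigma_finite_rho: "sigma_finite_measure (rho :: ((real^'n::finite) \<times> real) measure)"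
proof -
  have "sigma_finite_measure (density lborel (\<lambda>(x :: real^'n, a :: real). ennreal (1 / a)))"
    using sigma_finite_measure.sigma_finite_iff_density_finite[OF sigma_finite_lborel density_measurable]
    by (auto simp: case_prod_beta)
  then show ?thesis unfolding rho_def
    by (rule sigma_finite_measure_restrict_space) (simp add: S_set_borel)
qed

lemma emeasure_rho_le:
  assumes X: "X \<in> sets (rho :: ((real^'n::finite) \<times> real) measure)" and b: "0 < b"
    and snd: "\<And>z. z \<in> X \<Longrightarrow> b \<le> snd z"
  shows "emeasure rho X \<le> ennreal (1 / b) * emeasure lborel X"
proof -
  have Xb: "X \<in> sets borel" using X by (simp add: sets_rho_iff)
  have "emeasure rho X = (\<integral>\<^sup>+z\<in>X. ennreal (1 / snd z) \<partial>lborel)" by (rule emeasure_rho[OF X])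
  also have "\<dots> \<le> (\<integral>\<^sup>+z. ennreal (1 / b) * indicator X z \<partial>lborel)"
  proof (intro nn_integral_mono)
    fix z
    have "1 / snd z \<le> 1 / b" if "z \<in> X" using snd[OF that] b by (simp add: frac_le)
    then show "ennreal (1 / snd z) * indicator X z \<le> ennreal (1 / b) * indicator X z"
      by (auto simp: indicator_def intro: ennreal_leI)
  qed
  also have "\<dots> = ennreal (1 / b) * emeasure lborel X"
    using Xb by (simp add: nn_integral_cmult_indicator)
  finally show ?thesis .
qed

lemma emeasure_rho_compact:
  assumes K: "compact K" "K \<subseteq> (S_set :: ((real^'n::finite) \<times> real) set)"
  shows "K \<in> sets rho" "emeasure rho K < \<infinity>"
proof -
  show s: "K \<in> sets rho" using K by (simp add: sets_rho_iff borel_compact)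
  show "emeasure rho K < \<infinity>"
  proof (cases "K = {}")
    case False
    have "compact (snd ` K)" using K by (intro compact_continuous_image continuous_intros)
    then obtain b where b: "b \<in> snd ` K" "\<forall>t\<in>snd ` K. b \<le> t"
      using compact_attains_inf[of "snd ` K"] False by blast
    have "emeasure rho K \<le> ennreal (1 / b) * emeasure lborel K"
      using b K by (intro emeasure_rho_le s) (auto simp: S_set_def)
    also have "\<dots> < \<infinity>"
      using emeasure_bounded_finite[OF compact_imp_bounded[OF K(1)]]
      by (simp add: ennreal_mult_less_top)
    finally show ?thesis .
  qed simp
qed

lemma nn_integral_inverse_interval:
  assumes "0 < u" "u \<le> v"
  shows "(\<integral>\<^sup>+a\<in>{u..<v}. ennreal (1 / a) \<partial>lborel) = ennreal (ln v - ln u)"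
proof -
  have "(\<integral>\<^sup>+a\<in>{u..<v}. ennreal (1 / a) \<partial>lborel) = (\<integral>\<^sup>+a. ennreal (1 / a) * indicator {u..v} a \<partial>lborel)"
  proof (rule nn_integral_cong_AE)
    have "AE a in lborel. a \<noteq> v" by (rule AE_lborel_singleton)
    then show "AE a in lborel. ennreal (1 / a) * indicator {u..<v} a = ennreal (1 / a) * indicator {u..v} a"
      by eventually_elim (auto simp: indicator_def)
  qed
  also have "\<dots> = ennreal (ln v - ln u)"
  proof (rule nn_integral_FTC_Icc)
    show "DERIV ln x :> 1 / x" if "x \<in> {u..v}" for x
      using that assms by (auto intro!: derivative_eq_intros)
  qed (use assms in auto)
  finally show ?thesis .
qed

lemma dyadic_cube_borel: "dyadic_cube k m \<in> sets (borel :: (real^'n) measure)"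
proof -
  have "dyadic_cube k m = (\<Inter>i. {x::real^'n. 2 powi k * of_int (m i) \<le> x $ i} \<inter>
      {x. x $ i < 2 powi k * (of_int (m i) + 1)})"
    unfolding dyadic_cube_def by auto
  also have "\<dots> \<in> sets borel"
    by (intro sets.countable_INT' sets.Int borel_closed borel_open closed_Collect_le
        open_Collect_less continuous_intros) auto
  finally show ?thesis .
qed

lemma emeasure_dyadic_cube:
  "emeasure lborel (dyadic_cube k m :: (real^'n::finite) set) = ennreal ((2 powi k) ^ CARD('n))"
proof -
  define u :: "real^'n" where "u = (\<chi> i. 2 powi k * of_int (m i))"
  define v :: "real^'n" where "v = (\<chi> i. 2 powi k * (of_int (m i) + 1))"
  have uv: "u $ i \<le> v $ i" for i by (simp add: u_def v_def)
  have le: "\<forall>b\<in>Basis. u \<bullet> b \<le> v \<bullet> b"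
    using uv by (auto simp: Basis_vec_def inner_axis)
  have ne: "cbox u v \<noteq> {}" using le by (simp add: box_ne_empty)
  have "emeasure lborel (cbox u v) = ennreal ((2 powi k) ^ CARD('n))"
  proof -
    have "emeasure lborel (cbox u v) = ennreal (measure lborel (cbox u v))"
      using emeasure_lborel_cbox_finite[of u v] by (intro emeasure_eq_ennreal_measure) simp
    also have "measure lborel (cbox u v) = (\<Prod>i\<in>UNIV. v $ i - u $ i)"
      by (rule content_cbox_cart[OF ne])
    also have "\<dots> = (\<Prod>i\<in>(UNIV :: 'n set). 2 powi k)"
      by (intro prod.cong) (auto simp: u_def v_def algebra_simps)
    finally show ?thesis by simp
  qed
  moreover have "emeasure lborel (box u v) = emeasure lborel (cbox u v)"
    by (simp add: emeasure_lborel_box_eq emeasure_lborel_cbox_eq)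
  moreover have "box u v \<subseteq> dyadic_cube k m" "dyadic_cube k m \<subseteq> cbox u v"
    by (auto simp: dyadic_cube_def mem_box_cart u_def v_def less_imp_le)
  then have "emeasure lborel (box u v) \<le> emeasure lborel (dyadic_cube k m)"
    "emeasure lborel (dyadic_cube k m) \<le> emeasure lborel (cbox u v)"
    using dyadic_cube_borel by (auto intro!: emeasure_mono)
  ultimately show ?thesis by simp
qed

text \<open>
  The interval is half-open, unlike that of a Calderon--Zygmund set, so that cells can be
  partitioned into cells; the difference is a null set.
\<close>

definition cz_cell :: "int \<Rightarrow> ('n \<Rightarrow> int) \<Rightarrow> real \<Rightarrow> real \<Rightarrow> ((real^'n) \<times> real) set" where
  "cz_cell k m a r = dyadic_cube k m \<times> {a * exp (- r) ..< a * exp r}"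

definition CZ_cells :: "((real^'n) \<times> real) set set" where
  "CZ_cells = {cz_cell k m a r | k m a r. 0 < a \<and> 0 < r \<and> CZ_admissible (2 powi k) a r}"

lemma CZ_cellsE:
  assumes "R \<in> CZ_cells"
  obtains k m a r where "R = cz_cell k m a r" "0 < a" "0 < r" "CZ_admissible (2 powi k) a r"
  using assms unfolding CZ_cells_def by blast

lemma Times_rho:
  assumes Q: "Q \<in> sets (borel :: (real^'n::finite) measure)" and I: "I \<in> sets borel" "I \<subseteq> {0<..}"
  shows "Q \<times> I \<in> sets rho"
    "emeasure rho (Q \<times> I) = emeasure lborel Q * (\<integral>\<^sup>+a\<in>I. ennreal (1 / a) \<partial>lborel)"
proof -
  have "Q \<times> I \<in> sets (borel \<Otimes>\<^sub>M borel)" using Q I by (intro pair_measureI) auto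
  then have "Q \<times> I \<in> sets borel" by (simp only: borel_prod)
  then show s: "Q \<times> I \<in> sets rho" using I by (auto simp: sets_rho_iff S_set_def)
  have [measurable]: "Q \<in> sets lborel" "I \<in> sets lborel" using Q I by auto
  have "emeasure rho (Q \<times> I) = (\<integral>\<^sup>+z. indicator Q (fst z) * (ennreal (1 / snd z) * indicator I (snd z)) \<partial>lborel)"
    unfolding emeasure_rho[OF s] by (intro nn_integral_cong) (auto simp: indicator_def)
  also have "\<dots> = (\<integral>\<^sup>+x. \<integral>\<^sup>+a. indicator Q x * (ennreal (1 / a) * indicator I a) \<partial>lborel \<partial>lborel)"
    unfolding lborel_prod[symmetric] by (subst lborel.nn_integral_fst[symmetric]) auto
  also have "\<dots> = (\<integral>\<^sup>+x. indicator Q x * (\<integral>\<^sup>+a\<in>I. ennreal (1 / a) \<partial>lborel) \<partial>lborel)"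
    by (intro nn_integral_cong nn_integral_cmult) auto
  also have "\<dots> = emeasure lborel Q * (\<integral>\<^sup>+a\<in>I. ennreal (1 / a) \<partial>lborel)"
    using Q by (subst nn_integral_multc) auto
  finally show "emeasure rho (Q \<times> I) = emeasure lborel Q * (\<integral>\<^sup>+a\<in>I. ennreal (1 / a) \<partial>lborel)" .
qed

lemma cz_cell_rho:
  fixes m :: "'n::finite \<Rightarrow> int"
  assumes a: "0 < a" and r: "0 < r"
  shows "cz_cell k m a r \<in> sets rho"
    "emeasure rho (cz_cell k m a r) = ennreal (2 * r * (2 powi k) ^ CARD('n))"
    "measure rho (cz_cell k m a r) = 2 * r * (2 powi k) ^ CARD('n)"
proof -
  have I: "{a * exp (- r) ..< a * exp r} \<subseteq> {0<..}"
    using a by (auto intro: less_le_trans[of 0 "a * exp (- r)"])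
  show "cz_cell k m a r \<in> sets rho"
    unfolding cz_cell_def using I by (intro Times_rho dyadic_cube_borel) auto
  have "emeasure rho (cz_cell k m a r) = ennreal ((2 powi k) ^ CARD('n)) * ennreal (ln (a * exp r) - ln (a * exp (- r)))"
    unfolding cz_cell_def using I a r
    by (simp add: Times_rho dyadic_cube_borel emeasure_dyadic_cube nn_integral_inverse_interval)
  also have "ln (a * exp r) - ln (a * exp (- r)) = 2 * r" using a by (simp add: ln_mult)
  finally show e: "emeasure rho (cz_cell k m a r) = ennreal (2 * r * (2 powi k) ^ CARD('n))"
    using r by (simp add: ennreal_mult[symmetric] mult_ac)
  show "measure rho (cz_cell k m a r) = 2 * r * (2 powi k) ^ CARD('n)"
    using r by (simp add: measure_def e)
qed

lemma CZ_cells_rho: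
  assumes "R \<in> (CZ_cells :: ((real^'n::finite) \<times> real) set set)"
  shows "R \<in> sets rho" "0 < measure rho R" "emeasure rho R = ennreal (measure rho R)"
  using assms by (auto elim!: CZ_cellsE simp: cz_cell_rho)

lemma mem_dyadic_cube: "x \<in> dyadic_cube k m \<longleftrightarrow> (\<forall>i. \<lfloor>x $ i / 2 powi k\<rfloor> = m i)"
  by (auto simp: dyadic_cube_def floor_eq_iff field_simps)

text \<open>
  A point lies in the cube with index m of side 2^k if its indices at side 2^(k-1), halved and
  rounded down, are m; this describes the subcubes.
\<close>

lemma mem_dyadic_cube_half:
  "x \<in> dyadic_cube k m \<longleftrightarrow> (\<forall>i. \<lfloor>x $ i / 2 powi (k - 1)\<rfloor> div 2 = m i)"
proof -
  have "\<lfloor>x $ i / 2 powi (k - 1)\<rfloor> div 2 = \<lfloor>x $ i / 2 powi k\<rfloor>" for i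
  proof -
    have "\<lfloor>x $ i / 2 powi (k - 1)\<rfloor> div 2 = \<lfloor>x $ i / 2 powi (k - 1) / 2\<rfloor>"
      using floor_divide_real_eq_div[of 2 "x $ i / 2 powi (k - 1)"] by simp
    also have "x $ i / 2 powi (k - 1) / 2 = x $ i / 2 powi k" by (simp add: power_int_diff)
    finally show ?thesis .
  qed
  then show ?thesis by (simp add: mem_dyadic_cube)
qed

text \<open>
  The factor 2 makes the pieces shrink from generation to generation, the factor 2^n bounds the
  ratio of a parent to its children.
\<close>

definition splits :: "((real^'n::finite) \<times> real) set \<Rightarrow> ((real^'n) \<times> real) set set \<Rightarrow> bool" where
  "splits R C \<longleftrightarrow> finite C \<and> C \<subseteq> CZ_cells \<and> disjoint C \<and> \<Union>C = R \<and>
     (\<forall>D\<in>C. 2 * measure rho D \<le> measure rho R \<and> measure rho R \<le> 2 ^ CARD('n) * measure rho D)"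

lemma two_le_power_card: "(2::real) \<le> 2 ^ CARD('n::finite)"
proof -
  have "(2::real) ^ 1 \<le> 2 ^ CARD('n)" by (intro power_increasing) (auto simp: Suc_le_eq)
  then show ?thesis by simp
qed

lemma split_interval:
  fixes m :: "'n::finite \<Rightarrow> int"
  assumes a: "0 < a" and r: "0 < r"
    and adm: "CZ_admissible (2 powi k) (a * exp (- r / 2)) (r / 2)"
      "CZ_admissible (2 powi k) (a * exp (r / 2)) (r / 2)"
  shows "\<exists>C. splits (cz_cell k m a r) C"
proof -
  define D1 where "D1 = cz_cell k m (a * exp (- r / 2)) (r / 2)"
  define D2 where "D2 = cz_cell k m (a * exp (r / 2)) (r / 2)"
  have e1: "D1 = dyadic_cube k m \<times> {a * exp (- r) ..< a}"
    and e2: "D2 = dyadic_cube k m \<times> {a ..< a * exp r}"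
    unfolding D1_def D2_def cz_cell_def by (simp_all add: mult.assoc flip: exp_add)
  have "D1 \<union> D2 = dyadic_cube k m \<times> ({a * exp (- r) ..< a} \<union> {a ..< a * exp r})"
    unfolding e1 e2 by blast
  also have "{a * exp (- r) ..< a} \<union> {a ..< a * exp r} = {a * exp (- r) ..< a * exp r}"
    using a r by (intro ivl_disj_un_two(3)) auto
  finally have un: "D1 \<union> D2 = cz_cell k m a r" by (simp add: cz_cell_def)
  have dis: "D1 \<inter> D2 = {}" unfolding e1 e2 by auto
  have mD: "measure rho D1 = r * (2 powi k) ^ CARD('n)" "measure rho D2 = r * (2 powi k) ^ CARD('n)"
    using a r by (simp_all add: D1_def D2_def cz_cell_rho)
  have "D1 \<in> CZ_cells" "D2 \<in> CZ_cells"
    unfolding D1_def D2_def CZ_cells_def using a r adm by (auto intro!: exI)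
  moreover have "2 * (r * (2 powi k) ^ CARD('n)) \<le> 2 ^ CARD('n) * (r * (2 powi k) ^ CARD('n))"
    using two_le_power_card[where 'n = 'n] r by (intro mult_right_mono) auto
  ultimately have "splits (cz_cell k m a r) {D1, D2}"
    unfolding splits_def using un dis mD a r
    by (auto simp: cz_cell_rho disjoint_def mult.assoc)
  then show ?thesis by blast
qed

lemma split_cube:
  fixes m :: "'n::finite \<Rightarrow> int"
  assumes a: "0 < a" and r: "0 < r" and adm: "CZ_admissible (2 powi (k - 1)) a r"
  shows "\<exists>C. splits (cz_cell k m a r) C"
proof -
  define I where "I = {m'. \<forall>i::'n. m' i div 2 = m i}"
  define C where "C = (\<lambda>m'. cz_cell (k - 1) m' a r) ` I"
  have "I \<subseteq> (\<Pi>\<^sub>E i\<in>UNIV. {2 * m i, 2 * m i + 1})"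
  proof
    fix m' assume "m' \<in> I"
    then have "m' i div 2 = m i" for i by (simp add: I_def)
    then have "m' i = 2 * m i \<or> m' i = 2 * m i + 1" for i
      by (metis mult_div_mod_eq mod2_eq_if add.right_neutral)
    then show "m' \<in> (\<Pi>\<^sub>E i\<in>UNIV. {2 * m i, 2 * m i + 1})" by (auto simp: PiE_def)
  qed
  moreover have "finite (\<Pi>\<^sub>E i\<in>(UNIV :: 'n set). {2 * m i, 2 * m i + 1})"
    by (intro finite_PiE) auto
  ultimately have fin: "finite C" unfolding C_def by (intro finite_imageI) (rule finite_subset)
  have "\<Union>C = cz_cell k m a r"
    unfolding C_def I_def cz_cell_def
    by (force simp: mem_dyadic_cube_half[of _ k m] mem_dyadic_cube[of _ "k - 1"] choice_iff)
  moreover have "disjoint C"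
    unfolding C_def
  proof (intro disjointI, clarsimp)
    fix m1 m2 assume "cz_cell (k - 1) m1 a r \<noteq> cz_cell (k - 1) m2 a r"
    then have "m1 \<noteq> m2" by auto
    then show "cz_cell (k - 1) m1 a r \<inter> cz_cell (k - 1) m2 a r = {}"
      by (auto simp: cz_cell_def mem_dyadic_cube fun_eq_iff)
  qed
  moreover have "C \<subseteq> CZ_cells" unfolding C_def CZ_cells_def using a r adm by (auto intro!: exI)
  moreover have "2 * measure rho D \<le> measure rho (cz_cell k m a r) \<and>
      measure rho (cz_cell k m a r) \<le> 2 ^ CARD('n) * measure rho D" if "D \<in> C" for D
  proof -
    have D: "measure rho D = 2 * r * (2 powi (k - 1)) ^ CARD('n)"
      using that a r by (auto simp: C_def cz_cell_rho)
    have R: "measure rho (cz_cell k m a r) = 2 ^ CARD('n) * measure rho D"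
      using a r unfolding D by (simp add: cz_cell_rho power_int_diff power_divide)
    show ?thesis
      unfolding R using two_le_power_card[where 'n = 'n]
      by (auto intro!: mult_right_mono)
  qed
  ultimately have "splits (cz_cell k m a r) C" using fin by (simp add: splits_def)
  then show ?thesis by blast
qed

text \<open>
  Taking logarithms, admissibility says that ln L - ln a lies in a window that depends on r
  only.
\<close>

lemma CZ_admissible_ln:
  assumes "0 < a" "0 < r" "0 < L"
  shows "CZ_admissible L a r \<longleftrightarrow>
    (if r < 1 then 2 + ln r \<le> ln L - ln a \<and> ln L - ln a < 8 + ln r
     else 2 * r \<le> ln L - ln a \<and> ln L - ln a < 8 * r)"
proof -
  have 1: "exp c * a * r \<le> L \<longleftrightarrow> c + ln r \<le> ln L - ln a" "L < exp c * a * r \<longleftrightarrow> ln L - ln a < c + ln r" for c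
  proof -
    have eq: "ln (exp c * a * r) = c + ln a + ln r" using assms by (simp add: ln_mult)
    show "exp c * a * r \<le> L \<longleftrightarrow> c + ln r \<le> ln L - ln a"
      using assms eq by (subst ln_le_cancel_iff[symmetric]) auto
    show "L < exp c * a * r \<longleftrightarrow> ln L - ln a < c + ln r"
      using assms eq by (subst ln_less_cancel_iff[symmetric]) auto
  qed
  have 2: "a * exp c \<le> L \<longleftrightarrow> c \<le> ln L - ln a" "L < a * exp c \<longleftrightarrow> ln L - ln a < c" for c
  proof -
    have eq: "ln (a * exp c) = c + ln a" using assms by (simp add: ln_mult)
    show "a * exp c \<le> L \<longleftrightarrow> c \<le> ln L - ln a"
      using assms eq by (subst ln_le_cancel_iff[symmetric]) auto
    show "L < a * exp c \<longleftrightarrow> ln L - ln a < c"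
      using assms eq by (subst ln_less_cancel_iff[symmetric]) auto
  qed
  show ?thesis unfolding CZ_admissible_def by (simp only: 1 2)
qed

text \<open>
  Halving the interval replaces r by r/2 and moves ln L - ln a by r/2 in either direction;
  halving the cube lowers ln L - ln a by ln 2. The admissible windows, from 2 + ln r to 8 + ln
  r or from 2 r to 8 r, are wide enough that the first move is possible in the lower part of
  the window and the second one in the upper part. The bounds 3 + ln r and 3 r separate the
  two parts.
\<close>

lemma CZ_cell_splits:
  assumes "R \<in> (CZ_cells :: ((real^'n::finite) \<times> real) set set)"
  shows "\<exists>C. splits R C"
proof -
  obtain k m a r where R: "R = cz_cell k m a r" and a: "0 < a" and r: "0 < r"
    and adm: "CZ_admissible (2 powi k) a r" using assms by (rule CZ_cellsE)
  define u where "u = ln (2 powi k) - ln a"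
  have u: "if r < 1 then 2 + ln r \<le> u \<and> u < 8 + ln r else 2 * r \<le> u \<and> u < 8 * r"
    using adm a r by (simp add: CZ_admissible_ln u_def)
  have ln2: "ln 2 < (1::real)" "1 / 2 \<le> ln (2::real)" using ln2_ge_two_thirds ln_less_self[of "2::real"] ln_2_less_1
    by auto
  show ?thesis
  proof (cases "if r < 1 then u < 3 + ln r else u < 3 * r")
    case True
    have lnr: "ln (r / 2) = ln r - ln 2" using r by (simp add: ln_div)
    have up: "ln r \<le> r - 1" using r by (rule ln_le_minus_one)
    have pos: "0 \<le> ln r" if "1 \<le> r" using that by simp
    have shift: "ln (2 powi k) - ln (a * exp c) = u - c" for c
      using a by (simp add: u_def ln_mult)
    have "CZ_admissible (2 powi k) (a * exp c) (r / 2)" if c: "c = - r / 2 \<or> c = r / 2" for c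
    proof -
      consider "r < 1" | "1 \<le> r" "r < 2" | "2 \<le> r" by linarith
      then show ?thesis
      proof cases
        case 1
        then show ?thesis using a r u True ln2 c by (auto simp: CZ_admissible_ln shift lnr)
      next
        case 2
        have ub: "v + r / 2 < 8 + (ln r - ln 2)" if "v < 3 * r" for v
          using that 2 ln2 pos by linarith
        show ?thesis
          using c
        proof
          assume "c = - r / 2"
          then show ?thesis using 2 a r u True ln2 up ub[of u] by (auto simp: CZ_admissible_ln shift lnr)
        next
          assume c: "c = r / 2"
          have "u - r / 2 < 8 + (ln r - ln 2)" using ub[of u] True 2 r by auto
          then show ?thesis using 2 a r u True ln2 up unfolding c by (auto simp: CZ_admissible_ln shift lnr)
        qed
      next
        case 3
        then show ?thesis using a r u True c by (auto simp: CZ_admissible_ln shift)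
      qed
    qed
    from this[of "- r / 2"] this[of "r / 2"]
    have "CZ_admissible (2 powi k) (a * exp (- r / 2)) (r / 2)"
      "CZ_admissible (2 powi k) (a * exp (r / 2)) (r / 2)" by simp_all
    then show ?thesis unfolding R by (intro split_interval a r)
  next
    case False
    have "ln (2 powi (k - 1)) = ln (2 powi k) - ln (2::real)"
      by (simp add: power_int_diff ln_div)
    then have "CZ_admissible (2 powi (k - 1)) a r"
      using a r u False ln2 by (auto simp: CZ_admissible_ln u_def split: if_splits)
    then show ?thesis unfolding R by (intro split_cube a r)
  qed
qed

section \<open>The tree of cells below a cell\<close>

definition children :: "((real^'n::finite) \<times> real) set \<Rightarrow> ((real^'n) \<times> real) set set" where
  "children R = (SOME C. splits R C)"

primrec generation :: "((real^'n::finite) \<times> real) set \<Rightarrow> nat \<Rightarrow> ((real^'n) \<times> real) set set" where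
  "generation R0 0 = {R0}"
| "generation R0 (Suc j) = (\<Union>R\<in>generation R0 j. children R)"

definition cell_tree :: "((real^'n::finite) \<times> real) set \<Rightarrow> ((real^'n) \<times> real) set set" where
  "cell_tree R0 = (\<Union>j. generation R0 j)"

lemma splits_children: "R \<in> CZ_cells \<Longrightarrow> splits R (children R)"
  unfolding children_def by (rule someI_ex) (rule CZ_cell_splits)

lemma generation_partition:
  assumes R0: "R0 \<in> CZ_cells"
  shows "finite (generation R0 j) \<and> generation R0 j \<subseteq> CZ_cells \<and> disjoint (generation R0 j) \<and>
    \<Union>(generation R0 j) = R0 \<and> (\<forall>R\<in>generation R0 j. 2 ^ j * measure rho R \<le> measure rho R0)"
proof (induction j)
  case 0 then show ?case using R0 by simp
next
  case (Suc j)
  have sp: "splits R (children R)" if "R \<in> generation R0 j" for R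
    using Suc that by (intro splits_children) auto
  have "finite (generation R0 (Suc j))" using Suc sp by (auto simp: splits_def)
  moreover have "generation R0 (Suc j) \<subseteq> CZ_cells" using sp by (fastforce simp: splits_def)
  moreover have "disjoint (generation R0 (Suc j))"
  proof (rule disjointI)
    fix D D' assume D: "D \<in> generation R0 (Suc j)" "D' \<in> generation R0 (Suc j)" "D \<noteq> D'"
    then obtain R R' where R: "R \<in> generation R0 j" "D \<in> children R"
      "R' \<in> generation R0 j" "D' \<in> children R'" by auto
    show "D \<inter> D' = {}"
    proof (cases "R = R'")
      case True
      then show ?thesis using sp[OF R(1)] R D by (auto simp: splits_def disjoint_def)
    next
      case False
      then have "R \<inter> R' = {}" using Suc R by (auto simp: disjoint_def)
      moreover have "D \<subseteq> R" "D' \<subseteq> R'"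
        using sp[OF R(1)] sp[OF R(3)] R by (auto simp: splits_def)
      ultimately show ?thesis by blast
    qed
  qed
  moreover have "\<Union>(generation R0 (Suc j)) = R0"
  proof -
    have "\<Union>(generation R0 (Suc j)) = (\<Union>R\<in>generation R0 j. \<Union>(children R))" by auto
    also have "\<dots> = (\<Union>R\<in>generation R0 j. R)" using sp by (intro SUP_cong) (auto simp: splits_def)
    finally show ?thesis using Suc by simp
  qed
  moreover have "2 ^ Suc j * measure rho D \<le> measure rho R0" if "D \<in> generation R0 (Suc j)" for D
  proof -
    obtain R where R: "R \<in> generation R0 j" "D \<in> children R" using \<open>D \<in> generation R0 (Suc j)\<close> by auto
    have "2 ^ Suc j * measure rho D = 2 ^ j * (2 * measure rho D)" by simp
    also have "\<dots> \<le> 2 ^ j * measure rho R"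
      using sp[OF R(1)] R by (intro mult_left_mono) (auto simp: splits_def)
    also have "\<dots> \<le> measure rho R0" using Suc R by auto
    finally show ?thesis .
  qed
  ultimately show ?case by blast
qed

lemma generation_ancestor:
  assumes R0: "R0 \<in> CZ_cells" and R: "R \<in> generation R0 (i + d)"
  shows "\<exists>P\<in>generation R0 i. R \<subseteq> P"
  using R
proof (induction d arbitrary: R)
  case 0 then show ?case by auto
next
  case (Suc d)
  then obtain P where P: "P \<in> generation R0 (i + d)" "R \<in> children P" by auto
  have "splits P (children P)"
    using generation_partition[OF R0, of "i + d"] P by (intro splits_children) auto
  then have "R \<subseteq> P" using P by (auto simp: splits_def)
  then show ?case using Suc.IH[OF P(1)] by blast
qed

lemma cell_tree_cells: "R0 \<in> CZ_cells \<Longrightarrow> cell_tree R0 \<subseteq> CZ_cells"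
  unfolding cell_tree_def using generation_partition by blast

lemma cell_bounds:
  assumes R: "R = cz_cell k m a r" and a: "0 < a" and r: "0 < r"
    and sub: "R \<subseteq> cz_cell k0 m0 a0 r0" and r0: "0 < r0" "0 < a0"
  shows "a0 * exp (- r0) \<le> a" "a * exp r \<le> a0 * exp r0"
proof -
  obtain x where x: "x \<in> dyadic_cube k m"
  proof
    show "(\<chi> i. 2 powi k * of_int (m i)) \<in> dyadic_cube k m" by (simp add: dyadic_cube_def)
  qed
  have "(x, a) \<in> R" using x a r by (simp add: R cz_cell_def)
  then show "a0 * exp (- r0) \<le> a" using sub by (auto simp: cz_cell_def)
  show "a * exp r \<le> a0 * exp r0"
  proof (rule dense_le_bounded)
    show "a * exp (- r) < a * exp r" using a r by simp
    fix w assume w: "a * exp (- r) < w" "w < a * exp r"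
    then have "(x, w) \<in> R" using x by (simp add: R cz_cell_def)
    then show "w \<le> a0 * exp r0" using sub by (auto simp: cz_cell_def)
  qed
qed

text \<open>
  For cells inside R0 the parameter a is bounded from above and from below. Then admissibility
  bounds the side from below by a multiple of min 1 r, so a small measure forces r to be
  small, and for small r it bounds the side by a multiple of r.
\<close>

lemma small_cell:
  fixes R0 :: "((real^'n::finite) \<times> real) set"
  assumes R0: "R0 \<in> CZ_cells" and e: "0 < e"
  shows "\<exists>\<eta>>0. \<forall>R\<in>CZ_cells. R \<subseteq> R0 \<longrightarrow> measure rho R < \<eta> \<longrightarrow> (\<forall>x\<in>R. \<forall>y\<in>R. dist x y < e)"
proof -
  obtain k0 m0 a0 r0 where R0eq: "R0 = cz_cell k0 m0 a0 r0" and a0: "0 < a0" and r0: "0 < r0"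
    using R0 by (rule CZ_cellsE)
  define \<alpha> where "\<alpha> = a0 * exp (- r0)"
  define \<beta> where "\<beta> = a0 * exp r0"
  have \<alpha>: "0 < \<alpha>" and \<beta>: "0 < \<beta>" using a0 by (auto simp: \<alpha>_def \<beta>_def)
  define C where "C = (real CARD('n) * exp 8 + 2) * \<beta>"
  have C: "0 < C" using \<beta> by (simp add: C_def add_nonneg_pos)
  \<comment> \<open>If r < \<delta>, the distance of two points of the cell is at most C \<delta>: the factor exp 8 comes from the upper
    bound of the side, the summand 2 from the length of the interval.\<close>
  define \<delta> where "\<delta> = min 1 (e / (2 * C))"
  have \<delta>: "0 < \<delta>" "\<delta> \<le> 1" using e C by (auto simp: \<delta>_def)
  have "C * \<delta> \<le> C * (e / (2 * C))" using C by (intro mult_left_mono) (auto simp: \<delta>_def)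
  then have C\<delta>: "C * \<delta> < e" using C e by simp
  \<comment> \<open>A lower bound for the measure of the cells with r at least \<delta>.\<close>
  define \<eta> where "\<eta> = 2 * \<delta> * (\<alpha> * \<delta>) ^ CARD('n)"
  have "0 < \<eta>" using \<delta> \<alpha> by (simp add: \<eta>_def)
  moreover have "dist x y < e"
    if R: "R \<in> CZ_cells" "R \<subseteq> R0" "measure rho R < \<eta>" and x: "x \<in> R" and y: "y \<in> R" for R x y
  proof -
    obtain k m a r where Req: "R = cz_cell k m a r" and a: "0 < a" and r: "0 < r"
      and adm: "CZ_admissible (2 powi k) a r" using R(1) by (rule CZ_cellsE)
    have \<alpha>a: "\<alpha> \<le> a" and a\<beta>: "a * exp r \<le> \<beta>"
      using cell_bounds[OF Req a r, of k0 m0 a0 r0] R(2) a0 r0 by (simp_all add: R0eq \<alpha>_def \<beta>_def)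
    have "a * 1 \<le> a * exp r" using a r by (intro mult_left_mono) auto
    then have a\<beta>': "a \<le> \<beta>" using a\<beta> by simp
    have r\<delta>: "r < \<delta>"
    proof (rule ccontr)
      assume "\<not> r < \<delta>"
      then have rd: "\<delta> \<le> r" by simp
      have L: "\<alpha> * \<delta> \<le> 2 powi k"
      proof (cases "r < 1")
        case True
        have "\<alpha> * \<delta> \<le> a * r" using \<alpha>a rd \<alpha> \<delta> by (intro mult_mono) auto
        also have "\<dots> \<le> exp 2 * (a * r)" using a r mult_right_mono[of 1 "exp 2" "a * r"] by simp
        also have "\<dots> \<le> 2 powi k" using adm True by (simp add: CZ_admissible_def mult.assoc)
        finally show ?thesis .
      next
        case False
        have "\<alpha> * \<delta> \<le> a * exp (2 * r)" using \<alpha>a \<delta> \<alpha> r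
          by (intro mult_mono) (auto intro: order_trans[of \<delta> 1])
        also have "\<dots> \<le> 2 powi k" using adm False by (simp add: CZ_admissible_def)
        finally show ?thesis .
      qed
      have "\<eta> \<le> 2 * r * (2 powi k) ^ CARD('n)"
        unfolding \<eta>_def using L rd \<delta> \<alpha> by (intro mult_mono power_mono) auto
      then show False using R(3) a r by (simp add: Req cz_cell_rho)
    qed
    then have r1: "r < 1" using \<delta> by simp
    have L: "2 powi k \<le> exp 8 * \<beta> * \<delta>"
    proof -
      have "2 powi k \<le> exp 8 * a * r" using adm r1 by (simp add: CZ_admissible_def)
      also have "\<dots> \<le> exp 8 * \<beta> * \<delta>" using a\<beta>' r\<delta> a r \<beta> by (intro mult_mono) auto
      finally show ?thesis .
    qed
    have d1: "dist (fst x) (fst y) \<le> real CARD('n) * exp 8 * \<beta> * \<delta>"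
    proof -
      have "dist (fst x) (fst y) \<le> (\<Sum>i\<in>UNIV. \<bar>(fst x - fst y) $ i\<bar>)"
        unfolding dist_norm by (rule norm_le_l1_cart)
      also have "\<dots> \<le> (\<Sum>i\<in>(UNIV :: 'n set). exp 8 * \<beta> * \<delta>)"
      proof (intro sum_mono)
        fix i
        have "2 powi k * of_int (m i) \<le> fst z $ i \<and> fst z $ i < 2 powi k * of_int (m i) + 2 powi k"
          if "z \<in> R" for z
          using that by (auto simp: Req cz_cell_def dyadic_cube_def distrib_left)
        from this[OF x] this[OF y] show "\<bar>(fst x - fst y) $ i\<bar> \<le> exp 8 * \<beta> * \<delta>"
          unfolding vector_minus_component using L by (intro abs_leI) linarith+
      qed
      finally show ?thesis by (simp add: mult_ac)
    qed
    have d2: "dist (snd x) (snd y) \<le> 2 * \<beta> * \<delta>"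
    proof -
      have "dist (snd x) (snd y) \<le> a * exp r - a * exp (- r)"
        using x y by (auto simp: Req cz_cell_def dist_real_def)
      also have "\<dots> = a * exp r * (1 - exp (- (2 * r)))"
        by (simp add: algebra_simps flip: exp_add)
      also have "\<dots> \<le> \<beta> * (2 * \<delta>)"
      proof (rule mult_mono)
        show "1 - exp (- (2 * r)) \<le> 2 * \<delta>"
          using exp_ge_add_one_self[of "- (2 * r)"] r\<delta> by linarith
      qed (use a\<beta> \<beta> r in auto)
      finally show ?thesis by (simp add: mult_ac)
    qed
    have "dist x y \<le> dist (fst x) (fst y) + dist (snd x) (snd y)"
      by (simp add: dist_prod_def sqrt_sum_squares_le_sum)
    also have "\<dots> \<le> C * \<delta>" using d1 d2 by (simp add: C_def algebra_simps)
    finally show ?thesis using C\<delta> by simp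
  qed
  ultimately show ?thesis by blast
qed

lemma cell_tree_fine:
  assumes R0: "R0 \<in> CZ_cells" and x: "x \<in> R0" and U: "open U" "x \<in> U"
  shows "\<exists>R\<in>cell_tree R0. x \<in> R \<and> R \<subseteq> U"
proof -
  obtain e where e: "0 < e" "ball x e \<subseteq> U" by (rule openE[OF U])
  obtain \<eta> where \<eta>: "0 < \<eta>"
    "\<And>R. R \<in> CZ_cells \<Longrightarrow> R \<subseteq> R0 \<Longrightarrow> measure rho R < \<eta> \<Longrightarrow> \<forall>x\<in>R. \<forall>y\<in>R. dist x y < e"
    using small_cell[OF R0 e(1)] by auto
  obtain j where j: "measure rho R0 / \<eta> < 2 ^ j"
    using real_arch_pow[of 2 "measure rho R0 / \<eta>"] by auto
  note gp = generation_partition[OF R0, of j]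
  obtain R where R: "R \<in> generation R0 j" "x \<in> R" using gp x by blast
  have "2 ^ j * measure rho R \<le> measure rho R0" using gp R by blast
  also have "\<dots> < 2 ^ j * \<eta>" using j \<eta> by (simp add: field_simps)
  finally have "measure rho R < \<eta>" by simp
  then have "\<forall>y\<in>R. dist x y < e" using \<eta>(2)[of R] R gp by blast
  then have "R \<subseteq> U" using e by (auto simp: ball_def)
  then show ?thesis using R unfolding cell_tree_def by blast
qed

text \<open>
  Lebesgue measure is outer regular, and the density of rho is bounded on R0, which stays away
  from the boundary of the half space. The cells inside an open set that contains B cover B.
\<close>

lemma cell_tree_outer:
  fixes R0 :: "((real^'n::finite) \<times> real) set"
  assumes R0: "R0 \<in> CZ_cells" and B: "B \<in> sets rho" "B \<subseteq> R0" and e: "0 < e"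
  shows "\<exists>U\<subseteq>cell_tree R0. B \<subseteq> \<Union>U \<and> emeasure rho (\<Union>U) \<le> emeasure rho B + ennreal e"
proof -
  obtain k0 m0 a0 r0 where R0eq: "R0 = cz_cell k0 m0 a0 r0" and a0: "0 < a0" and r0: "0 < r0"
    using R0 by (rule CZ_cellsE)
  define \<alpha> where "\<alpha> = a0 * exp (- r0)"
  have \<alpha>: "0 < \<alpha>" using a0 by (simp add: \<alpha>_def)
  have Bb: "B \<in> sets borel" using B by (simp add: sets_rho_iff)
  then have "B \<in> sets lebesgue" by simp
  then obtain W where W: "open W" "B \<subseteq> W" "emeasure lebesgue (W - B) < ennreal (\<alpha> * e)"
    using sets_lebesgue_outer_open[of B "\<alpha> * e"] \<alpha> e by (metis mult_pos_pos)
  define U where "U = {R \<in> cell_tree R0. R \<subseteq> W}"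
  have cover: "B \<subseteq> \<Union>U"
    using cell_tree_fine[OF R0] B(2) W unfolding U_def by blast
  have sub: "\<Union>U \<subseteq> B \<union> ((W - B) \<inter> R0)"
    using generation_partition[OF R0] by (auto simp: U_def cell_tree_def)
  have R0s: "R0 \<in> sets rho" by (rule CZ_cells_rho[OF R0])
  have WB: "W - B \<in> sets borel" using W Bb by auto
  have Ds: "(W - B) \<inter> R0 \<in> sets rho" using R0s WB by (auto simp: sets_rho_iff)
  have "emeasure rho (\<Union>U) \<le> emeasure rho (B \<union> ((W - B) \<inter> R0))"
    using sub B Ds by (intro emeasure_mono) auto
  also have "\<dots> \<le> emeasure rho B + emeasure rho ((W - B) \<inter> R0)"
    using B Ds by (intro emeasure_subadditive) auto
  also have "emeasure rho ((W - B) \<inter> R0) \<le> ennreal (1 / \<alpha>) * emeasure lborel ((W - B) \<inter> R0)"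
    by (rule emeasure_rho_le[OF Ds \<alpha>]) (auto simp: R0eq cz_cell_def \<alpha>_def)
  also have "emeasure lborel ((W - B) \<inter> R0) \<le> emeasure lborel (W - B)"
    using WB by (intro emeasure_mono) auto
  also have "\<dots> \<le> ennreal (\<alpha> * e)" using W(3) WB by (simp add: less_imp_le)
  also have "ennreal (1 / \<alpha>) * ennreal (\<alpha> * e) = ennreal e"
    using \<alpha> e by (simp add: ennreal_mult[symmetric])
  finally have "emeasure rho (\<Union>U) \<le> emeasure rho B + ennreal e"
    by (simp add: add_left_mono mult_left_mono)
  then show ?thesis using cover by (intro exI[of _ U]) (auto simp: U_def)
qed

lemma dyadic_tree_cell_tree:
  fixes R0 :: "((real^'n::finite) \<times> real) set"
  assumes R0: "R0 \<in> CZ_cells"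
  shows "dyadic_tree rho (cell_tree R0) R0 (2 ^ CARD('n))"
proof (rule dyadic_tree.intro[OF sigma_finite_rho], rule dyadic_tree_axioms.intro)
  let ?T = "cell_tree R0"
  note gp = generation_partition[OF R0]
  note cells = cell_tree_cells[OF R0]
  show "countable ?T"
    unfolding cell_tree_def using gp by (intro countable_UN) (auto intro: countable_finite)
  show "R \<in> sets rho" "0 < measure rho R" if "R \<in> ?T" for R
    using CZ_cells_rho[of R] cells that by auto
  have nest: "R \<subseteq> S \<or> S \<subseteq> R" if "R \<in> generation R0 i" "S \<in> generation R0 (i + d)" "R \<inter> S \<noteq> {}" for R S i d
  proof -
    obtain P where P: "P \<in> generation R0 i" "S \<subseteq> P" using generation_ancestor[OF R0] \<open>S \<in> _\<close> by blast
    have "R \<inter> P \<noteq> {}" using P that(3) by blast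
    moreover have "disjoint (generation R0 i)" using gp by blast
    ultimately have "R = P" using P(1) that(1) unfolding disjoint_def by blast
    then show ?thesis using P by simp
  qed
  show "R \<subseteq> S \<or> S \<subseteq> R" if RS: "R \<in> ?T" "S \<in> ?T" "R \<inter> S \<noteq> {}" for R S
  proof -
    obtain i j where ij: "R \<in> generation R0 i" "S \<in> generation R0 j" using RS by (auto simp: cell_tree_def)
    show ?thesis
    proof (cases "i \<le> j")
      case True
      then show ?thesis using nest[of R i S "j - i"] ij RS by simp
    next
      case False
      then show ?thesis using nest[of S j R "i - j"] ij RS by (simp add: Int_commute) blast
    qed
  qed
  show "finite {S \<in> ?T. R \<subseteq> S}" if R: "R \<in> ?T" for R
  proof -
    have Rp: "0 < measure rho R" using R cells CZ_cells_rho by blast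
    obtain j where j: "measure rho R0 / measure rho R < 2 ^ j"
      using real_arch_pow[of 2 "measure rho R0 / measure rho R"] by auto
    have "{S \<in> ?T. R \<subseteq> S} \<subseteq> (\<Union>i\<in>{..<j}. generation R0 i)"
    proof
      fix S assume "S \<in> {S \<in> ?T. R \<subseteq> S}"
      then obtain i where S: "S \<in> generation R0 i" "R \<subseteq> S" "S \<in> CZ_cells" using cells
        by (auto simp: cell_tree_def)
      have "measure rho R \<le> measure rho S"
        using S R cells CZ_cells_rho[of R] CZ_cells_rho[of S]
        by (intro measure_mono_fmeasurable) (auto simp: fmeasurable_def)
      then have "2 ^ i * measure rho R \<le> 2 ^ i * measure rho S" by simp
      also have "\<dots> \<le> measure rho R0" using gp S by blast
      also have "\<dots> < 2 ^ j * measure rho R" using j Rp by (simp add: field_simps)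
      finally have "(2::real) ^ i < 2 ^ j" using Rp by simp
      then have "i < j" by simp
      then show "S \<in> (\<Union>i\<in>{..<j}. generation R0 i)" using S by auto
    qed
    moreover have "finite (\<Union>i\<in>{..<j}. generation R0 i)" using gp by blast
    ultimately show ?thesis by (rule finite_subset)
  qed
  show "R0 \<in> ?T" unfolding cell_tree_def by (auto intro!: exI[of _ 0])
  show "R \<subseteq> R0" if "R \<in> ?T" for R using that gp by (auto simp: cell_tree_def)
  show "(1::real) \<le> 2 ^ CARD('n)" by simp
  show "\<exists>P\<in>?T. R \<subset> P \<and> measure rho P \<le> 2 ^ CARD('n) * measure rho R"
    if R: "R \<in> ?T" "R \<noteq> R0" for R
  proof -
    obtain i where i: "R \<in> generation R0 i" using R by (auto simp: cell_tree_def)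
    then obtain j where "i = Suc j" using R by (cases i) auto
    then obtain P where P: "P \<in> generation R0 j" "R \<in> children P" using i by auto
    have PT: "P \<in> ?T" using P by (auto simp: cell_tree_def)
    have sp: "splits P (children P)" using PT cells by (intro splits_children) auto
    have "R \<noteq> P" using sp P CZ_cells_rho(2)[of P] PT cells by (force simp: splits_def)
    then show ?thesis using sp P PT by (intro bexI[of _ P]) (auto simp: splits_def)
  qed
  show "\<exists>U\<subseteq>?T. B \<subseteq> \<Union>U \<and> emeasure rho (\<Union>U) \<le> emeasure rho B + ennreal e"
    if "B \<in> sets rho" "B \<subseteq> R0" "0 < e" for B e
    using cell_tree_outer[OF R0] that by blast
qed

section \<open>Mean oscillation on cells\<close>

text \<open>
  The upper edge that the cell lacks is a null set.
\<close>

lemma cell_to_CZ_set: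
  fixes R :: "((real^'n::finite) \<times> real) set"
  assumes R: "R \<in> CZ_cells"
  obtains R' where "R' \<in> CZ_sets" "R \<subseteq> R'" "R' \<in> sets rho" "AE z in rho. z \<in> R \<longleftrightarrow> z \<in> R'"
proof -
  obtain k m a r where Req: "R = cz_cell k m a r" and a: "0 < a" and r: "0 < r"
    and adm: "CZ_admissible (2 powi k) a r" using R by (rule CZ_cellsE)
  define R' where "R' = dyadic_cube k m \<times> {a * exp (- r) .. a * exp r}"
  define N where "N = dyadic_cube k m \<times> {a * exp r}"
  have pos: "{a * exp (- r) .. a * exp r} \<subseteq> {0<..}"
    using a by (auto intro: less_le_trans[of 0 "a * exp (- r)"])
  have R's: "R' \<in> sets rho"
    unfolding R'_def using pos by (intro Times_rho dyadic_cube_borel) auto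
  have "emeasure rho N = emeasure lborel (dyadic_cube k m) * (\<integral>\<^sup>+b\<in>{a * exp r}. ennreal (1 / b) \<partial>lborel)"
    unfolding N_def using a by (intro Times_rho dyadic_cube_borel) auto
  also have "(\<integral>\<^sup>+b\<in>{a * exp r}. ennreal (1 / b) \<partial>lborel) = 0"
    by (subst nn_integral_indicator_singleton) auto
  finally have "N \<in> null_sets rho"
    using a by (auto simp: null_sets_def N_def intro!: Times_rho dyadic_cube_borel)
  then have "AE z in rho. z \<notin> N" by (rule AE_not_in)
  then have ae: "AE z in rho. z \<in> R \<longleftrightarrow> z \<in> R'"
    by eventually_elim (auto simp: Req cz_cell_def R'_def N_def)
  have "R' \<in> CZ_sets" unfolding CZ_sets_def R'_def using a r adm by blast
  moreover have "R \<subseteq> R'" by (auto simp: Req cz_cell_def R'_def)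
  ultimately show thesis using that R's ae by blast
qed

lemma CZ_sets_rho:
  assumes "R \<in> (CZ_sets :: ((real^'n::finite) \<times> real) set set)" shows "R \<in> sets rho"
proof -
  obtain k m a r where R: "R = dyadic_cube k m \<times> {a * exp (- r) .. a * exp r}" and a: "0 < a"
    using assms unfolding CZ_sets_def by blast
  have "{a * exp (- r) .. a * exp r} \<subseteq> {0<..}"
    using a by (auto intro: less_le_trans[of 0 "a * exp (- r)"])
  then show ?thesis unfolding R by (intro Times_rho dyadic_cube_borel) auto
qed

lemma mean_osc_AE_cong:
  fixes f :: "'n::finite S_fun"
  assumes [measurable]: "f \<in> borel_measurable rho" "R \<in> sets rho" "R' \<in> sets rho"
    and ae: "AE z in rho. z \<in> R \<longleftrightarrow> z \<in> R'"
  shows "mean_osc f R' = mean_osc f R"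
proof -
  have m: "measure rho R' = measure rho R"
    using emeasure_eq_AE[OF ae] by (simp add: measure_def)
  have 1: "(LINT z:R'|rho. f z) = (LINT z:R|rho. f z)"
    by (rule set_integral_cong_set) (auto simp: ae set_borel_measurable_def)
  then have av: "average f R' = average f R" by (simp add: average_def m)
  have "(LINT z:R'|rho. norm (f z - average f R)) = (LINT z:R|rho. norm (f z - average f R))"
    by (rule set_integral_cong_set) (auto simp: ae set_borel_measurable_def)
  then show ?thesis by (simp add: mean_osc_def m av)
qed

lemma L1_loc_measurable: "f \<in> L1_loc \<Longrightarrow> f \<in> borel_measurable rho"
  by (simp add: L1_loc_def)

lemma L1_loc_cell:
  fixes f :: "'n::finite S_fun"
  assumes f: "f \<in> L1_loc" and R: "R \<in> CZ_cells"
  shows "set_integrable rho R f"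
proof -
  obtain R' where R': "R' \<in> CZ_sets" "R \<subseteq> R'" by (rule cell_to_CZ_set[OF R])
  show ?thesis
    by (rule set_integrable_subset[OF CZ_set_integrable[OF f R'(1)] _ R'(2)]) (rule CZ_cells_rho[OF R])
qed

lemma L1_loc_bounded_by:
  fixes f :: "'n::finite S_fun" and h :: "(real^'n) \<times> real \<Rightarrow> real"
  assumes f[measurable]: "f \<in> borel_measurable rho" and h: "integrable rho h"
    and le: "\<And>z. norm (f z) \<le> C + h z"
  shows "f \<in> L1_loc"
proof -
  have "set_integrable rho K f" if K: "compact K" "K \<subseteq> S_set" for K
  proof -
    note Kr[measurable] = emeasure_rho_compact(1)[OF K]
    have 1: "integrable rho (\<lambda>z. indicator K z *\<^sub>R C)"
      using emeasure_rho_compact[OF K] by (intro integrable_scaleR_left integrable_real_indicator)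
    have 2: "integrable rho (\<lambda>z. indicator K z *\<^sub>R h z)"
      by (rule integrable_mult_indicator[OF Kr h])
    show ?thesis
      unfolding set_integrable_def
      by (rule Bochner_Integration.integrable_bound[OF Bochner_Integration.integrable_add[OF 1 2]])
        (use le in \<open>auto simp: indicator_def intro!: AE_I2 order_trans[OF le]\<close>)
  qed
  then show ?thesis using f by (simp add: L1_loc_def)
qed

lemma Lp_fun_L1_loc:
  assumes p: "1 \<le> p" and f: "f \<in> Lp_fun p"
  shows "f \<in> L1_loc"
proof (rule L1_loc_bounded_by[where C = 1])
  show "f \<in> borel_measurable rho" "integrable rho (\<lambda>z. norm (f z) powr p)"
    using f by (auto simp: Lp_fun_def)
  show "norm (f z) \<le> 1 + norm (f z) powr p" for z
  proof (cases "norm (f z) \<le> 1")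
    case False
    then have "norm (f z) powr 1 \<le> norm (f z) powr p" using p by (intro powr_mono) auto
    then show ?thesis using False by simp
  qed (simp add: add_increasing2)
qed

context
  fixes f :: "'n::finite S_fun" and R :: "((real^'n) \<times> real) set"
  assumes fR: "set_integrable rho R f" and R: "R \<in> sets rho" "0 < measure rho R"
begin

lemma set_integrable_diff_const: "set_integrable rho R (\<lambda>z. f z - c)"
proof -
  have "emeasure rho R < \<infinity>" by (simp add: emeasure_eq_measure_of_pos[OF R(2)])
  then have "set_integrable rho R (\<lambda>_. c)"
    unfolding set_integrable_def using R by (intro integrable_scaleR_left integrable_real_indicator)
  then show ?thesis by (intro set_integral_diff fR)
qed

lemma nn_set_integral_norm:
  "(\<integral>\<^sup>+z\<in>R. ennreal (norm (f z - c)) \<partial>rho) = ennreal (LINT z:R|rho. norm (f z - c))"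
proof -
  have "(\<integral>\<^sup>+z\<in>R. ennreal (norm (f z - c)) \<partial>rho) = (\<integral>\<^sup>+z. ennreal (indicator R z * norm (f z - c)) \<partial>rho)"
    by (intro nn_integral_cong) (auto simp: indicator_def)
  also have "\<dots> = ennreal (LINT z:R|rho. norm (f z - c))"
    using set_integrable_norm[OF set_integrable_diff_const, of c]
    unfolding set_lebesgue_integral_def set_integrable_def
    by (subst nn_integral_eq_integral) auto
  finally show ?thesis .
qed

lemma norm_average_diff_le:
  "norm (average f R - c) * measure rho R \<le> (LINT z:R|rho. norm (f z - c))"
proof -
  have "(LINT z:R|rho. f z - c) = (LINT z:R|rho. f z) - (LINT z:R|rho. c)"
  proof (rule set_integral_diff(2)[OF fR])
    show "set_integrable rho R (\<lambda>_. c)"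
      using set_integral_diff(1)[OF fR set_integrable_diff_const[of c]] by simp
  qed
  also have "(LINT z:R|rho. c) = measure rho R *\<^sub>R c"
    using R by (simp add: set_integral_const emeasure_eq_measure_of_pos[OF R(2)])
  finally have "(LINT z:R|rho. f z - c) = measure rho R *\<^sub>R (average f R - c)"
    using R by (simp add: average_def scaleR_diff_right)
  then have "norm (average f R - c) * measure rho R = norm (LINT z:R|rho. f z - c)" by simp
  also have "\<dots> \<le> (LINT z:R|rho. norm (f z - c))"
    by (rule set_integral_norm_bound[OF set_integrable_diff_const])
  finally show ?thesis .
qed

lemma norm_average_diff_le_nn:
  "ennreal (norm (average f R - c)) * emeasure rho R \<le> (\<integral>\<^sup>+z\<in>R. ennreal (norm (f z - c)) \<partial>rho)"
  using norm_average_diff_le[of c]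
  by (simp add: nn_set_integral_norm emeasure_eq_measure_of_pos[OF R(2)] ennreal_mult[symmetric] ennreal_leI)

lemma nn_integral_osc:
  "(\<integral>\<^sup>+z\<in>R. ennreal (norm (f z - average f R)) \<partial>rho) = ennreal (mean_osc f R) * emeasure rho R"
proof -
  have "(LINT z:R|rho. norm (f z - average f R)) = mean_osc f R * measure rho R"
    using R by (simp add: mean_osc_def)
  then show ?thesis
    by (simp add: nn_set_integral_norm emeasure_eq_measure_of_pos[OF R(2)] ennreal_mult mean_osc_nonneg)
qed

lemma mean_osc_le_twice:
  "mean_osc f R * measure rho R \<le> 2 * (LINT z:R|rho. norm (f z - c))"
proof -
  have i1: "set_integrable rho R (\<lambda>z. norm (f z - d))" for d
    by (rule set_integrable_norm[OF set_integrable_diff_const])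
  have i2: "set_integrable rho R (\<lambda>_. d)" for d :: real
    unfolding set_integrable_def using R
    by (intro integrable_scaleR_left integrable_real_indicator) (auto simp: emeasure_eq_measure_of_pos[OF R(2)])
  have "mean_osc f R * measure rho R = (LINT z:R|rho. norm (f z - average f R))"
    using R by (simp add: mean_osc_def)
  also have "\<dots> \<le> (LINT z:R|rho. norm (f z - c) + norm (average f R - c))"
  proof (intro set_integral_mono i1 set_integral_add i2)
    fix z show "norm (f z - average f R) \<le> norm (f z - c) + norm (average f R - c)"
      using norm_triangle_ineq4[of "f z - c" "average f R - c"] by simp
  qed
  also have "\<dots> = (LINT z:R|rho. norm (f z - c)) + norm (average f R - c) * measure rho R"
    using R by (subst set_integral_add(2)[OF i1 i2]) (simp add: set_integral_const emeasure_eq_measure_of_pos[OF R(2)] mult.commute)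
  also have "\<dots> \<le> 2 * (LINT z:R|rho. norm (f z - c))" using norm_average_diff_le[of c] by simp
  finally show ?thesis .
qed

end

lemma mean_osc_le_bmo:
  assumes "R \<in> CZ_sets" "bmo_seminorm f < \<infinity>"
  shows "mean_osc f R \<le> enn2real (bmo_seminorm f)"
proof -
  have "ennreal (mean_osc f R) \<le> bmo_seminorm f" unfolding bmo_seminorm_def by (rule SUP_upper[OF assms(1)])
  then have "enn2real (ennreal (mean_osc f R)) \<le> enn2real (bmo_seminorm f)"
    using assms(2) by (intro enn2real_mono) auto
  then show ?thesis by (simp add: mean_osc_nonneg)
qed

text \<open>
  The functions f and f0 + f1 differ by a function of vanishing seminorm.
\<close>

lemma mean_osc_decomposition:
  fixes f f0 f1 :: "'n::finite S_fun"
  assumes f: "f \<in> L1_loc" and f0: "f0 \<in> L1_loc" and f1: "f1 \<in> BMO_fun"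
    and eq: "bmo_class f = bmo_class f0 + bmo_class f1" and R: "R \<in> CZ_cells"
  shows "mean_osc f R \<le> mean_osc f0 R + enn2real (bmo_seminorm f1)"
proof -
  have f1': "f1 \<in> L1_loc" "bmo_seminorm f1 < \<infinity>" using f1 by (auto simp: BMO_fun_def)
  have g: "f0 + f1 \<in> L1_loc" using L1_loc_add[OF f0 f1'(1)] by (simp add: plus_fun_def)
  have "bmo_class f = bmo_class (f0 + f1)" using eq bmo_class_add[OF f0 f1'(1)] by simp
  then have z: "bmo_seminorm (\<lambda>z. f z - (f0 + f1) z) = 0" using bmo_class_eq_iff[OF f g] by simp
  obtain R' where R': "R' \<in> CZ_sets" "R' \<in> sets rho" "AE z in rho. z \<in> R \<longleftrightarrow> z \<in> R'"
    by (rule cell_to_CZ_set[OF R])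
  have eqo: "mean_osc h R' = mean_osc h R" if "h \<in> L1_loc" for h :: "'n S_fun"
    using that R' CZ_cells_rho[OF R] by (intro mean_osc_AE_cong L1_loc_measurable) auto
  have "mean_osc f R' = mean_osc (\<lambda>z. (f z - (f0 + f1) z) + (f0 + f1) z) R'" by simp
  also have "\<dots> \<le> mean_osc (\<lambda>z. f z - (f0 + f1) z) R' + mean_osc (f0 + f1) R'"
    using mean_osc_add_le[OF L1_loc_diff[OF f g] g R'(1)] by simp
  also have "mean_osc (\<lambda>z. f z - (f0 + f1) z) R' \<le> 0"
    using mean_osc_le_bmo[OF R'(1), of "\<lambda>z. f z - (f0 + f1) z"] z by simp
  also have "mean_osc (f0 + f1) R' \<le> mean_osc f0 R' + mean_osc f1 R'"
    using mean_osc_add_le[OF f0 f1'(1) R'(1)] by (simp add: plus_fun_def)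
  also have "mean_osc f1 R' \<le> enn2real (bmo_seminorm f1)"
    by (rule mean_osc_le_bmo[OF R'(1) f1'(2)])
  finally show ?thesis by (simp add: eqo[OF f] eqo[OF f0])
qed

section \<open>The K-functional and the local estimate\<close>

lemma Lp_norm_nonneg: "0 \<le> Lp_norm p f" by (simp add: Lp_norm_def)

lemma nrm_Lp_le:
  assumes "f \<in> c" "f \<in> Lp_fun p"
  shows "nrm (Lp_space p) c \<le> Lp_norm p f"
  unfolding Lp_space_def using assms
  by (auto intro!: cINF_lower bdd_belowI2[of _ 0] Lp_norm_nonneg)

lemma nrm_BMO_le:
  assumes "f \<in> c" shows "nrm BMO_space c \<le> enn2real (bmo_seminorm f)"
  unfolding BMO_space_def using assms by (auto intro!: cINF_lower bdd_belowI2[of _ 0])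

lemma elems_Lp_nonempty:
  assumes "1 \<le> p" "c \<in> elems (Lp_space p)"
  shows "c \<inter> Lp_fun p \<noteq> {}"
proof -
  obtain f where "f \<in> Lp_fun p" "c = bmo_class f" using assms(2) by (auto simp: Lp_space_def)
  then show ?thesis using bmo_class_self[OF Lp_fun_L1_loc[OF assms(1)]] by blast
qed

lemma elems_BMO_nonempty:
  assumes "c \<in> elems BMO_space" shows "c \<noteq> {}"
proof -
  obtain f where "f \<in> BMO_fun" "c = bmo_class f" using assms by (auto simp: BMO_space_def)
  then show ?thesis using bmo_class_self[of f] by (auto simp: BMO_fun_def)
qed

lemma nrm_Lp_nonneg: "1 \<le> p \<Longrightarrow> c \<in> elems (Lp_space p) \<Longrightarrow> 0 \<le> nrm (Lp_space p) c"
  using elems_Lp_nonempty[of p c] unfolding Lp_space_def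
  by (auto intro!: cINF_greatest Lp_norm_nonneg)

lemma nrm_BMO_nonneg: "c \<in> elems BMO_space \<Longrightarrow> 0 \<le> nrm BMO_space c"
  using elems_BMO_nonempty[of c] unfolding BMO_space_def
  by (auto intro!: cINF_greatest)

lemma Lp_reps:
  assumes p: "1 \<le> p" and c: "c \<in> elems (Lp_space p)" and e: "nrm (Lp_space p) c < e"
  obtains f where "f \<in> Lp_fun p" "c = bmo_class f" "Lp_norm p f < e"
proof -
  obtain g where g: "g \<in> Lp_fun p" "c = bmo_class g" using c by (auto simp: Lp_space_def)
  have "(INF f\<in>c \<inter> Lp_fun p. Lp_norm p f) < e" using e by (simp add: Lp_space_def)
  then obtain f where f: "f \<in> c" "f \<in> Lp_fun p" "Lp_norm p f < e"
    using cInf_lessD[of "Lp_norm p ` (c \<inter> Lp_fun p)" e] elems_Lp_nonempty[OF p c] by blast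
  have fL: "f \<in> L1_loc" and gL: "g \<in> L1_loc" using Lp_fun_L1_loc[OF p] f g by auto
  have "bmo_class f = bmo_class g"
    using f g by (simp add: bmo_class_eq_iff[OF fL gL]) (simp add: bmo_class_def)
  then show thesis using that f g by simp
qed

text \<open>
  All representatives of a BMO class have the same seminorm, so the infimum in the norm is
  attained.
\<close>

lemma BMO_reps:
  assumes c: "c \<in> elems BMO_space"
  obtains f where "f \<in> BMO_fun" "c = bmo_class f" "nrm BMO_space c = enn2real (bmo_seminorm f)"
proof -
  obtain g where g: "g \<in> BMO_fun" "c = bmo_class g" using c by (auto simp: BMO_space_def)
  then have "g \<in> L1_loc" by (simp add: BMO_fun_def)
  then have "(INF f\<in>c. enn2real (bmo_seminorm f)) = (INF f\<in>c. enn2real (bmo_seminorm g))"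
    using g bmo_seminorm_cong[of g] by (intro INF_cong) auto
  also have "\<dots> = enn2real (bmo_seminorm g)" using elems_BMO_nonempty[OF c] by simp
  finally show thesis using that g by (simp add: BMO_space_def)
qed

definition K_values :: "real \<Rightarrow> real \<Rightarrow> 'n::finite S_fun set \<Rightarrow> real set" where
  "K_values p t x = {nrm (Lp_space p) x0 + t * nrm BMO_space x1 | x0 x1.
     x0 \<in> elems (Lp_space p) \<and> x1 \<in> elems BMO_space \<and> x = x0 + x1}"

abbreviation K_Lp_BMO :: "real \<Rightarrow> real \<Rightarrow> 'n::finite S_fun set \<Rightarrow> real" where
  "K_Lp_BMO p t x \<equiv> K_functional (Lp_space p) BMO_space t x"

lemma K_Inf: "K_Lp_BMO p t x = Inf (K_values p t x)"
  unfolding K_functional_def K_values_def ..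

lemma K_values_nonneg: "1 \<le> p \<Longrightarrow> 0 \<le> t \<Longrightarrow> v \<in> K_values p t x \<Longrightarrow> 0 \<le> v"
  unfolding K_values_def by (auto intro!: add_nonneg_nonneg mult_nonneg_nonneg nrm_Lp_nonneg nrm_BMO_nonneg)

lemma K_le:
  assumes p: "1 \<le> p" and t: "0 \<le> t" and f0: "f0 \<in> Lp_fun p" and f1: "f1 \<in> BMO_fun"
    and x: "x = bmo_class f0 + bmo_class f1"
  shows "K_Lp_BMO p t x \<le> Lp_norm p f0 + t * enn2real (bmo_seminorm f1)"
proof -
  have s: "f0 \<in> bmo_class f0" "f1 \<in> bmo_class f1"
    using Lp_fun_L1_loc[OF p f0] f1 by (auto intro: bmo_class_self simp: BMO_fun_def)
  have "K_Lp_BMO p t x \<le> nrm (Lp_space p) (bmo_class f0) + t * nrm BMO_space (bmo_class f1)"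
    unfolding K_Inf
  proof (rule cInf_lower)
    show "bdd_below (K_values p t x)" using K_values_nonneg[OF p t] by (intro bdd_belowI[of _ 0]) auto
    show "nrm (Lp_space p) (bmo_class f0) + t * nrm BMO_space (bmo_class f1) \<in> K_values p t x"
      unfolding K_values_def using f0 f1 x by (auto simp: Lp_space_def BMO_space_def)
  qed
  also have "\<dots> \<le> Lp_norm p f0 + t * enn2real (bmo_seminorm f1)"
    using t s f0 by (intro add_mono mult_left_mono nrm_Lp_le nrm_BMO_le) auto
  finally show ?thesis .
qed

locale class_sum =
  fixes p :: real and x :: "'n::finite S_fun set"
  assumes p: "1 \<le> p"
    and sum: "\<exists>x0\<in>elems (Lp_space p). \<exists>x1\<in>elems BMO_space. x = x0 + x1"
begin

lemma K_values_nonempty: "K_values p t x \<noteq> {}" using sum unfolding K_values_def by blast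

lemma K_nonneg: "0 \<le> t \<Longrightarrow> 0 \<le> K_Lp_BMO p t x"
  unfolding K_Inf using K_values_nonneg[OF p] K_values_nonempty by (intro cInf_greatest) auto

lemma K_mono:
  assumes "0 \<le> s" "s \<le> t" shows "K_Lp_BMO p s x \<le> K_Lp_BMO p t x"
  unfolding K_Inf
proof (rule cInf_mono[OF K_values_nonempty])
  show "bdd_below (K_values p s x)"
    using K_values_nonneg[OF p] assms by (intro bdd_belowI[of _ 0]) auto
  fix b assume "b \<in> K_values p t x"
  then obtain x0 x1 where b: "b = nrm (Lp_space p) x0 + t * nrm BMO_space x1"
    and x01: "x0 \<in> elems (Lp_space p)" "x1 \<in> elems BMO_space" "x = x0 + x1"
    unfolding K_values_def by blast
  have "nrm (Lp_space p) x0 + s * nrm BMO_space x1 \<in> K_values p s x"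
    unfolding K_values_def using x01 by blast
  moreover have "nrm (Lp_space p) x0 + s * nrm BMO_space x1 \<le> b"
    unfolding b using assms nrm_BMO_nonneg[OF x01(2)] by (simp add: mult_right_mono)
  ultimately show "\<exists>a\<in>K_values p s x. a \<le> b" by blast
qed

lemma K_decomposition:
  assumes t: "0 \<le> t" and k: "K_Lp_BMO p t x < k"
  obtains f0 f1 where "f0 \<in> Lp_fun p" "f1 \<in> BMO_fun" "x = bmo_class f0 + bmo_class f1"
    "Lp_norm p f0 + t * enn2real (bmo_seminorm f1) < k"
proof -
  obtain v where v: "v \<in> K_values p t x" "v < k"
    using cInf_lessD[OF K_values_nonempty] k unfolding K_Inf by blast
  then obtain x0 x1 where veq: "v = nrm (Lp_space p) x0 + t * nrm BMO_space x1"
    and x01: "x0 \<in> elems (Lp_space p)" "x1 \<in> elems BMO_space" "x = x0 + x1"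
    unfolding K_values_def by blast
  obtain f1 where f1: "f1 \<in> BMO_fun" "x1 = bmo_class f1" "nrm BMO_space x1 = enn2real (bmo_seminorm f1)"
    using BMO_reps[OF x01(2)] by blast
  have "nrm (Lp_space p) x0 < k - t * nrm BMO_space x1" using v veq by simp
  then obtain f0 where "f0 \<in> Lp_fun p" "x0 = bmo_class f0" "Lp_norm p f0 < k - t * nrm BMO_space x1"
    using Lp_reps[OF p x01(1)] by blast
  then show thesis using that[of f0 f1] f1 x01 by simp
qed

lemma measurable_K: "(\<lambda>t. if 0 < t then K_Lp_BMO p t x else 0) \<in> borel_measurable borel"
  by (intro borel_measurable_mono monoI) (auto intro: K_mono K_nonneg)

text \<open>
  The condition on \<theta> turns the weight t^(-\<theta> q) dt/t, applied to K^q, into the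
  measure d(t^p)/p, applied to (K/t)^q.
\<close>

lemma interp_integral_power_measure:
  assumes c: "0 \<le> c" and pq: "p < q" and \<theta>: "\<theta> * q = q - p"
  shows "(\<integral>\<^sup>+t. ennreal ((c * ((if 0 < t then K_Lp_BMO p t x else 0) / t)) powr q) \<partial>power_measure p)
    = ennreal (c powr q * p) * interp_integral (Lp_space p) BMO_space \<theta> q x"
proof -
  let ?K = "\<lambda>t. if 0 < t then K_Lp_BMO p t x else 0"
  note [measurable] = measurable_K
  have "(\<integral>\<^sup>+t. ennreal ((c * (?K t / t)) powr q) \<partial>power_measure p)
     = (\<integral>\<^sup>+t. ennreal (p * t powr (p - 1)) * indicator {0<..} t * ennreal ((c * (?K t / t)) powr q) \<partial>lborel)"
    by (subst nn_integral_power_measure) auto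
  also have "\<dots> = (\<integral>\<^sup>+t. ennreal (c powr q * p) *
      (ennreal ((t powr (- \<theta>) * ?K t) powr q / t) * indicator {0<..} t) \<partial>lborel)"
  proof (intro nn_integral_cong)
    fix t :: real
    show "ennreal (p * t powr (p - 1)) * indicator {0<..} t * ennreal ((c * (?K t / t)) powr q)
      = ennreal (c powr q * p) * (ennreal ((t powr (- \<theta>) * ?K t) powr q / t) * indicator {0<..} t)"
    proof (cases "0 < t")
      case True
      let ?k = "K_Lp_BMO p t x"
      have k: "0 \<le> ?k" using K_nonneg True by simp
      have 1: "(c * (?k / t)) powr q = c powr q * (?k powr q * t powr (- q))"
        using c k True by (simp add: powr_mult powr_divide powr_minus_divide)
      have 2: "(t powr (- \<theta>) * ?k) powr q / t = ?k powr q * t powr (- (q - p)) * t powr (- 1)"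
      proof -
        have "(t powr (- \<theta>)) powr q = t powr (- (q - p))" by (simp add: powr_powr \<theta>)
        moreover have "t powr (- 1) = 1 / t" using True by (simp add: powr_minus_divide)
        ultimately show ?thesis using k True by (simp add: powr_mult)
      qed
      have 3: "t powr (p - 1) * t powr (- q) = t powr (- (q - p)) * t powr (- 1)"
      proof -
        have "p - 1 + - q = - (q - p) + - 1" by simp
        then show ?thesis unfolding powr_add[symmetric] by (rule arg_cong)
      qed
      have "(p * t powr (p - 1)) * (c * (?k / t)) powr q
          = (c powr q * p) * (?k powr q * (t powr (p - 1) * t powr (- q)))"
        unfolding 1 by (simp only: mult_ac)
      also have "\<dots> = (c powr q * p) * ((t powr (- \<theta>) * ?k) powr q / t)"
        unfolding 2 3 by (simp only: mult_ac)
      finally have "(p * t powr (p - 1)) * (c * (?k / t)) powr q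
          = (c powr q * p) * ((t powr (- \<theta>) * ?k) powr q / t)" .
      then show ?thesis
        using True p by (simp add: ennreal_mult[symmetric])
    qed simp
  qed
  also have "\<dots> = ennreal (c powr q * p) * (\<integral>\<^sup>+t\<in>{0<..}. ennreal ((t powr (- \<theta>) * ?K t) powr q / t) \<partial>lborel)"
    by (subst nn_integral_cmult) auto
  also have "(\<integral>\<^sup>+t\<in>{0<..}. ennreal ((t powr (- \<theta>) * ?K t) powr q / t) \<partial>lborel)
      = interp_integral (Lp_space p) BMO_space \<theta> q x"
    unfolding interp_integral_def by (intro nn_integral_cong) (auto simp: indicator_def)
  finally show ?thesis .
qed

text \<open>
  Decompose f = f0 + f1 with L^p norm of f0 plus t times the norm of f1 less than k. The
  oscillation of f1 contributes less than k/t to that of f, so a cell on which the oscillation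
  of f exceeds 2 k/t has an average of |f0| of at least k/(2t). By Jensen's inequality the
  average of |f0|^p is at least (k/(2t))^p, and the weak-type estimate for |f0|^p, whose
  integral is at most k^p, gives the bound.
\<close>

lemma sharp_level_measure:
  fixes R0 :: "((real^'n) \<times> real) set"
  assumes f: "f \<in> L1_loc" and xf: "x = bmo_class f" and R0: "R0 \<in> CZ_cells"
    and t: "0 < t" and k: "K_Lp_BMO p t x < k"
  shows "emeasure rho (\<Union>(dyadic_tree.level_cells rho (cell_tree R0)
      (\<lambda>R z. norm (f z - average f R)) (2 * k / t))) \<le> ennreal ((2 * t) powr p)"
proof -
  interpret T: dyadic_tree rho "cell_tree R0" R0 "2 ^ CARD('n)" by (rule dyadic_tree_cell_tree[OF R0])
  let ?U = "T.level_cells (\<lambda>R z. norm (f z - average f R)) (2 * k / t)"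
  have k0: "0 < k" using K_nonneg[of t] k t by simp
  obtain f0 f1 where f0: "f0 \<in> Lp_fun p" and f1: "f1 \<in> BMO_fun" and xeq: "x = bmo_class f0 + bmo_class f1"
    and lt: "Lp_norm p f0 + t * enn2real (bmo_seminorm f1) < k"
    using K_decomposition[OF less_imp_le[OF t] k] by blast
  define \<beta> where "\<beta> = enn2real (bmo_seminorm f1)"
  have \<beta>: "\<beta> < k / t"
    using lt t Lp_norm_nonneg[of p f0] by (simp add: \<beta>_def field_simps)
  have f0L: "f0 \<in> L1_loc" by (rule Lp_fun_L1_loc[OF p f0])
  have [measurable]: "f0 \<in> borel_measurable rho" by (rule L1_loc_measurable[OF f0L])
  note cells = cell_tree_cells[OF R0]
  define N where "N = density rho (\<lambda>z. ennreal (norm (f0 z) powr p))"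
  have le: "emeasure (scale_measure (ennreal ((k / (2 * t)) powr p)) rho) (\<Union>?U) \<le> emeasure N (\<Union>?U)"
  proof (rule T.union_mono[OF T.level_cells_sub])
    fix R assume R: "R \<in> ?U"
    then have RT: "R \<in> cell_tree R0" using T.level_cells_sub by auto
    then have RC: "R \<in> CZ_cells" using cells by blast
    note Rr = CZ_cells_rho[OF RC]
    note fR = L1_loc_cell[OF f RC] and f0R = L1_loc_cell[OF f0L RC]
    have "ennreal (2 * k / t) * emeasure rho R < ennreal (mean_osc f R) * emeasure rho R"
      using R nn_integral_osc[OF fR Rr(1,2)] by (simp add: T.level_cells_def)
    then have "2 * k / t * measure rho R < mean_osc f R * measure rho R"
      using Rr k0 t by (simp add: ennreal_mult[symmetric] mean_osc_nonneg ennreal_less_iff)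
    also have "\<dots> \<le> (mean_osc f0 R + \<beta>) * measure rho R"
      using mean_osc_decomposition[OF f f0L f1 _ RC] xf xeq by (intro mult_right_mono) (auto simp: \<beta>_def)
    also have "\<dots> \<le> 2 * (LINT z:R|rho. norm (f0 z)) + k / t * measure rho R"
    proof -
      have "\<beta> * measure rho R \<le> k / t * measure rho R" using \<beta> Rr(2) by (intro mult_right_mono) auto
      then show ?thesis
        using mean_osc_le_twice[OF f0R Rr(1,2), of 0] unfolding distrib_right by simp
    qed
    finally have lt: "2 * k / t * measure rho R < 2 * (LINT z:R|rho. norm (f0 z)) + k / t * measure rho R" .
    define X where "X = k / t * measure rho R"
    have "2 * X < 2 * (LINT z:R|rho. norm (f0 z)) + X" using lt by (simp add: X_def mult.assoc)
    then have "X / 2 \<le> (LINT z:R|rho. norm (f0 z))" by simp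
    moreover have "k / (2 * t) * measure rho R = X / 2" by (simp add: X_def)
    ultimately have "k / (2 * t) * measure rho R \<le> (LINT z:R|rho. norm (f0 z))" by (simp only:)
    then have "ennreal (k / (2 * t)) * emeasure rho R \<le> (\<integral>\<^sup>+z\<in>R. ennreal (norm (f0 z)) \<partial>rho)"
      using nn_set_integral_norm[OF f0R Rr(1,2), of 0] Rr k0 t
      by (simp add: ennreal_mult[symmetric] ennreal_leI)
    then have "ennreal ((k / (2 * t)) powr p) * emeasure rho R \<le> (\<integral>\<^sup>+z\<in>R. ennreal (norm (f0 z) powr p) \<partial>rho)"
      using p k0 t Rr by (intro jensen_powr) auto
    then show "emeasure (scale_measure (ennreal ((k / (2 * t)) powr p)) rho) R \<le> emeasure N R"
      using Rr by (simp add: N_def emeasure_density)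
  qed (auto simp: N_def)
  have "emeasure N (\<Union>?U) \<le> emeasure N (space N)" by (rule emeasure_space)
  also have "\<dots> = (\<integral>\<^sup>+z. ennreal (norm (f0 z) powr p) \<partial>rho)"
    by (simp add: N_def emeasure_density cong: nn_integral_cong)
  also have "\<dots> = ennreal (LINT z|rho. norm (f0 z) powr p)"
    using f0 by (intro nn_integral_eq_integral) (auto simp: Lp_fun_def)
  also have "\<dots> = ennreal (Lp_norm p f0 powr p)"
    using p by (simp add: Lp_norm_def powr_powr integral_nonneg_AE)
  also have "\<dots> \<le> ennreal (k powr p)"
  proof (intro ennreal_leI powr_mono2)
    have "0 \<le> t * enn2real (bmo_seminorm f1)" using t by simp
    then show "Lp_norm p f0 \<le> k" using lt by linarith
  qed (use p in \<open>auto simp: Lp_norm_nonneg\<close>)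
  finally have "ennreal ((k / (2 * t)) powr p) * emeasure rho (\<Union>?U) \<le> ennreal (k powr p)"
    using le by simp
  also have "ennreal (k powr p) = ennreal ((k / (2 * t)) powr p) * ennreal ((2 * t) powr p)"
    using k0 t by (simp add: ennreal_mult[symmetric] powr_mult[symmetric])
  finally show ?thesis
    using k0 t by (subst (asm) ennreal_mult_le_mult_iff) auto
qed

text \<open>
  The local Fefferman--Stein inequality combined with the previous bound: where the distribution
  function of the sharp function exceeds (2t)^p, the argument is at most a multiple of K(t)/t,
  and the exchange lemma applies with q and p in the roles of its two exponents. The number g
  is the largest one that the good-lambda argument admits for cells whose parents are at most
  2^n times larger.
\<close>

lemma local_interpolation_estimate:
  fixes R0 :: "((real^'n) \<times> real) set"
  assumes f: "f \<in> L1_loc" and xf: "x = bmo_class f" and R0: "R0 \<in> CZ_cells"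
    and pq: "p < q" and \<theta>: "\<theta> * q = q - p"
    and g: "g = 1 / (2 powr (q + 1) * 2 ^ CARD('n))"
  shows "(\<integral>\<^sup>+z\<in>R0. ennreal (norm (f z - average f R0) powr q) \<partial>rho)
    \<le> ennreal (2 powr (q + 1) * (2 powr p * ((2 / g) powr q * p))) *
      interp_integral (Lp_space p) BMO_space \<theta> q x"
proof -
  interpret T: dyadic_tree rho "cell_tree R0" R0 "2 ^ CARD('n)" by (rule dyadic_tree_cell_tree[OF R0])
  let ?U = "\<lambda>s. T.level_cells (\<lambda>R z. norm (f z - average f R)) s"
  let ?K = "\<lambda>t. if 0 < t then K_Lp_BMO p t x else 0"
  let ?I = "interp_integral (Lp_space p) BMO_space \<theta> q x"
  have g0: "0 < g" by (simp add: g)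
  note cells = cell_tree_cells[OF R0]
  define D where "D s = measure rho (\<Union>(?U (g * s)))" for s
  have De: "emeasure rho (\<Union>(?U s)) = ennreal (measure rho (\<Union>(?U s)))" for s
    by (rule T.union_emeasure[OF T.level_cells_sub])
  have "(\<integral>\<^sup>+z\<in>R0. ennreal (norm (f z - average f R0) powr q) \<partial>rho)
      \<le> ennreal (2 powr (q + 1)) * (\<integral>\<^sup>+s. ennreal (D s) \<partial>power_measure q)"
    unfolding D_def
  proof (rule T.local_fefferman_stein[OF L1_loc_measurable[OF f]])
    fix R c assume "R \<in> cell_tree R0"
    then have RC: "R \<in> CZ_cells" using cells by blast
    show "ennreal (norm (average f R - c)) * emeasure rho R \<le> (\<integral>\<^sup>+z\<in>R. ennreal (norm (f z - c)) \<partial>rho)"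
      by (rule norm_average_diff_le_nn[OF L1_loc_cell[OF f RC] CZ_cells_rho(1,2)[OF RC]])
  qed (use p pq g0 in \<open>auto simp: g\<close>)
  also have "(\<integral>\<^sup>+s. ennreal (D s) \<partial>power_measure q)
      = (\<integral>\<^sup>+s. ennreal (2 powr p) * ennreal ((D s powr (1 / p) / 2) powr p) \<partial>power_measure q)"
    using p by (intro nn_integral_cong)
      (simp add: ennreal_mult[symmetric] powr_divide powr_powr D_def)
  also have "\<dots> = ennreal (2 powr p) * (\<integral>\<^sup>+s. ennreal ((D s powr (1 / p) / 2) powr p) \<partial>power_measure q)"
  proof (rule nn_integral_cmult)
    have [measurable]: "D \<in> borel_measurable borel"
      unfolding D_def by (rule measurable_compose[OF _ T.measurable_level_measure]) simp
    show "(\<lambda>s. ennreal ((D s powr (1 / p) / 2) powr p)) \<in> borel_measurable (power_measure q)" by simp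
  qed
  also have "(\<integral>\<^sup>+s. ennreal ((D s powr (1 / p) / 2) powr p) \<partial>power_measure q)
      \<le> (\<integral>\<^sup>+t. ennreal (((2 / g) * (?K t / t)) powr q) \<partial>power_measure p)"
  proof (rule tonelli_exchange)
    note [measurable] = measurable_K
    show "(\<lambda>t. (2 / g) * (?K t / t)) \<in> borel_measurable borel" by measurable
    show "0 \<le> (2 / g) * (?K t / t)" if "0 < t" for t using that g0 K_nonneg[of t] by simp
    show "s \<le> (2 / g) * (?K t / t)" if t: "0 < t" and s: "0 < s" and lt: "t < D s powr (1 / p) / 2" for t s
    proof (rule ccontr)
      assume "\<not> s \<le> (2 / g) * (?K t / t)"
      then have k: "K_Lp_BMO p t x < g * s * t / 2" using t g0 by (simp add: field_simps)
      have "ennreal (D s) \<le> ennreal ((2 * t) powr p)"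
        using sharp_level_measure[OF f xf R0 t k] t by (simp add: D_def De)
      then have "D s \<le> (2 * t) powr p" by simp
      then have "D s powr (1 / p) \<le> ((2 * t) powr p) powr (1 / p)"
        using p by (intro powr_mono2) (auto simp: D_def)
      also have "\<dots> = 2 * t" using p t by (simp add: powr_powr)
      finally show False using lt by simp
    qed
  qed (use p pq in auto)
  also have "\<dots> = ennreal ((2 / g) powr q * p) * ?I"
    using g0 pq by (intro interp_integral_power_measure \<theta>) auto
  finally show ?thesis
    using p g0 by (simp add: ennreal_mult mult.assoc mult_left_mono)
qed

end

section \<open>From cells to the whole space\<close>

definition orthant :: "(real^'n) \<times> real \<Rightarrow> 'n \<Rightarrow> bool" where
  "orthant z = (\<lambda>i. 0 \<le> fst z $ i)"

text \<open>
  The interval is from 2^(-j) to 2^j and the cube has side 16^j, so that ln L - ln a = 4 r lies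
  between 2 r and 8 r, which is admissible for r at least 1, and so for j at least 2.
\<close>

definition exhausting_cell :: "('n \<Rightarrow> bool) \<Rightarrow> nat \<Rightarrow> ((real^'n) \<times> real) set" where
  "exhausting_cell \<sigma> j = cz_cell (4 * int j) (\<lambda>i. if \<sigma> i then 0 else - 1) 1 (real j * ln 2)"

lemma exhausting_cell_CZ:
  assumes "2 \<le> j" shows "exhausting_cell \<sigma> j \<in> CZ_cells"
proof -
  have r: "1 \<le> real j * ln 2"
  proof -
    have "1 \<le> 2 * ln (2::real)" using ln2_ge_two_thirds by simp
    also have "\<dots> \<le> real j * ln 2" using assms by (intro mult_right_mono) auto
    finally show ?thesis .
  qed
  have "ln (2 powi (4 * int j) :: real) = 4 * (real j * ln 2)"
  proof -
    have "(2::real) powi (4 * int j) = 2 ^ (4 * j)" by (simp add: power_int_def nat_mult_distrib)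
    then show ?thesis by (simp add: ln_realpow)
  qed
  then have "CZ_admissible (2 powi (4 * int j)) 1 (real j * ln 2)"
    using r by (simp add: CZ_admissible_ln)
  then show ?thesis unfolding exhausting_cell_def CZ_cells_def using r by fastforce
qed

lemma mem_exhausting_cell:
  "z \<in> exhausting_cell \<sigma> j \<longleftrightarrow>
    (\<forall>i. if \<sigma> i then 0 \<le> fst z $ i \<and> fst z $ i < 16 ^ j else - (16 ^ j) \<le> fst z $ i \<and> fst z $ i < 0) \<and>
    1 / 2 ^ j \<le> snd z \<and> snd z < 2 ^ j"
proof -
  have e: "exp (real j * ln 2) = (2::real) ^ j" by (simp add: exp_of_nat_mult)
  then have e': "exp (- (real j * ln 2)) = 1 / (2::real) ^ j" by (simp add: exp_minus divide_inverse)
  have k: "(2::real) powi (4 * int j) = 16 ^ j" by (simp add: power_int_mult)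
  show ?thesis
    by (cases z) (simp add: exhausting_cell_def cz_cell_def dyadic_cube_def k e e' if_distrib cong: if_cong)
qed

lemma exhausting_cell_mono:
  assumes "i \<le> j" shows "exhausting_cell \<sigma> i \<subseteq> exhausting_cell \<sigma> j"
proof
  fix z :: "(real^'a) \<times> real" assume z: "z \<in> exhausting_cell \<sigma> i"
  have 1: "(16::real) ^ i \<le> 16 ^ j" "(2::real) ^ i \<le> 2 ^ j" using assms by (auto intro: power_increasing)
  have "1 / (2::real) ^ j \<le> 1 / 2 ^ i" using 1 by (intro divide_left_mono) auto
  moreover have "if \<sigma> k then 0 \<le> fst z $ k \<and> fst z $ k < 16 ^ j
      else - (16 ^ j) \<le> fst z $ k \<and> fst z $ k < 0" for k
  proof -
    have "if \<sigma> k then 0 \<le> fst z $ k \<and> fst z $ k < 16 ^ i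
      else - (16 ^ i) \<le> fst z $ k \<and> fst z $ k < 0" using z unfolding mem_exhausting_cell by blast
    then show ?thesis using 1(1) by (cases "\<sigma> k") (auto simp del: power_increasing_iff)
  qed
  moreover have "1 / 2 ^ i \<le> snd z" "snd z < 2 ^ i" using z unfolding mem_exhausting_cell by blast+
  ultimately show "z \<in> exhausting_cell \<sigma> j" using 1(2) unfolding mem_exhausting_cell by (auto simp del: power_increasing_iff)
qed

lemma exhausting_cell_eventually:
  assumes z: "z \<in> S_set"
  shows "\<forall>\<^sub>F j in sequentially. z \<in> exhausting_cell \<sigma> j \<longleftrightarrow> orthant z = \<sigma>"
proof -
  have a: "0 < snd z" using z by (auto simp: S_set_def)
  obtain N where N: "max (norm (fst z)) (max (snd z) (1 / snd z)) < 2 ^ N"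
    using real_arch_pow[of 2 "max (norm (fst z)) (max (snd z) (1 / snd z))"] by auto
  have "z \<in> exhausting_cell \<sigma> j \<longleftrightarrow> orthant z = \<sigma>" if j: "N \<le> j" for j
  proof -
    have p: "(2::real) ^ N \<le> 2 ^ j" "(2::real) ^ j \<le> 16 ^ j"
      using j by (auto intro: power_increasing power_mono)
    have x: "\<bar>fst z $ i\<bar> < 16 ^ j" for i
      using component_le_norm_cart[of "fst z" i] N p by (auto simp del: power_increasing_iff)
    have s: "snd z < 2 ^ j" "1 / snd z < 2 ^ j" using N p by (auto simp del: power_increasing_iff)
    have "1 / 2 ^ j \<le> snd z" using s(2) a by (simp add: field_simps)
    moreover have "(if \<sigma> i then 0 \<le> fst z $ i \<and> fst z $ i < 16 ^ j
        else - (16 ^ j) \<le> fst z $ i \<and> fst z $ i < 0) \<longleftrightarrow> (0 \<le> fst z $ i) = \<sigma> i" for i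
      using x[of i] by (cases "\<sigma> i") auto
    ultimately show ?thesis
      using s(1) unfolding mem_exhausting_cell orthant_def fun_eq_iff by simp
  qed
  then show ?thesis by (auto simp: eventually_sequentially)
qed

lemma measurable_orthant_fun:
  fixes c :: "('n::finite \<Rightarrow> bool) \<Rightarrow> 'b::{real_normed_vector, second_countable_topology}"
  shows "(\<lambda>z :: (real^'n) \<times> real. c (orthant z)) \<in> borel_measurable borel"
proof -
  have "{z :: (real^'n) \<times> real. orthant z = \<sigma>} \<in> sets borel" for \<sigma>
  proof -
    have "{z :: (real^'n) \<times> real. orthant z = \<sigma>}
        = (\<Inter>i. if \<sigma> i then {z. 0 \<le> fst z $ i} else {z. fst z $ i < 0})"
    proof -
      have "z \<in> (if \<sigma> i then {z. 0 \<le> fst z $ i} else {z. fst z $ i < 0}) \<longleftrightarrow> (0 \<le> fst z $ i) = \<sigma> i"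
        for i and z :: "(real^'n) \<times> real" by auto
      then show ?thesis unfolding orthant_def fun_eq_iff by blast
    qed
    also have "\<dots> \<in> sets borel"
    proof -
      have "{z :: (real^'n) \<times> real. 0 \<le> fst z $ i} \<in> sets borel"
        "{z :: (real^'n) \<times> real. fst z $ i < 0} \<in> sets borel" for i
        by (intro borel_closed closed_Collect_le continuous_intros)
          (intro borel_open open_Collect_less continuous_intros)
      then show ?thesis by (intro sets.countable_INT') auto
    qed
    finally show ?thesis .
  qed
  then have "(\<lambda>z :: (real^'n) \<times> real. \<Sum>\<sigma>\<in>UNIV. indicator {z. orthant z = \<sigma>} z *\<^sub>R c \<sigma>) \<in> borel_measurable borel"
    by (intro borel_measurable_sum borel_measurable_scaleR borel_measurable_indicator borel_measurable_const)
  moreover have "(\<Sum>\<sigma>\<in>UNIV. indicator {z. orthant z = \<sigma>} z *\<^sub>R c \<sigma>) = c (orthant z)" for z :: "(real^'n) \<times> real"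
  proof -
    have "(\<Sum>\<sigma>\<in>UNIV. indicator {z. orthant z = \<sigma>} z *\<^sub>R c \<sigma>) = (\<Sum>\<sigma>\<in>UNIV. if orthant z = \<sigma> then c \<sigma> else 0)"
      by (intro sum.cong) (auto simp: indicator_def)
    then show ?thesis by simp
  qed
  ultimately show ?thesis by simp
qed

lemma measurable_rho_borel: "g \<in> borel_measurable borel \<Longrightarrow> g \<in> borel_measurable rho"
  unfolding rho_def by (intro measurable_restrict_space1) simp

lemma L1_loc_orthant:
  fixes c :: "('n::finite \<Rightarrow> bool) \<Rightarrow> complex"
  shows "(\<lambda>z. c (orthant z)) \<in> L1_loc"
proof (rule L1_loc_bounded_by[where h = "\<lambda>_. 0" and C = "\<Sum>\<sigma>\<in>UNIV. norm (c \<sigma>)"])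
  show "(\<lambda>z. c (orthant z)) \<in> borel_measurable rho"
    by (intro measurable_rho_borel measurable_orthant_fun)
  show "norm (c (orthant z)) \<le> (\<Sum>\<sigma>\<in>UNIV. norm (c \<sigma>)) + 0" for z
    using member_le_sum[of "orthant z" UNIV "\<lambda>\<sigma>. norm (c \<sigma>)"] by simp
qed simp

lemma CZ_set_in_orthant:
  assumes "R \<in> CZ_sets"
  obtains \<sigma> where "\<And>z. z \<in> R \<Longrightarrow> orthant z = \<sigma>"
proof -
  obtain k m a r where R: "R = dyadic_cube k m \<times> {a * exp (- r) .. a * exp r}"
    using assms unfolding CZ_sets_def by blast
  have "orthant z = (\<lambda>i. 0 \<le> m i)" if "z \<in> R" for z
  proof
    fix i
    have z: "2 powi k * of_int (m i) \<le> fst z $ i" "fst z $ i < 2 powi k * (of_int (m i) + 1)"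
      using that by (auto simp: R dyadic_cube_def)
    show "orthant z i = (0 \<le> m i)"
    proof (cases "0 \<le> m i")
      case True
      have "0 \<le> fst z $ i" by (rule order_trans[OF _ z(1)]) (use True in simp)
      then show ?thesis using True by (simp add: orthant_def)
    next
      case False
      then have "of_int (m i) + 1 \<le> (0::real)" by linarith
      then have "(2::real) powi k * (of_int (m i) + 1) \<le> 0" by (intro mult_nonneg_nonpos) auto
      with z(2) have "fst z $ i < 0" by (rule less_le_trans)
      then show ?thesis using False by (simp add: orthant_def)
    qed
  qed
  then show thesis using that by blast
qed

text \<open>
  On each Calderon--Zygmund set the function is constant, because the set lies in a single
  orthant.
\<close>

lemma bmo_seminorm_orthant:
  fixes c :: "('n::finite \<Rightarrow> bool) \<Rightarrow> complex"
  shows "bmo_seminorm (\<lambda>z. c (orthant z)) = 0"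
proof -
  have "mean_osc (\<lambda>z. c (orthant z)) R = 0" if R: "R \<in> CZ_sets" for R
  proof (cases "measure rho R = 0")
    case True then show ?thesis by (simp add: mean_osc_def)
  next
    case False
    then have pos: "0 < measure rho R" by (simp add: zero_less_measure_iff)
    obtain \<sigma> where \<sigma>: "\<And>z. z \<in> R \<Longrightarrow> orthant z = \<sigma>" using CZ_set_in_orthant[OF R] by blast
    have "indicator R z *\<^sub>R norm (c (orthant z) - c \<sigma>) = 0" for z
      using \<sigma>[of z] by (cases "z \<in> R") auto
    then have "(LINT z:R|rho. norm (c (orthant z) - c \<sigma>)) = 0"
      by (simp only: set_lebesgue_integral_def Bochner_Integration.integral_zero)
    then have "mean_osc (\<lambda>z. c (orthant z)) R * measure rho R \<le> 0"
      using mean_osc_le_twice[OF CZ_set_integrable[OF L1_loc_orthant R] CZ_sets_rho[OF R] pos, of c "c \<sigma>"]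
      by simp
    then show ?thesis using pos mean_osc_nonneg[of "\<lambda>z. c (orthant z)" R]
      by (simp add: mult_le_0_iff)
  qed
  then show ?thesis unfolding bmo_seminorm_def by (intro antisym SUP_least) auto
qed

text \<open>
  Restricting the estimate on the j-th exhausting cell to the smallest one and applying Jensen's
  inequality there shows that the means over all these cells are at a bounded distance from
  the first one. Let l be the limit of a subsequence; the estimate passes to the limit by
  Fatou's lemma.
\<close>

lemma orthant_limit:
  fixes f :: "'n::finite S_fun" and \<sigma> :: "'n \<Rightarrow> bool"
  assumes f: "f \<in> L1_loc" and q: "1 \<le> q" and B: "0 \<le> B"
    and loc: "\<And>R0. R0 \<in> CZ_cells \<Longrightarrow>
      (\<integral>\<^sup>+z\<in>R0. ennreal (norm (f z - average f R0) powr q) \<partial>rho) \<le> ennreal B"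
  shows "\<exists>l. (\<integral>\<^sup>+z\<in>{z. orthant z = \<sigma>}. ennreal (norm (f z - l) powr q) \<partial>rho) \<le> ennreal B"
proof -
  note [measurable] = L1_loc_measurable[OF f]
  define E where "E j = exhausting_cell \<sigma> (j + 2)" for j
  have E: "E j \<in> CZ_cells" for j unfolding E_def by (rule exhausting_cell_CZ) simp
  note Er = CZ_cells_rho[OF E]
  define a where "a j = average f (E j)" for j
  define \<rho>0 where "\<rho>0 = measure rho (E 0)"
  have \<rho>0: "0 < \<rho>0" unfolding \<rho>0_def by (rule Er)
  have dist: "norm (a 0 - a j) \<le> (B / \<rho>0) powr (1 / q)" for j
  proof -
    let ?s = "norm (a 0 - a j)"
    have "ennreal (?s powr q) * emeasure rho (E 0) \<le> (\<integral>\<^sup>+z\<in>E 0. ennreal (norm (f z - a j) powr q) \<partial>rho)"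
    proof (rule jensen_powr[OF q])
      show "ennreal ?s * emeasure rho (E 0) \<le> (\<integral>\<^sup>+z\<in>E 0. ennreal (norm (f z - a j)) \<partial>rho)"
        unfolding a_def[of 0] by (rule norm_average_diff_le_nn[OF L1_loc_cell[OF f E] Er(1,2)])
    qed (use Er in auto)
    also have "\<dots> \<le> (\<integral>\<^sup>+z\<in>E j. ennreal (norm (f z - a j) powr q) \<partial>rho)"
    proof -
      have "E 0 \<subseteq> E j" unfolding E_def by (rule exhausting_cell_mono) simp
      then show ?thesis by (intro nn_integral_mono mult_left_mono) (auto simp: indicator_def)
    qed
    also have "\<dots> \<le> ennreal B" unfolding a_def by (rule loc[OF E])
    finally have "ennreal (?s powr q * \<rho>0) \<le> ennreal B"
      using Er(3)[of 0] \<rho>0 by (simp add: ennreal_mult \<rho>0_def)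
    then have "?s powr q \<le> B / \<rho>0" using B \<rho>0 by (simp add: field_simps)
    then have "(?s powr q) powr (1 / q) \<le> (B / \<rho>0) powr (1 / q)" using q by (intro powr_mono2) auto
    then show ?thesis using q by (simp add: powr_powr)
  qed
  have "bounded (range a)"
  proof (rule boundedI)
    fix y assume "y \<in> range a"
    then obtain j where "y = a j" by blast
    then show "norm y \<le> norm (a 0) + (B / \<rho>0) powr (1 / q)"
      using dist[of j] norm_triangle_ineq2[of "a j" "a 0"] by (simp add: norm_minus_commute)
  qed
  then obtain l r where r: "strict_mono (r :: nat \<Rightarrow> nat)" and l: "(a \<circ> r) \<longlonglongrightarrow> l"
    using bounded_imp_convergent_subsequence by blast
  define u where "u j z = ennreal (norm (f z - a (r j)) powr q) * indicator (E (r j)) z" for j z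
  have [measurable]: "u j \<in> borel_measurable rho" for j
    unfolding u_def using Er by measurable
  have "(\<integral>\<^sup>+z\<in>{z. orthant z = \<sigma>}. ennreal (norm (f z - l) powr q) \<partial>rho) \<le> (\<integral>\<^sup>+z. liminf (\<lambda>j. u j z) \<partial>rho)"
  proof (rule nn_integral_mono)
    fix z :: "(real^'n) \<times> real" assume "z \<in> space rho"
    then have zS: "z \<in> S_set" by (simp add: space_rho)
    show "ennreal (norm (f z - l) powr q) * indicator {z. orthant z = \<sigma>} z \<le> liminf (\<lambda>j. u j z)"
    proof (cases "orthant z = \<sigma>")
      case True
      have "\<forall>\<^sub>F j in sequentially. z \<in> exhausting_cell \<sigma> j"
        using exhausting_cell_eventually[OF zS, of \<sigma>] True by simp
      then obtain N where N: "\<And>j. N \<le> j \<Longrightarrow> z \<in> exhausting_cell \<sigma> j" by (auto simp: eventually_sequentially)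
      have "u j z = ennreal (norm (f z - a (r j)) powr q)" if "N \<le> j" for j
        using N[of "r j + 2"] seq_suble[OF r, of j] that by (simp add: u_def E_def)
      then have ev: "\<forall>\<^sub>F j in sequentially. ennreal (norm (f z - a (r j)) powr q) = u j z"
        by (intro eventually_sequentiallyI[of N]) simp
      have "(\<lambda>j. ennreal (norm (f z - a (r j)) powr q)) \<longlonglongrightarrow> ennreal (norm (f z - l) powr q)"
        using l q by (intro tendsto_ennrealI tendsto_powr' tendsto_intros) (auto simp: o_def)
      then have "(\<lambda>j. u j z) \<longlonglongrightarrow> ennreal (norm (f z - l) powr q)"
        by (rule Lim_transform_eventually[OF _ ev])
      then have "liminf (\<lambda>j. u j z) = ennreal (norm (f z - l) powr q)"
        by (intro lim_imp_Liminf) auto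
      then show ?thesis using True by simp
    qed simp
  qed
  also have "\<dots> \<le> liminf (\<lambda>j. \<integral>\<^sup>+z. u j z \<partial>rho)" by (rule nn_integral_liminf) measurable
  also have "\<dots> \<le> liminf (\<lambda>j. ennreal B)"
    using loc[OF E] unfolding u_def a_def by (intro Liminf_mono) auto
  also have "\<dots> = ennreal B" by (simp add: Liminf_const)
  finally show ?thesis by blast
qed

text \<open>
  Subtract from f, on each orthant, the constant of the previous lemma; the seminorm does not
  see the difference.
\<close>

lemma global_representative:
  fixes f :: "'n::finite S_fun"
  assumes f: "f \<in> L1_loc" and q: "1 \<le> q" and B: "0 \<le> B"
    and loc: "\<And>R0. R0 \<in> CZ_cells \<Longrightarrow>
      (\<integral>\<^sup>+z\<in>R0. ennreal (norm (f z - average f R0) powr q) \<partial>rho) \<le> ennreal B"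
  shows "\<exists>g. g \<in> Lp_fun q \<and> bmo_class f = bmo_class g \<and>
    Lp_norm q g \<le> (real CARD('n \<Rightarrow> bool) * B) powr (1 / q)"
proof -
  note [measurable] = L1_loc_measurable[OF f]
  have "\<forall>\<sigma>. \<exists>l. (\<integral>\<^sup>+z\<in>{z. orthant z = \<sigma>}. ennreal (norm (f z - l) powr q) \<partial>rho) \<le> ennreal B"
    by (intro allI orthant_limit[OF f q B loc])
  from choice[OF this] obtain c where
    c': "\<forall>\<sigma>. (\<integral>\<^sup>+z\<in>{z. orthant z = \<sigma>}. ennreal (norm (f z - c \<sigma>) powr q) \<partial>rho) \<le> ennreal B" ..
  note c = spec[OF c']
  define h where "h = (\<lambda>z :: (real^'n) \<times> real. c (orthant z))"
  define g where "g = (\<lambda>z. f z - h z)"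
  have hL: "h \<in> L1_loc" unfolding h_def by (rule L1_loc_orthant)
  have gL: "g \<in> L1_loc" unfolding g_def by (rule L1_loc_diff[OF f hL])
  note [measurable] = L1_loc_measurable[OF gL]
  have [measurable]: "{z \<in> space rho. orthant z = \<sigma>} \<in> sets rho" for \<sigma> :: "'n \<Rightarrow> bool"
  proof -
    have "(\<lambda>z :: (real^'n) \<times> real. if orthant z = \<sigma> then 1 else 0 :: real) \<in> borel_measurable rho"
      by (intro measurable_rho_borel measurable_orthant_fun)
    then have "{z \<in> space rho. (if orthant z = \<sigma> then 1 else 0 :: real) = 1} \<in> sets rho" by measurable
    moreover have "{z \<in> space rho. (if orthant z = \<sigma> then 1 else 0 :: real) = 1} = {z \<in> space rho. orthant z = \<sigma>}"
      by auto
    ultimately show ?thesis by simp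
  qed
  have "(\<integral>\<^sup>+z. ennreal (norm (g z) powr q) \<partial>rho)
      = (\<integral>\<^sup>+z. (\<Sum>\<sigma>\<in>UNIV. ennreal (norm (f z - c \<sigma>) powr q) * indicator {z \<in> space rho. orthant z = \<sigma>} z) \<partial>rho)"
  proof (intro nn_integral_cong)
    fix z :: "(real^'n) \<times> real" assume z: "z \<in> space rho"
    have "(\<Sum>\<sigma>\<in>UNIV. ennreal (norm (f z - c \<sigma>) powr q) * indicator {z \<in> space rho. orthant z = \<sigma>} z)
      = (\<Sum>\<sigma>\<in>UNIV. if orthant z = \<sigma> then ennreal (norm (f z - c \<sigma>) powr q) else 0)"
      using z by (intro sum.cong) (auto simp: indicator_def)
    then show "ennreal (norm (g z) powr q)
      = (\<Sum>\<sigma>\<in>UNIV. ennreal (norm (f z - c \<sigma>) powr q) * indicator {z \<in> space rho. orthant z = \<sigma>} z)"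
      by (simp add: g_def h_def)
  qed
  also have "\<dots> = (\<Sum>\<sigma>\<in>UNIV. \<integral>\<^sup>+z\<in>{z \<in> space rho. orthant z = \<sigma>}. ennreal (norm (f z - c \<sigma>) powr q) \<partial>rho)"
    by (rule nn_integral_sum) measurable
  also have "\<dots> = (\<Sum>\<sigma>\<in>UNIV. \<integral>\<^sup>+z\<in>{z. orthant z = \<sigma>}. ennreal (norm (f z - c \<sigma>) powr q) \<partial>rho)"
    by (intro sum.cong nn_integral_cong) (auto simp: indicator_def)
  also have "\<dots> \<le> (\<Sum>\<sigma>\<in>(UNIV :: ('n \<Rightarrow> bool) set). ennreal B)" by (intro sum_mono c)
  also have "\<dots> = ennreal (real CARD('n \<Rightarrow> bool) * B)"
    using B by (simp add: ennreal_mult ennreal_of_nat_eq_real_of_nat)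
  finally have le: "(\<integral>\<^sup>+z. ennreal (norm (g z) powr q) \<partial>rho) \<le> ennreal (real CARD('n \<Rightarrow> bool) * B)" .
  have int: "integrable rho (\<lambda>z. norm (g z) powr q)"
    using le by (intro integrableI_nonneg) (auto intro: le_less_trans)
  then have gLq: "g \<in> Lp_fun q" by (simp add: Lp_fun_def)
  have "bmo_seminorm (\<lambda>z. f z - g z) = 0"
    using bmo_seminorm_orthant[of c] by (simp add: g_def h_def)
  then have cls: "bmo_class f = bmo_class g" by (simp add: bmo_class_eq_iff[OF f gL])
  have "ennreal (LINT z|rho. norm (g z) powr q) \<le> ennreal (real CARD('n \<Rightarrow> bool) * B)"
    using le by (subst (asm) nn_integral_eq_integral[OF int]) auto
  then have "(LINT z|rho. norm (g z) powr q) \<le> real CARD('n \<Rightarrow> bool) * B"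
    using B by (subst (asm) ennreal_le_iff) auto
  then have "Lp_norm q g \<le> (real CARD('n \<Rightarrow> bool) * B) powr (1 / q)"
    unfolding Lp_norm_def using q by (intro powr_mono2) auto
  then show ?thesis using gLq cls by blast
qed

section \<open>The two inclusions\<close>

lemma interpolation_sub_Lp:
  fixes p q \<theta> :: real
  assumes pq: "1 \<le> p" "p < q" and \<theta>: "\<theta> * q = q - p"
  shows "\<exists>C>0. \<forall>x\<in>elems (real_interpolation (Lp_space p) BMO_space \<theta> q :: 'n::finite S_fun set normed_sp).
    x \<in> elems (Lp_space q) \<and>
    nrm (Lp_space q) x \<le> C * nrm (real_interpolation (Lp_space p) BMO_space \<theta> q) x"
proof -
  define g where "g = 1 / (2 powr (q + 1) * 2 ^ CARD('n) :: real)"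
  define A where "A = 2 powr (q + 1) * (2 powr p * ((2 / g) powr q * p))"
  have A: "0 < A" using pq by (simp add: A_def g_def)
  define C where "C = (real CARD('n \<Rightarrow> bool) * A) powr (1 / q)"
  have "0 < CARD('n \<Rightarrow> bool)" by (simp add: card_gt_0_iff)
  then have C: "0 < C" using A unfolding C_def by simp
  have "x \<in> elems (Lp_space q) \<and>
      nrm (Lp_space q) x \<le> C * nrm (real_interpolation (Lp_space p) BMO_space \<theta> q) x"
    if x: "x \<in> elems (real_interpolation (Lp_space p) BMO_space \<theta> q)" for x :: "'n S_fun set"
  proof -
    interpret class_sum p x using x pq by unfold_locales (auto simp: real_interpolation_def)
    let ?I = "interp_integral (Lp_space p) BMO_space \<theta> q x"
    have fin: "?I < \<infinity>" using x by (simp add: real_interpolation_def)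
    obtain x0 x1 where x01: "x0 \<in> elems (Lp_space p)" "x1 \<in> elems BMO_space" "x = x0 + x1" using sum by blast
    then obtain f0 f1 where f01: "f0 \<in> Lp_fun p" "f1 \<in> BMO_fun" "x = bmo_class f0 + bmo_class f1"
      by (auto simp: Lp_space_def BMO_space_def)
    have L: "f0 \<in> L1_loc" "f1 \<in> L1_loc" using f01 Lp_fun_L1_loc[OF pq(1)] by (auto simp: BMO_fun_def)
    define f where "f = f0 + f1"
    have f: "f \<in> L1_loc" using L1_loc_add[OF L] by (simp add: f_def plus_fun_def)
    have xf: "x = bmo_class f" using bmo_class_add[OF L] f01 by (simp add: f_def)
    define B where "B = A * enn2real ?I"
    have Beq: "ennreal B = ennreal A * ?I" using fin A by (simp add: B_def ennreal_mult)
    have B0: "0 \<le> B" using A by (simp add: B_def)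
    have "(\<integral>\<^sup>+z\<in>R0. ennreal (norm (f z - average f R0) powr q) \<partial>rho) \<le> ennreal B"
      if R0: "R0 \<in> CZ_cells" for R0
      unfolding Beq A_def by (rule local_interpolation_estimate[OF f xf R0 pq(2) \<theta> g_def])
    from global_representative[OF f _ B0 this] pq obtain h where h: "h \<in> Lp_fun q" "bmo_class f = bmo_class h"
      "Lp_norm q h \<le> (real CARD('n \<Rightarrow> bool) * B) powr (1 / q)" by auto
    have hx: "h \<in> x" using h xf bmo_class_self[OF Lp_fun_L1_loc, of q h] pq by simp
    have "nrm (Lp_space q) x \<le> Lp_norm q h" by (rule nrm_Lp_le[OF hx h(1)])
    also have "\<dots> \<le> (real CARD('n \<Rightarrow> bool) * B) powr (1 / q)" by (rule h)
    also have "\<dots> = C * enn2real ?I powr (1 / q)"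
      using A by (simp add: C_def B_def powr_mult mult_ac)
    also have "enn2real ?I powr (1 / q) = nrm (real_interpolation (Lp_space p) BMO_space \<theta> q) x"
      by (simp add: real_interpolation_def)
    finally have "nrm (Lp_space q) x \<le> C * nrm (real_interpolation (Lp_space p) BMO_space \<theta> q) x" .
    moreover have "x \<in> elems (Lp_space q)" using h xf by (auto simp: Lp_space_def)
    ultimately show ?thesis by simp
  qed
  then show ?thesis using C by blast
qed

text \<open>
  Above the height s, |f|^p is at most s^(p-q) |f|^q.
\<close>

lemma truncation:
  fixes f :: "'n::finite S_fun"
  assumes p: "1 \<le> p" "p < q" and f: "f \<in> Lp_fun q" and s: "0 < s"
  defines "f0 \<equiv> (\<lambda>z. if s < norm (f z) then f z else 0)"
    and "f1 \<equiv> (\<lambda>z. if s < norm (f z) then 0 else f z)"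
  shows "f0 \<in> Lp_fun p" "f1 \<in> BMO_fun" "bmo_class f = bmo_class f0 + bmo_class f1"
    "enn2real (bmo_seminorm f1) \<le> 2 * s"
proof -
  have [measurable]: "f \<in> borel_measurable rho" and fi: "integrable rho (\<lambda>z. norm (f z) powr q)"
    using f by (auto simp: Lp_fun_def)
  have "integrable rho (\<lambda>z. norm (f0 z) powr p)"
  proof (rule Bochner_Integration.integrable_bound[OF integrable_mult_right[OF fi, of "s powr (p - q)"]])
    show "(\<lambda>z. norm (f0 z) powr p) \<in> borel_measurable rho" unfolding f0_def by measurable
    show "AE z in rho. norm (norm (f0 z) powr p) \<le> norm (s powr (p - q) * norm (f z) powr q)"
    proof (rule AE_I2)
      fix z
      have "norm (f z) powr p \<le> s powr (p - q) * norm (f z) powr q" if "s < norm (f z)"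
      proof -
        have "norm (f z) powr p = norm (f z) powr (p - q) * norm (f z) powr q"
          using that s by (simp add: powr_add[symmetric])
        also have "\<dots> \<le> s powr (p - q) * norm (f z) powr q"
          using that s p by (intro mult_right_mono powr_mono2') auto
        finally show ?thesis .
      qed
      then show "norm (norm (f0 z) powr p) \<le> norm (s powr (p - q) * norm (f z) powr q)"
        using p by (simp add: f0_def)
    qed
  qed
  moreover have [measurable]: "f0 \<in> borel_measurable rho" "f1 \<in> borel_measurable rho"
    unfolding f0_def f1_def by measurable
  ultimately show f0: "f0 \<in> Lp_fun p" by (simp add: Lp_fun_def)
  have bd: "norm (f1 z) \<le> s" for z using s by (simp add: f1_def)
  have f1L: "f1 \<in> L1_loc"
    by (rule L1_loc_bounded_by[where h = "\<lambda>_. 0" and C = s]) (use bd in auto)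
  have osc: "mean_osc f1 R \<le> 2 * s" if R: "R \<in> CZ_sets" for R
  proof (cases "measure rho R = 0")
    case True then show ?thesis using s by (simp add: mean_osc_def)
  next
    case False
    then have pos: "0 < measure rho R" by (simp add: zero_less_measure_iff)
    note fR = CZ_set_integrable[OF f1L R] and Rs = CZ_sets_rho[OF R]
    have fin: "emeasure rho R < \<infinity>" using emeasure_eq_measure_of_pos[OF pos] by simp
    have "(LINT z:R|rho. norm (f1 z)) \<le> (LINT z:R|rho. s)"
      using fR fin Rs bd by (intro set_integral_mono set_integrable_norm)
        (auto simp: set_integrable_def intro!: integrable_scaleR_left integrable_real_indicator)
    also have "\<dots> = s * measure rho R" using fin Rs by (simp add: set_integral_const)
    finally have "mean_osc f1 R * measure rho R \<le> (2 * s) * measure rho R"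
      using mean_osc_le_twice[OF fR Rs pos, of 0] by simp
    then show ?thesis using pos by simp
  qed
  have le: "bmo_seminorm f1 \<le> ennreal (2 * s)"
    unfolding bmo_seminorm_def by (intro SUP_least ennreal_leI osc)
  show f1: "f1 \<in> BMO_fun" using f1L le by (auto simp: BMO_fun_def intro: le_less_trans)
  show "enn2real (bmo_seminorm f1) \<le> 2 * s"
    using le s by (intro enn2real_leI) auto
  have "f0 + f1 = f" by (auto simp: f0_def f1_def fun_eq_iff)
  then show "bmo_class f = bmo_class f0 + bmo_class f1"
    using bmo_class_add[OF Lp_fun_L1_loc[OF p(1) f0] f1L] by simp
qed

text \<open>
  With G(s) the integral of |f|^p over the set where |f| exceeds s, truncation at s gives K(t)
  \<le> G(s)^(1/p) + 2 t s. So t \<le> G(s)^(1/p)/s whenever s < K(t)/(3t). After the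
  exchange, s^(-p) G(s) is integrated against d(s^q), and the layer-cake formula for the
  measure with density |f|^p gives a multiple of the integral of |f|^q.
\<close>

lemma interp_integral_le_Lp:
  fixes f :: "'n::finite S_fun"
  assumes pq: "1 \<le> p" "p < q" and \<theta>: "\<theta> * q = q - p" and f: "f \<in> Lp_fun q"
  shows "class_sum p (bmo_class f)"
    "ennreal ((1 / 3) powr q * p) * interp_integral (Lp_space p) BMO_space \<theta> q (bmo_class f)
      \<le> ennreal (q / (q - p)) * ennreal (LINT z|rho. norm (f z) powr q)"
proof -
  let ?x = "bmo_class f"
  note tr = truncation[OF pq f]
  have fm[measurable]: "f \<in> borel_measurable rho" and fi: "integrable rho (\<lambda>z. norm (f z) powr q)"
    using f by (auto simp: Lp_fun_def)
  show cs: "class_sum p ?x"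
  proof
    show "\<exists>x0\<in>elems (Lp_space p). \<exists>x1\<in>elems BMO_space. ?x = x0 + x1"
    proof (intro bexI)
      show "?x = bmo_class (\<lambda>z. if 1 < norm (f z) then f z else 0)
          + bmo_class (\<lambda>z. if 1 < norm (f z) then 0 else f z)" by (rule tr(3)) simp
      show "bmo_class (\<lambda>z. if 1 < norm (f z) then f z else 0) \<in> elems (Lp_space p)"
        unfolding Lp_space_def using tr(1)[of 1] by simp
      show "bmo_class (\<lambda>z. if 1 < norm (f z) then 0 else f z) \<in> elems BMO_space"
        unfolding BMO_space_def using tr(2)[of 1] by simp
    qed
  qed (rule pq)
  interpret class_sum p ?x by (rule cs)
  let ?K = "\<lambda>t. if 0 < t then K_Lp_BMO p t ?x else 0"
  define \<nu> where "\<nu> = density rho (\<lambda>z. ennreal (norm (f z) powr p))"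
  have s\<nu>: "sigma_finite_measure \<nu>"
    unfolding \<nu>_def by (subst sigma_finite_measure.sigma_finite_iff_density_finite[OF sigma_finite_rho]) auto
  have [measurable]: "f \<in> borel_measurable \<nu>" by (simp add: \<nu>_def)
  define G where "G s = emeasure \<nu> {z \<in> space \<nu>. s < norm (f z)}" for s
  have [measurable]: "G \<in> borel_measurable borel"
    unfolding G_def by (rule measurable_distribution[OF s\<nu>]) simp
  have G: "G s = ennreal (Lp_norm p (\<lambda>z. if s < norm (f z) then f z else 0) powr p)" if s: "0 < s" for s
  proof -
    let ?f0 = "\<lambda>z. if s < norm (f z) then f z else 0"
    have "G s = (\<integral>\<^sup>+z. ennreal (norm (f z) powr p) * indicator {z \<in> space rho. s < norm (f z)} z \<partial>rho)"
      unfolding G_def \<nu>_def by (subst emeasure_density) auto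
    also have "\<dots> = (\<integral>\<^sup>+z. ennreal (norm (?f0 z) powr p) \<partial>rho)"
      using pq by (intro nn_integral_cong) (auto simp: indicator_def)
    also have "\<dots> = ennreal (LINT z|rho. norm (?f0 z) powr p)"
      using tr(1)[OF s] by (intro nn_integral_eq_integral) (auto simp: Lp_fun_def)
    also have "\<dots> = ennreal (Lp_norm p ?f0 powr p)"
      using pq by (simp add: Lp_norm_def powr_powr integral_nonneg_AE)
    finally show ?thesis .
  qed
  define B where "B s = (if 0 < s then enn2real (G s) powr (1 / p) / s else 0)" for s
  have "(\<integral>\<^sup>+t. ennreal (((1 / 3) * (?K t / t)) powr q) \<partial>power_measure p) \<le> (\<integral>\<^sup>+s. ennreal (B s powr p) \<partial>power_measure q)"
  proof (rule tonelli_exchange)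
    show "B \<in> borel_measurable borel" unfolding B_def by measurable
    show "0 \<le> (1 / 3) * (?K t / t)" if "0 < t" for t using that K_nonneg[of t] by simp
    show "t \<le> B s" if s: "0 < s" and t: "0 < t" and lt: "s < (1 / 3) * (?K t / t)" for s t
    proof (rule ccontr)
      assume "\<not> t \<le> B s"
      then have "enn2real (G s) powr (1 / p) < t * s" using s by (simp add: B_def field_simps)
      moreover have "enn2real (G s) powr (1 / p) = Lp_norm p (\<lambda>z. if s < norm (f z) then f z else 0)"
        using pq s by (simp add: G powr_powr Lp_norm_nonneg)
      moreover have "K_Lp_BMO p t ?x \<le> Lp_norm p (\<lambda>z. if s < norm (f z) then f z else 0)
          + t * enn2real (bmo_seminorm (\<lambda>z. if s < norm (f z) then 0 else f z))"
        using tr[OF s] t by (intro K_le p) auto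
      moreover have "t * enn2real (bmo_seminorm (\<lambda>z. if s < norm (f z) then 0 else f z)) \<le> t * (2 * s)"
        using tr(4)[OF s] t by (intro mult_left_mono) auto
      ultimately have "K_Lp_BMO p t ?x < 3 * (t * s)" by linarith
      then show False using lt t by (simp add: field_simps)
    qed
  qed (use pq in \<open>auto simp: B_def\<close>)
  also have "\<dots> = (\<integral>\<^sup>+s. ennreal (s powr (- p)) * G s \<partial>power_measure q)"
  proof (rule nn_integral_cong_AE)
    show "AE s in power_measure q. ennreal (B s powr p) = ennreal (s powr (- p)) * G s"
      using AE_power_measure_pos
    proof eventually_elim
      case (elim s)
      have "B s powr p = s powr (- p) * enn2real (G s)"
        using elim p by (simp add: B_def powr_divide powr_powr powr_minus_divide)
      then show ?case using elim by (simp add: ennreal_mult' G)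
    qed
  qed
  also have "\<dots> = ennreal (q / (q - p)) * (\<integral>\<^sup>+s. G s \<partial>power_measure (q - p))"
    by (rule nn_integral_power_measure_weight) (use pq in auto)
  also have "(\<integral>\<^sup>+s. G s \<partial>power_measure (q - p)) = (\<integral>\<^sup>+z. ennreal (norm (f z) powr (q - p)) \<partial>\<nu>)"
    unfolding G_def by (rule layer_cake[symmetric, OF s\<nu>]) (use pq in auto)
  also have "\<dots> = (\<integral>\<^sup>+z. ennreal (norm (f z) powr p) * ennreal (norm (f z) powr (q - p)) \<partial>rho)"
    unfolding \<nu>_def by (subst nn_integral_density) auto
  also have "\<dots> = (\<integral>\<^sup>+z. ennreal (norm (f z) powr q) \<partial>rho)"
    by (intro nn_integral_cong) (simp add: ennreal_mult[symmetric] powr_add[symmetric])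
  also have "\<dots> = ennreal (LINT z|rho. norm (f z) powr q)"
    using fi by (intro nn_integral_eq_integral) auto
  finally show "ennreal ((1 / 3) powr q * p) * interp_integral (Lp_space p) BMO_space \<theta> q ?x
      \<le> ennreal (q / (q - p)) * ennreal (LINT z|rho. norm (f z) powr q)"
    using interp_integral_power_measure[of "1 / 3" q \<theta>] pq \<theta> by simp
qed

lemma Lp_sub_interpolation:
  fixes p q \<theta> :: real
  assumes p: "1 \<le> p" "p < q" and \<theta>: "\<theta> * q = q - p"
  shows "\<exists>C>0. \<forall>x\<in>elems (Lp_space q :: 'n::finite S_fun set normed_sp).
    x \<in> elems (real_interpolation (Lp_space p) BMO_space \<theta> q) \<and>
    nrm (real_interpolation (Lp_space p) BMO_space \<theta> q) x \<le> C * nrm (Lp_space q) x"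
proof -
  define A where "A = (q / (q - p)) / ((1 / 3) powr q * p)"
  have A: "0 < A" using p by (simp add: A_def)
  define C where "C = A powr (1 / q)"
  have C: "0 < C" using A by (simp add: C_def)
  have q: "1 \<le> q" using p by simp
  let ?I = "\<lambda>x :: 'n S_fun set. interp_integral (Lp_space p) BMO_space \<theta> q x"
  have main: "?I (bmo_class f) \<le> ennreal (A * (LINT z|rho. norm (f z) powr q))" if f: "f \<in> Lp_fun q" for f :: "'n S_fun"
  proof -
    define c where "c = (1 / 3) powr q * p"
    have c: "0 < c" using p by (simp add: c_def)
    have i0: "0 \<le> (LINT z|rho. norm (f z) powr q)" by (simp add: integral_nonneg_AE)
    have "c * A = q / (q - p)" using p by (simp add: A_def c_def)
    then have "ennreal (q / (q - p)) = ennreal c * ennreal A"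
      using c A by (simp add: ennreal_mult[symmetric])
    then have "ennreal c * ?I (bmo_class f) \<le> ennreal c * ennreal (A * (LINT z|rho. norm (f z) powr q))"
      using interp_integral_le_Lp(2)[OF p \<theta> f] A i0 by (simp add: c_def ennreal_mult mult_ac)
    then show ?thesis using c by (subst (asm) ennreal_mult_le_mult_iff) auto
  qed
  have "x \<in> elems (real_interpolation (Lp_space p) BMO_space \<theta> q) \<and>
    nrm (real_interpolation (Lp_space p) BMO_space \<theta> q) x \<le> C * nrm (Lp_space q) x"
    if x: "x \<in> elems (Lp_space q)" for x :: "'n S_fun set"
  proof -
    obtain f where f: "f \<in> Lp_fun q" "x = bmo_class f" using x by (auto simp: Lp_space_def)
    have "?I x < \<infinity>" using main[OF f(1)] f(2) by (auto intro: le_less_trans)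
    moreover have "\<exists>x0\<in>elems (Lp_space p). \<exists>x1\<in>elems BMO_space. x = x0 + x1"
      using interp_integral_le_Lp(1)[OF p \<theta> f(1)] f(2) by (simp add: class_sum_def)
    ultimately have el: "x \<in> elems (real_interpolation (Lp_space p) BMO_space \<theta> q)"
      by (simp add: real_interpolation_def)
    let ?N = "nrm (real_interpolation (Lp_space p) BMO_space \<theta> q) x"
    have "?N / C \<le> Lp_norm q g" if g: "g \<in> x \<inter> Lp_fun q" for g
    proof -
      have gL: "g \<in> L1_loc" and fL: "f \<in> L1_loc" using g f Lp_fun_L1_loc[OF q] by auto
      have "bmo_class g = bmo_class f"
        using g f by (simp add: bmo_class_eq_iff[OF gL fL]) (simp add: bmo_class_def)
      then have "?I x \<le> ennreal (A * (LINT z|rho. norm (g z) powr q))"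
        using main[of g] g f by simp
      then have "enn2real (?I x) \<le> A * (LINT z|rho. norm (g z) powr q)"
        using A by (intro enn2real_leI) (auto intro!: mult_nonneg_nonneg integral_nonneg_AE)
      then have "enn2real (?I x) powr (1 / q) \<le> (A * (LINT z|rho. norm (g z) powr q)) powr (1 / q)"
        using q by (intro powr_mono2) auto
      also have "\<dots> = C * Lp_norm q g"
        using A by (simp add: C_def Lp_norm_def powr_mult integral_nonneg_AE)
      finally show ?thesis using C by (simp add: real_interpolation_def field_simps)
    qed
    then have "?N / C \<le> (INF g\<in>x \<inter> Lp_fun q. Lp_norm q g)"
      using elems_Lp_nonempty[OF q x] by (intro cINF_greatest)
    then have "?N \<le> C * nrm (Lp_space q) x" using C by (simp add: Lp_space_def field_simps)
    then show ?thesis using el by simp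
  qed
  then show ?thesis using C by blast
qed

theorem corollary5p4:
  fixes q1 q \<theta> :: real
  assumes "1 < q1" and "q1 < q"
    and "0 < \<theta>" and "\<theta> < 1"
    and "1 / q = (1 - \<theta>) / q1"
  shows "eq_equiv_norms
    (real_interpolation (Lp_space q1) BMO_space \<theta> q)
    (Lp_space q :: 'n::finite S_fun set normed_sp)"
proof -
  let ?X = "real_interpolation (Lp_space q1) BMO_space \<theta> q :: 'n S_fun set normed_sp"
  let ?Y = "Lp_space q :: 'n S_fun set normed_sp"
  have p: "1 \<le> q1" using assms by simp
  have \<theta>: "\<theta> * q = q - q1" using assms by (simp add: field_simps)
  obtain C1 where C1: "0 < C1" "\<And>x. x \<in> elems ?X \<Longrightarrow> x \<in> elems ?Y \<and> nrm ?Y x \<le> C1 * nrm ?X x"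
    using interpolation_sub_Lp[OF p assms(2) \<theta>] by blast
  obtain C2 where C2: "0 < C2" "\<And>x. x \<in> elems ?Y \<Longrightarrow> x \<in> elems ?X \<and> nrm ?X x \<le> C2 * nrm ?Y x"
    using Lp_sub_interpolation[OF p assms(2) \<theta>] by blast
  have eq: "elems ?X = elems ?Y" using C1 C2 by blast
  have "nrm ?X x \<le> max C1 C2 * nrm ?Y x \<and> nrm ?Y x \<le> max C1 C2 * nrm ?X x" if x: "x \<in> elems ?X" for x
  proof
    have "0 \<le> nrm ?Y x" using nrm_Lp_nonneg[of q x] x eq p assms by auto
    then have "C2 * nrm ?Y x \<le> max C1 C2 * nrm ?Y x" by (intro mult_right_mono) auto
    then show "nrm ?X x \<le> max C1 C2 * nrm ?Y x" using C2(2)[of x] x eq by auto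
    have "0 \<le> nrm ?X x" by (simp add: real_interpolation_def)
    then have "C1 * nrm ?X x \<le> max C1 C2 * nrm ?X x" by (intro mult_right_mono) auto
    then show "nrm ?Y x \<le> max C1 C2 * nrm ?X x" using C1(2)[of x] x by auto
  qed
  then show ?thesis
    unfolding eq_equiv_norms_def using eq C1(1) by (auto intro!: exI[of _ "max C1 C2"])
qed

end
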